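(* Let $A\subset X$ and let $\varepsilon>0$. Then there exists an open set $W\subset X$ such that $W\cup b_1A=X$ and $\mathrm{Cap}_1(W\cap A)<\varepsilon$.
   Context: Standing assumptions: $(X,d,\mu)$ is a complete metric space with at least two points, equipped with a Borel regular outer measure $\mu$ that is doubling: there is $C_d\ge 1$ with $0<\mu(B(x,2r))\le C_d\,\mu(B(x,r))<\infty$ for every ball $B(x,r):=\{y\in X: d(y,x)<r\}$. All functions take values in $[-\infty,\infty]$. A curve is a nonconstant rectifiable continuous map from a compact interval into $X$. A nonnegative Borel function $g$ on $X$ is an upper gradient of a function $u$ on $X$ if $|u(x)-u(y)|\le\int_\gamma g\,ds$ for every curve $\gamma$ with end points $x,y$ (where $|u(x)-u(y)|:=\infty$ if at least one of $|u(x)|,|u(y)|$ is infinite). It is assumed that $X$ supports a $(1,1)$-Poincaré inequality: there are $C_P>0$, $\lambda\ge1$ such that for every ball $B(x,r)$, every $u\in L^1_{\mathrm{loc}}(X)$ and every upper gradient $g$ of $u$, $\frac{1}{\mu(B(x,r))}\int_{B(x,r)}|u-u_{B(x,r)}|\,d\mu\le C_P\, r\,\frac{1}{\mu(B(x,\lambda r))}\int_{B(x,\lambda r)}g\,d\mu$, where $u_{B(x,r)}$ is the mean value of $u$ over $B(x,r)$. Newton–Sobolev space: $\|u\|_{N^{1,1}(X)}:=\|u\|_{L^1(X)}+\inf\|g\|_{L^1(X)}$, the infimum over all $1$-weak upper gradients $g$ of $u$ (i.e. the upper gradient inequality holds for all curves outside a family of zero $1$-modulus), and $N^{1,1}(X):=\{u:\|u\|_{N^{1,1}(X)}<\infty\}$;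 such functions are defined at every point of $X$. Capacities: for $A\subset X$, $\mathrm{Cap}_1(A):=\inf\|u\|_{N^{1,1}(X)}$ over all $u\in N^{1,1}(X)$ with $u\ge1$ on $A$. For $A\subset D\subset X$, $\mathrm{cap}_1(A,D):=\inf\int_X g_u\,d\mu$ over all $u\in N^{1,1}(X)$ with $u\ge1$ on $A$ and $u=0$ on $X\setminus D$, and all upper gradients $g_u$ of $u$. A set $A\subset X$ is $1$-thin at $x\in X$ if $\lim_{r\to0} r\,\frac{\mathrm{cap}_1(A\cap B(x,r),B(x,2r))}{\mu(B(x,r))}=0$, and $1$-thick at $x$ if it is not $1$-thin at $x$. The $1$-base $b_1A$ is the set of points $x\in X$ at which $A$ is $1$-thick. "Open" without further qualification refers to the metric topology of $X$. *)

theory Defs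
  imports "HOL-Analysis.Analysis"
begin

section \<open>Borel regular outer measures\<close>

definition borel_regular_outer_measure :: "('a::topological_space set \<Rightarrow> ennreal) \<Rightarrow> bool" where
  "borel_regular_outer_measure \<mu> \<longleftrightarrow>
     outer_measure_space UNIV \<mu> \<and>
     sets borel \<subseteq> lambda_system UNIV UNIV \<mu> \<and>
     (\<forall>A. \<exists>B \<in> sets borel. A \<subseteq> B \<and> \<mu> B = \<mu> A)"

text \<open>
  The measure obtained by restricting the outer measure to its Caratheodory-measurable sets.
  ``Measurable'' functions and all integrals below refer to it.
\<close>
definition outer_to_measure :: "('a set \<Rightarrow> ennreal) \<Rightarrow> 'a measure" where
  "outer_to_measure \<mu> = measure_of UNIV (lambda_system UNIV UNIV \<mu>) \<mu>"

lemma measure_space_outer: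
  assumes "outer_measure_space UNIV (\<mu> :: 'a set \<Rightarrow> ennreal)"
  shows "measure_space UNIV (lambda_system UNIV UNIV \<mu>) \<mu>"
  using sigma_algebra.caratheodory_lemma[OF sigma_algebra_Pow[of "UNIV :: 'a set"], of \<mu>] assms
  by simp

lemma space_outer_to_measure [simp]: "space (outer_to_measure \<mu>) = UNIV"
  by (simp add: outer_to_measure_def space_measure_of_conv)

lemma sets_outer_to_measure:
  assumes "outer_measure_space UNIV (\<mu> :: 'a set \<Rightarrow> ennreal)"
  shows "sets (outer_to_measure \<mu>) = lambda_system UNIV UNIV \<mu>"
  using measure_space_outer[OF assms]
  by (simp add: outer_to_measure_def measure_space_def sigma_algebra.sigma_sets_eq)

lemma emeasure_outer_to_measure:
  assumes "outer_measure_space UNIV (\<mu> :: 'a set \<Rightarrow> ennreal)"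
    and "A \<in> lambda_system UNIV UNIV \<mu>"
  shows "emeasure (outer_to_measure \<mu>) A = \<mu> A"
  using measure_space_outer[OF assms(1)] assms(2)
  unfolding outer_to_measure_def measure_space_def
  by (intro emeasure_measure_of_sigma) auto

definition doubling :: "('a::metric_space set \<Rightarrow> ennreal) \<Rightarrow> bool" where
  "doubling \<mu> \<longleftrightarrow>
     (\<exists>C::real. C \<ge> 1 \<and>
       (\<forall>x. \<forall>r>0. 0 < \<mu> (ball x (2 * r)) \<and>
                   \<mu> (ball x (2 * r)) \<le> ennreal C * \<mu> (ball x r) \<and>
                   ennreal C * \<mu> (ball x r) < \<infinity>))"

section \<open>Curves and upper gradients\<close>

text \<open>A triple \<open>(\<gamma>, a, b)\<close> stands for the restriction of \<open>\<gamma>\<close> to the compact interval \<open>{a..b}\<close>.\<close>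
type_synonym 'a curve = "(real \<Rightarrow> 'a) \<times> real \<times> real"

definition curve_length :: "(real \<Rightarrow> 'a::metric_space) \<Rightarrow> real \<Rightarrow> real \<Rightarrow> ennreal" where
  "curve_length \<gamma> a b =
     (SUP (n, t) \<in> {(n::nat, t :: nat \<Rightarrow> real).
                     (\<forall>i<n. t i \<le> t (Suc i)) \<and> (\<forall>i\<le>n. t i \<in> {a..b})}.
        ennreal (\<Sum>i<n. dist (\<gamma> (t i)) (\<gamma> (t (Suc i)))))"

definition curves :: "'a::metric_space curve set" where
  "curves = {(\<gamma>, a, b). a < b \<and> continuous_on {a..b} \<gamma> \<and> curve_length \<gamma> a b < \<infinity> \<and>
                        \<not> \<gamma> constant_on {a..b}}"

text \<open>
  The point at arc length \<open>l\<close> along the curve.  The choice of \<open>s\<close> is immaterial, because a curve is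
  constant on every interval of parameters on which its length function is constant.
\<close>
definition arc_length_param :: "'a::metric_space curve \<Rightarrow> real \<Rightarrow> 'a" where
  "arc_length_param = (\<lambda>(\<gamma>, a, b) l. \<gamma> (SOME s. s \<in> {a..b} \<and> curve_length \<gamma> a s = ennreal l))"

definition curve_integral :: "'a::metric_space curve \<Rightarrow> ('a \<Rightarrow> ennreal) \<Rightarrow> ennreal" where
  "curve_integral = (\<lambda>(\<gamma>, a, b) g.
     \<integral>\<^sup>+ l \<in> {0..enn2real (curve_length \<gamma> a b)}. g (arc_length_param (\<gamma>, a, b) l) \<partial>lborel)"

definition ext_diff :: "ereal \<Rightarrow> ereal \<Rightarrow> ennreal" where
  "ext_diff p q = (if \<bar>p\<bar> = \<infinity> \<or> \<bar>q\<bar> = \<infinity> then \<infinity> else e2ennreal \<bar>p - q\<bar>)"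

definition upper_gradient_ineq :: "('a::metric_space \<Rightarrow> ereal) \<Rightarrow> ('a \<Rightarrow> ennreal) \<Rightarrow> 'a curve \<Rightarrow> bool" where
  "upper_gradient_ineq u g =
     (\<lambda>(\<gamma>, a, b). ext_diff (u (\<gamma> a)) (u (\<gamma> b)) \<le> curve_integral (\<gamma>, a, b) g)"

definition upper_gradient :: "('a::metric_space \<Rightarrow> ereal) \<Rightarrow> ('a \<Rightarrow> ennreal) \<Rightarrow> bool" where
  "upper_gradient u g \<longleftrightarrow>
     g \<in> borel_measurable borel \<and> (\<forall>c \<in> curves. upper_gradient_ineq u g c)"

definition modulus1 :: "('a::metric_space set \<Rightarrow> ennreal) \<Rightarrow> 'a curve set \<Rightarrow> ennreal" where
  "modulus1 \<mu> \<Gamma> =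
     (INF \<rho> \<in> {\<rho> \<in> borel_measurable borel. \<forall>c \<in> \<Gamma>. curve_integral c \<rho> \<ge> 1}.
        \<integral>\<^sup>+ x. \<rho> x \<partial>outer_to_measure \<mu>)"

definition weak_upper_gradient ::
    "('a::metric_space set \<Rightarrow> ennreal) \<Rightarrow> ('a \<Rightarrow> ereal) \<Rightarrow> ('a \<Rightarrow> ennreal) \<Rightarrow> bool" where
  "weak_upper_gradient \<mu> u g \<longleftrightarrow>
     g \<in> borel_measurable borel \<and>
     (\<exists>\<Gamma> \<subseteq> curves. modulus1 \<mu> \<Gamma> = 0 \<and> (\<forall>c \<in> curves - \<Gamma>. upper_gradient_ineq u g c))"

section \<open>Poincare inequality\<close>

definition L1_loc :: "('a::metric_space set \<Rightarrow> ennreal) \<Rightarrow> ('a \<Rightarrow> ereal) set" where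
  "L1_loc \<mu> = {u \<in> borel_measurable (outer_to_measure \<mu>).
     \<forall>x. \<exists>r>0. (\<integral>\<^sup>+ y \<in> ball x r. e2ennreal \<bar>u y\<bar> \<partial>outer_to_measure \<mu>) < \<infinity>}"

text \<open>
  Under the standing assumptions \<open>X\<close> is proper, so a function in \<open>L1_loc\<close> is integrable on each ball;
  it is then finite almost everywhere and \<^const>\<open>real_of_ereal\<close> changes it only on a null set.
\<close>
definition ball_mean :: "('a::metric_space set \<Rightarrow> ennreal) \<Rightarrow> ('a \<Rightarrow> ereal) \<Rightarrow> 'a \<Rightarrow> real \<Rightarrow> real" where
  "ball_mean \<mu> u x r =
     (LINT y : ball x r | outer_to_measure \<mu>. real_of_ereal (u y)) / enn2real (\<mu> (ball x r))"

definition poincare_1_1 :: "('a::metric_space set \<Rightarrow> ennreal) \<Rightarrow> bool" where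
  "poincare_1_1 \<mu> \<longleftrightarrow>
     (\<exists>C::real. \<exists>\<tau>::real. C > 0 \<and> \<tau> \<ge> 1 \<and>
       (\<forall>x. \<forall>r>0. \<forall>u \<in> L1_loc \<mu>. \<forall>g. upper_gradient u g \<longrightarrow>
          (\<integral>\<^sup>+ y \<in> ball x r. e2ennreal \<bar>u y - ereal (ball_mean \<mu> u x r)\<bar> \<partial>outer_to_measure \<mu>)
              / \<mu> (ball x r)
          \<le> ennreal (C * r) *
              ((\<integral>\<^sup>+ y \<in> ball x (\<tau> * r). g y \<partial>outer_to_measure \<mu>) / \<mu> (ball x (\<tau> * r)))))"

section \<open>Newton--Sobolev functions and capacities\<close>

definition N11_norm :: "('a::metric_space set \<Rightarrow> ennreal) \<Rightarrow> ('a \<Rightarrow> ereal) \<Rightarrow> ennreal" where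
  "N11_norm \<mu> u =
     (\<integral>\<^sup>+ x. e2ennreal \<bar>u x\<bar> \<partial>outer_to_measure \<mu>) +
     (INF g \<in> {g. weak_upper_gradient \<mu> u g}. \<integral>\<^sup>+ x. g x \<partial>outer_to_measure \<mu>)"

definition N11 :: "('a::metric_space set \<Rightarrow> ennreal) \<Rightarrow> ('a \<Rightarrow> ereal) set" where
  "N11 \<mu> = {u \<in> borel_measurable (outer_to_measure \<mu>). N11_norm \<mu> u < \<infinity>}"

definition Cap1 :: "('a::metric_space set \<Rightarrow> ennreal) \<Rightarrow> 'a set \<Rightarrow> ennreal" where
  "Cap1 \<mu> A = (INF u \<in> {u \<in> N11 \<mu>. \<forall>x \<in> A. u x \<ge> 1}. N11_norm \<mu> u)"

definition rel_cap1 :: "('a::metric_space set \<Rightarrow> ennreal) \<Rightarrow> 'a set \<Rightarrow> 'a set \<Rightarrow> ennreal" where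
  "rel_cap1 \<mu> A D =
     (INF (u, g) \<in> {(u, g). u \<in> N11 \<mu> \<and> (\<forall>x \<in> A. u x \<ge> 1) \<and> (\<forall>x \<in> - D. u x = 0) \<and>
                            upper_gradient u g}.
        \<integral>\<^sup>+ x. g x \<partial>outer_to_measure \<mu>)"

section \<open>Thinness\<close>

definition thin1 :: "('a::metric_space set \<Rightarrow> ennreal) \<Rightarrow> 'a set \<Rightarrow> 'a \<Rightarrow> bool" where
  "thin1 \<mu> A x \<longleftrightarrow>
     ((\<lambda>r. ennreal r * (rel_cap1 \<mu> (A \<inter> ball x r) (ball x (2 * r)) / \<mu> (ball x r))) \<longlongrightarrow> 0)
       (at_right 0)"

definition base1 :: "('a::metric_space set \<Rightarrow> ennreal) \<Rightarrow> 'a set \<Rightarrow> 'a set" where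
  "base1 \<mu> A = {x. \<not> thin1 \<mu> A x}"

end

theory Submission
  imports Defs "HOL-Library.Diagonal_Subsequence"
begin

text \<open>
For exponent one the capacity behaves like the Hausdorff content of codimension one, in which a
set is charged the sum of \<open>\<mu>(B\<^sub>i) / r\<^sub>i\<close> over a cover by balls \<open>B\<^sub>i\<close> of radius \<open>r\<^sub>i \<le> R\<close>
(\<open>codim_content\<close>).  The theorem is transferred to this content, where it becomes a covering
argument.  Three facts carry it.

Thinness bounds the content (\<open>boxing\<close>).  If the relative capacity of \<open>A \<inter> B(x,r)\<close> in
\<open>B(x,2r)\<close> is a small multiple of \<open>\<mu>(B(x,r)) / r\<close>, then so is the content of \<open>A \<inter> B(x,r)\<close> with
radii at most \<open>r/3\<close>.  A test function for the capacity may have bad values exactly on \<open>A\<close>, so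
only its upper gradient \<open>g\<close> is kept, through the fact that \<open>g\<close> has integral at least one along
every path from \<open>A \<inter> B(x,r)\<close> to the complement of \<open>B(x,2r)\<close>.  Make \<open>g\<close> lower semicontinuous
and bounded away from zero at little cost (\<open>lsc_majorant\<close>), and let \<open>v(y)\<close> be the minimum of one
and the infimum of the integrals of \<open>g\<close> over paths from \<open>y\<close> to that complement.  Paths of bounded
length are compact, so \<open>v\<close> is lower semicontinuous (\<open>path_potential_lsc\<close>): its superlevel sets
are open neighbourhoods of \<open>A \<inter> B(x,r)\<close>.  At a well chosen level \<open>t\<close> the integral of \<open>g\<close> over
the strip \<open>t < v \<le> t + h\<close> is at most \<open>m * h\<close> for arbitrarily small \<open>h\<close>, where \<open>m\<close> is comparable
to the full integral of \<open>g\<close> (\<open>level_selection\<close>); this replaces the coarea formula.  Around each point there is a ball in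
which \<open>{v > t}\<close> and its complement both have a fixed proportion of the measure, and the Poincare
inequality for \<open>v\<close> cut off at the two edges of the strip bounds \<open>\<mu>(B) / r\<close> by the share of
a dilated ball in the strip integral divided by \<open>h\<close> and in the integral of \<open>g\<close>
(\<open>isoperimetric_sum\<close>).  A Vitali covering finishes the estimate.

The content has the required property (\<open>codim_content_choquet\<close>).  Let \<open>F\<close> be a piece of small
diameter of the set of points at which the bound above holds for all radii below a fixed one, and
let \<open>c\<close> be the infimum over \<open>h\<close> of the content of \<open>A\<close> in the \<open>h\<close>-neighbourhood of \<open>F\<close>.
Take a nearly optimal cover of \<open>A\<close> in one such neighbourhood.  Finitely many of its balls carry
nearly the whole charge.  Once \<open>h\<close> is below their radii, each of them that still meets the
\<open>h\<close>-neighbourhood is close to a point of \<open>F\<close> on its own scale, and so \<open>A\<close> inside it can be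
covered again for half the price.  Hence \<open>c\<close> is at most about \<open>c / 2\<close>, that is, zero.  So every
piece has a neighbourhood in which \<open>A\<close> has content as small as desired; countably many
pieces contain all points at which \<open>A\<close> is thin, and \<open>W\<close> is the union of their neighbourhoods.

The content bounds the capacity (\<open>Cap1_le_cover\<close>), by the supremum of tent functions over the
balls of a cover.

Curves enter only through paths that are 1-Lipschitz on an interval.  Arc length
parametrisation turns a curve into such a path with the same integral, and conversely the
integral along a 1-Lipschitz path dominates the arc length integral along the curve that it traces.
\<close>

section \<open>Path integrals and Lipschitz reparametrisation\<close>

definition path_int :: "('a \<Rightarrow> ennreal) \<Rightarrow> (real \<Rightarrow> 'a) \<Rightarrow> real \<Rightarrow> real \<Rightarrow> ennreal" where
  "path_int g \<sigma> a b = (\<integral>\<^sup>+ l \<in> {a..b}. g (\<sigma> l) \<partial>lborel)"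

lemma path_int_measurable:
  fixes \<sigma> :: "real \<Rightarrow> 'a::topological_space" and g :: "'a \<Rightarrow> ennreal"
  assumes "continuous_on {a..b} \<sigma>" "g \<in> borel_measurable borel"
  shows "(\<lambda>l. g (\<sigma> l) * indicator {a..b} l) \<in> borel_measurable borel"
proof -
  have "\<sigma> \<in> borel_measurable (restrict_space borel {a..b})"
    by (rule borel_measurable_continuous_on_restrict[OF assms(1)])
  from measurable_compose[OF this assms(2)]
  have "(\<lambda>l. g (\<sigma> l)) \<in> borel_measurable (restrict_space borel {a..b})" .
  then show ?thesis
    by (subst (asm) borel_measurable_restrict_space_iff_ennreal) auto
qed

text \<open>The preimage of \<open>E\<close> can be covered by non-overlapping intervals of nearly the same total length,
and \<open>f\<close> maps an interval into one that is no longer.\<close>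
lemma emeasure_lipschitz_image:
  fixes f :: "real \<Rightarrow> real"
  assumes f: "1-lipschitz_on {a..b} f" and E: "E \<in> sets borel" "E \<subseteq> f ` {a..b}"
  shows "emeasure lborel E \<le> emeasure lborel ({a..b} \<inter> f -` E)"
proof (cases "a < b \<and> E \<noteq> {}")
  case False
  then have "finite E"
  proof (cases "E = {}")
    case False
    with \<open>\<not> (a < b \<and> E \<noteq> {})\<close> have "finite (f ` {a..b})" by (cases "a = b") auto
    then show ?thesis using E finite_subset by blast
  qed auto
  then show ?thesis by (simp add: emeasure_lborel_countable countable_finite)
next
  case True
  define S where "S = {a..b} \<inter> f -` E"
  have cont: "continuous_on {a..b} f" using f by (rule lipschitz_on_continuous_on)
  have Sb: "S \<in> sets borel"
  proof -
    have "f \<in> borel_measurable (restrict_space borel {a..b})"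
      by (rule borel_measurable_continuous_on_restrict[OF cont])
    from measurable_sets[OF this E(1)] show ?thesis
      by (simp add: sets_restrict_space_iff space_restrict_space S_def Int_commute)
  qed
  have Sfin: "emeasure lborel S \<noteq> \<infinity>"
  proof -
    have "emeasure lborel S \<le> emeasure lborel {a..b}"
      unfolding S_def by (rule emeasure_mono) auto
    then show ?thesis using True by (auto simp: top_unique)
  qed
  have Slm: "S \<in> lmeasurable"
    using Sb Sfin by (auto intro!: fmeasurableI simp: less_top)
  show ?thesis unfolding S_def[symmetric]
  proof (rule ennreal_le_epsilon)
    fix e :: real assume "0 < e"
    have "S \<subseteq> cbox a b" unfolding S_def by auto
    from measurable_outer_intervals_bounded[OF Slm this \<open>0 < e\<close>] obtain D where
      D: "countable D" "\<And>K. K \<in> D \<Longrightarrow> K \<subseteq> cbox a b \<and> K \<noteq> {} \<and> (\<exists>c d. K = cbox c d)"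
        "pairwise (\<lambda>A B. interior A \<inter> interior B = {}) D" "S \<subseteq> \<Union> D"
        "\<Union> D \<in> lmeasurable" "measure lebesgue (\<Union> D) \<le> measure lebesgue S + e"
      by metis
    have "\<exists>B. B \<in> sets borel \<and> f ` K \<subseteq> B \<and> emeasure lborel B \<le> emeasure lborel (interior K)"
      if K: "K \<in> D" for K
    proof -
      obtain c d where Kcd: "K = {c..d}" "K \<subseteq> {a..b}" "K \<noteq> {}" using D(2)[OF K] by auto
      then have cd: "c \<le> d" by auto
      have ck: "continuous_on K f" using continuous_on_subset[OF cont] Kcd by auto
      have "compact K" using Kcd by auto
      from continuous_attains_sup[OF this \<open>K \<noteq> {}\<close> ck] continuous_attains_inf[OF this \<open>K \<noteq> {}\<close> ck]
      obtain s s' where s: "s \<in> K" "\<And>y. y \<in> K \<Longrightarrow> f y \<le> f s" "s' \<in> K" "\<And>y. y \<in> K \<Longrightarrow> f s' \<le> f y"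
        by metis
      have "dist (f s) (f s') \<le> 1 * dist s s'"
        using lipschitz_onD[OF f, of s s'] s Kcd by auto
      then have "f s - f s' \<le> d - c" using s(1,3) Kcd by (auto simp: dist_real_def)
      moreover have "interior K = {c<..<d}" using Kcd by simp
      ultimately have "emeasure lborel {f s'..f s} \<le> emeasure lborel (interior K)"
        using s cd by (auto intro!: ennreal_leI)
      then show ?thesis using s by (intro exI[of _ "{f s'..f s}"]) auto
    qed
    then obtain B where B: "\<And>K. K \<in> D \<Longrightarrow> B K \<in> sets borel" "\<And>K. K \<in> D \<Longrightarrow> f ` K \<subseteq> B K"
      "\<And>K. K \<in> D \<Longrightarrow> emeasure lborel (B K) \<le> emeasure lborel (interior K)"
      by metis
    define I where "I = to_nat_on D ` D"
    define X where "X n = (if n \<in> I then B (from_nat_into D n) else {})" for n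
    define J where "J n = (if n \<in> I then interior (from_nat_into D n) else {})" for n
    have fI: "from_nat_into D n \<in> D" if "n \<in> I" for n
      using that D(1) by (auto simp: I_def)
    have inj: "from_nat_into D m \<noteq> from_nat_into D n" if "n \<in> I" "m \<in> I" "m \<noteq> n" for m n
      using that D(1) by (auto simp: I_def)
    have Xm: "X n \<in> sets lborel" for n unfolding X_def using B(1) fI by auto
    have Jm: "J n \<in> sets lborel" for n unfolding J_def by auto
    have "E \<subseteq> (\<Union>n. X n)"
    proof
      fix x assume x: "x \<in> E"
      then obtain s where s: "s \<in> {a..b}" "x = f s" using E by auto
      then have "s \<in> S" using x by (auto simp: S_def)
      then obtain K where K: "K \<in> D" "s \<in> K" using D(4) by auto
      then have "x \<in> B K" using B(2) s by auto
      then have "x \<in> X (to_nat_on D K)" using K D(1) by (auto simp: X_def I_def)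
      then show "x \<in> (\<Union>n. X n)" by auto
    qed
    then have "emeasure lborel E \<le> emeasure lborel (\<Union>n. X n)"
      using Xm by (intro emeasure_mono) auto
    also have "\<dots> \<le> (\<Sum>n. emeasure lborel (X n))"
      by (rule emeasure_subadditive_countably) (use Xm in auto)
    also have "\<dots> \<le> (\<Sum>n. emeasure lborel (J n))"
      by (intro suminf_le) (auto simp: X_def J_def intro!: B(3) fI)
    also have "\<dots> = emeasure lborel (\<Union>n. J n)"
    proof (rule suminf_emeasure)
      show "range J \<subseteq> sets lborel" using Jm by auto
      show "disjoint_family J"
        unfolding disjoint_family_on_def
      proof (intro ballI impI)
        fix m n :: nat assume "m \<noteq> n"
        show "J m \<inter> J n = {}"
        proof (cases "m \<in> I \<and> n \<in> I")
          case True
          then show ?thesis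
            using D(3) fI[of m] fI[of n] inj[of n m] \<open>m \<noteq> n\<close> unfolding pairwise_def J_def by auto
        qed (auto simp: J_def)
      qed
    qed
    also have "\<dots> = emeasure lebesgue (\<Union>n. J n)" using Jm by simp
    also have "\<dots> \<le> emeasure lebesgue (\<Union> D)"
    proof (rule emeasure_mono)
      show "(\<Union>n. J n) \<subseteq> \<Union> D"
      proof
        fix x assume "x \<in> (\<Union>n. J n)"
        then obtain n where "x \<in> J n" by auto
        then have "n \<in> I" "x \<in> from_nat_into D n"
          using interior_subset by (auto simp: J_def split: if_splits)
        then show "x \<in> \<Union> D" using fI by auto
      qed
      show "\<Union> D \<in> sets lebesgue" using D(5) by auto
    qed
    also have "\<dots> = ennreal (measure lebesgue (\<Union> D))" using D(5) by (simp add: emeasure_eq_measure2)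
    also have "\<dots> \<le> ennreal (measure lebesgue S + e)" using D(6) by (intro ennreal_leI)
    also have "\<dots> = emeasure lebesgue S + ennreal e"
      using \<open>0 < e\<close> Slm by (simp add: emeasure_eq_measure2 ennreal_plus)
    also have "emeasure lebesgue S = emeasure lborel S" using Sb by simp
    finally show "emeasure lborel E \<le> emeasure lborel S + ennreal e" .
  qed
qed

text \<open>This is the preceding lemma read as an inequality between Lebesgue measure on the image and the
push-forward of Lebesgue measure on the domain.\<close>
lemma nn_integral_lipschitz_image:
  fixes f :: "real \<Rightarrow> real" and h :: "real \<Rightarrow> ennreal"
  assumes f: "1-lipschitz_on {a..b} f" and im: "f ` {a..b} = {c..d}"
    and h: "(\<lambda>x. h x * indicator {c..d} x) \<in> borel_measurable borel"
  shows "(\<integral>\<^sup>+ l \<in> {c..d}. h l \<partial>lborel) \<le> (\<integral>\<^sup>+ s \<in> {a..b}. h (f s) \<partial>lborel)"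
proof -
  define H where "H x = h x * indicator {c..d} x" for x
  define F where "F x = f x * indicator {a..b} x" for x
  have cont: "continuous_on {a..b} f" using f by (rule lipschitz_on_continuous_on)
  have Fm[measurable]: "F \<in> borel_measurable borel"
    using borel_measurable_continuous_on_indicator[OF _ cont]
    by (auto simp: F_def[abs_def] mult.commute)
  have Hm[measurable]: "H \<in> borel_measurable borel" using h by (simp add: H_def[abs_def])
  define N1 where "N1 = density lborel (indicator {c..d} :: real \<Rightarrow> ennreal)"
  define N2 where "N2 = distr (density lborel (indicator {a..b} :: real \<Rightarrow> ennreal)) borel F"
  have "N1 \<le> N2"
  proof (subst le_measure)
    show "sets N1 = sets N2" by (simp add: N1_def N2_def)
    show "\<forall>A\<in>sets N1. emeasure N1 A \<le> emeasure N2 A"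
    proof
      fix A assume "A \<in> sets N1"
      then have A[measurable]: "A \<in> sets borel" by (simp add: N1_def)
      have "emeasure N1 A = emeasure lborel ({c..d} \<inter> A)"
        unfolding N1_def by (subst emeasure_density)
          (auto simp: indicator_inter_arith[symmetric] simp del: indicator_inter_arith)
      also have "\<dots> \<le> emeasure lborel ({a..b} \<inter> f -` ({c..d} \<inter> A))"
        by (rule emeasure_lipschitz_image[OF f]) (use im in auto)
      also have "\<dots> \<le> emeasure lborel ({a..b} \<inter> F -` A)"
      proof (rule emeasure_mono)
        show "{a..b} \<inter> F -` A \<in> sets lborel"
          using measurable_sets[OF Fm A] by auto
      qed (auto simp: F_def)
      also have "\<dots> = emeasure N2 A"
      proof -
        have [measurable]: "F -` A \<in> sets borel" using measurable_sets[OF Fm A] by simp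
        show ?thesis unfolding N2_def
          apply (subst emeasure_distr)
            apply (simp_all)
          apply (subst emeasure_density)
          apply (auto simp: indicator_inter_arith[symmetric] simp del: indicator_inter_arith)
          done
      qed
      finally show "emeasure N1 A \<le> emeasure N2 A" .
    qed
  qed
  then have "nn_integral N1 H \<le> nn_integral N2 H"
    by (intro nn_integral_mono_measure) (auto simp: N1_def N2_def)
  also have "nn_integral N1 H = (\<integral>\<^sup>+ l \<in> {c..d}. h l \<partial>lborel)"
    unfolding N1_def by (subst nn_integral_density)
      (auto intro!: nn_integral_cong simp: H_def indicator_def)
  also have "nn_integral N2 H = (\<integral>\<^sup>+ s \<in> {a..b}. h (f s) \<partial>lborel)"
    unfolding N2_def
    apply (subst nn_integral_distr)
      apply (simp_all)
    apply (subst nn_integral_density)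
      apply simp_all
    using im apply (intro nn_integral_cong) apply (auto simp: H_def F_def indicator_def)
    done
  finally show ?thesis .
qed

section \<open>Length and arc length parametrisation of curves\<close>

definition partition_of :: "real \<Rightarrow> real \<Rightarrow> nat \<Rightarrow> (nat \<Rightarrow> real) \<Rightarrow> bool" where
  "partition_of a b n t \<longleftrightarrow> (\<forall>i<n. t i \<le> t (Suc i)) \<and> (\<forall>i\<le>n. t i \<in> {a..b})"

definition variation_sum :: "(real \<Rightarrow> 'a::metric_space) \<Rightarrow> nat \<Rightarrow> (nat \<Rightarrow> real) \<Rightarrow> real" where
  "variation_sum \<gamma> n t = (\<Sum>i<n. dist (\<gamma> (t i)) (\<gamma> (t (Suc i))))"

lemma variation_sum_nonneg: "variation_sum \<gamma> n t \<ge> 0"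
  unfolding variation_sum_def by (intro sum_nonneg) auto

lemma curve_length_SUP:
  "curve_length \<gamma> a b = (SUP (n, t) \<in> {(n, t). partition_of a b n t}. ennreal (variation_sum \<gamma> n t))"
  unfolding curve_length_def partition_of_def variation_sum_def ..

lemma variation_sum_le_curve_length:
  "partition_of a b n t \<Longrightarrow> ennreal (variation_sum \<gamma> n t) \<le> curve_length \<gamma> a b"
  unfolding curve_length_SUP by (rule SUP_upper2[of "(n, t)"]) auto

lemma curve_length_leI:
  "(\<And>n t. partition_of a b n t \<Longrightarrow> ennreal (variation_sum \<gamma> n t) \<le> L) \<Longrightarrow> curve_length \<gamma> a b \<le> L"
  unfolding curve_length_SUP by (rule SUP_least) auto

lemma less_curve_lengthE:
  assumes "y < curve_length \<gamma> a b"
  obtains n t where "partition_of a b n t" "y < ennreal (variation_sum \<gamma> n t)"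
  using assms unfolding curve_length_SUP less_SUP_iff by auto

lemma variation_sum_append:
  assumes "partition_of a c n t" "partition_of c b m t'"
  shows "\<exists>k s. partition_of a b k s \<and> variation_sum \<gamma> n t + variation_sum \<gamma> m t' \<le> variation_sum \<gamma> k s"
proof (intro exI conjI)
  define s where "s i = (if i \<le> n then t i else t' (i - Suc n))" for i
  have n: "t n \<in> {a..c}" using assms(1) unfolding partition_of_def by blast
  have m: "t' 0 \<in> {c..b}" using assms(2) unfolding partition_of_def by blast
  show "partition_of a b (Suc n + m) s"
    unfolding partition_of_def
  proof (intro conjI allI impI)
    fix i assume i: "i < Suc n + m"
    consider "i < n" | "i = n" | "i > n" by linarith
    then show "s i \<le> s (Suc i)"
    proof cases
      case 1
      then have "t i \<le> t (Suc i)" using assms(1) unfolding partition_of_def by blast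
      then show ?thesis using 1 by (simp add: s_def)
    next
      case 2
      then show ?thesis using n m by (auto simp: s_def)
    next
      case 3
      then have "Suc i - Suc n = Suc (i - Suc n)" "i - Suc n < m" using i by auto
      then have "t' (i - Suc n) \<le> t' (Suc (i - Suc n))" using assms(2) unfolding partition_of_def by blast
      then show ?thesis using 3 \<open>Suc i - Suc n = Suc (i - Suc n)\<close> by (simp add: s_def)
    qed
  next
    fix i assume i: "i \<le> Suc n + m"
    show "s i \<in> {a..b}"
    proof (cases "i \<le> n")
      case True
      then have "t i \<in> {a..c}" using assms(1) by (auto simp: partition_of_def)
      then show ?thesis using True m by (auto simp: s_def)
    next
      case False
      then have "i - Suc n \<le> m" using i by auto
      then have "t' (i - Suc n) \<in> {c..b}" using assms(2) by (auto simp: partition_of_def)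
      then show ?thesis using False n by (auto simp: s_def)
    qed
  qed
  have "variation_sum \<gamma> (Suc n + m) s =
      variation_sum \<gamma> (Suc n) s + (\<Sum>i<m. dist (\<gamma> (s (Suc n + i))) (\<gamma> (s (Suc (Suc n + i)))))"
    unfolding variation_sum_def by (induction m) (simp_all add: add.assoc)
  also have "(\<Sum>i<m. dist (\<gamma> (s (Suc n + i))) (\<gamma> (s (Suc (Suc n + i))))) = variation_sum \<gamma> m t'"
    unfolding variation_sum_def by (intro sum.cong) (auto simp: s_def)
  also have "variation_sum \<gamma> (Suc n) s = variation_sum \<gamma> n t + dist (\<gamma> (t n)) (\<gamma> (t' 0))"
    unfolding variation_sum_def by (auto simp: s_def intro!: sum.cong)
  finally show "variation_sum \<gamma> n t + variation_sum \<gamma> m t' \<le> variation_sum \<gamma> (Suc n + m) s"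
    by simp
qed

lemma variation_sum_split:
  assumes t: "partition_of a b n t"
  shows "variation_sum \<gamma> n t \<le> variation_sum \<gamma> n (\<lambda>i. min (t i) c) + variation_sum \<gamma> n (\<lambda>i. max (t i) c)"
proof -
  have "dist (\<gamma> p) (\<gamma> q) \<le> dist (\<gamma> (min p c)) (\<gamma> (min q c)) + dist (\<gamma> (max p c)) (\<gamma> (max q c))"
    if "p \<le> q" for p q
  proof -
    consider "q \<le> c" | "c \<le> p" | "p \<le> c" "c \<le> q" by linarith
    then show ?thesis using that by cases (auto simp: min_def max_def dist_triangle)
  qed
  then show ?thesis
    unfolding variation_sum_def sum.distrib[symmetric] using t
    by (intro sum_mono) (auto simp: partition_of_def)
qed

lemma curve_length_add:
  assumes "a \<le> c" "c \<le> b"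
  shows "curve_length \<gamma> a b = curve_length \<gamma> a c + curve_length \<gamma> c b"
proof (rule antisym)
  show "curve_length \<gamma> a b \<le> curve_length \<gamma> a c + curve_length \<gamma> c b"
  proof (rule curve_length_leI)
    fix n t assume t: "partition_of a b n t"
    have "partition_of a c n (\<lambda>i. min (t i) c)" "partition_of c b n (\<lambda>i. max (t i) c)"
      using t assms by (auto simp: partition_of_def min_le_iff_disj le_max_iff_disj)
    then have "ennreal (variation_sum \<gamma> n (\<lambda>i. min (t i) c)) + ennreal (variation_sum \<gamma> n (\<lambda>i. max (t i) c))
        \<le> curve_length \<gamma> a c + curve_length \<gamma> c b"
      by (intro add_mono variation_sum_le_curve_length)
    moreover have "ennreal (variation_sum \<gamma> n t) \<le>
      ennreal (variation_sum \<gamma> n (\<lambda>i. min (t i) c)) + ennreal (variation_sum \<gamma> n (\<lambda>i. max (t i) c))"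
      using variation_sum_split[OF t]
      by (subst ennreal_plus[symmetric]) (auto intro!: ennreal_leI variation_sum_nonneg)
    ultimately show "ennreal (variation_sum \<gamma> n t) \<le> curve_length \<gamma> a c + curve_length \<gamma> c b"
      by (rule order_trans[rotated])
  qed
next
  have ne: "\<exists>n t. partition_of x y n t" if "x \<le> y" for x y
    using that by (intro exI[of _ 0] exI[of _ "\<lambda>_. x"]) (auto simp: partition_of_def)
  have *: "ennreal (variation_sum \<gamma> n t) + curve_length \<gamma> c b \<le> curve_length \<gamma> a b"
    if t: "partition_of a c n t" for n t
  proof -
    have "ennreal (variation_sum \<gamma> n t) + curve_length \<gamma> c b =
       (SUP (m, t') \<in> {(m, t'). partition_of c b m t'}. ennreal (variation_sum \<gamma> n t) + ennreal (variation_sum \<gamma> m t'))"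
      unfolding curve_length_SUP using ne[OF \<open>c \<le> b\<close>]
      unfolding case_prod_unfold by (intro ennreal_SUP_add_right) auto
    also have "\<dots> \<le> curve_length \<gamma> a b"
    proof (rule SUP_least, clarify)
      fix m t' assume t': "partition_of c b m t'"
      obtain k s where "partition_of a b k s" "variation_sum \<gamma> n t + variation_sum \<gamma> m t' \<le> variation_sum \<gamma> k s"
        using variation_sum_append[OF t t'] by blast
      then have "ennreal (variation_sum \<gamma> n t + variation_sum \<gamma> m t') \<le> curve_length \<gamma> a b"
        using variation_sum_le_curve_length[of a b k s \<gamma>] ennreal_leI order_trans by blast
      then show "ennreal (variation_sum \<gamma> n t) + ennreal (variation_sum \<gamma> m t') \<le> curve_length \<gamma> a b"
        by (simp add: variation_sum_nonneg)
    qed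
    finally show ?thesis .
  qed
  have "curve_length \<gamma> a c + curve_length \<gamma> c b =
      (SUP (n, t) \<in> {(n, t). partition_of a c n t}. ennreal (variation_sum \<gamma> n t) + curve_length \<gamma> c b)"
    unfolding curve_length_SUP[of \<gamma> a c] using ne[OF \<open>a \<le> c\<close>]
    unfolding case_prod_unfold by (intro ennreal_SUP_add_left[symmetric]) auto
  also have "\<dots> \<le> curve_length \<gamma> a b"
    by (rule SUP_least) (use * in auto)
  finally show "curve_length \<gamma> a c + curve_length \<gamma> c b \<le> curve_length \<gamma> a b" .
qed

lemma dist_le_curve_length:
  assumes "a \<le> b"
  shows "ennreal (dist (\<gamma> a) (\<gamma> b)) \<le> curve_length \<gamma> a b"
  using variation_sum_le_curve_length[of a b 1 "\<lambda>i. if i = 0 then a else b" \<gamma>] assms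
  by (auto simp: partition_of_def variation_sum_def)

lemma curve_length_refl: "curve_length \<gamma> a a = 0"
proof -
  have "curve_length \<gamma> a a \<le> 0"
  proof (rule curve_length_leI)
    fix n t assume "partition_of a a n t"
    then have "t i = a" if "i \<le> n" for i using that by (auto simp: partition_of_def)
    then have "variation_sum \<gamma> n t = 0" by (auto simp: variation_sum_def intro!: sum.neutral)
    then show "ennreal (variation_sum \<gamma> n t) \<le> 0" by simp
  qed
  then show ?thesis by simp
qed

text \<open>A partition whose sum exceeds \<open>y\<close> can be truncated at \<open>t'\<close>, and its sum depends continuously
on the place of truncation.  Lower semicontinuity of the length on both sides of \<open>t\<close>
gives continuity of the length function, because the two lengths add up to a constant.\<close>
lemma curve_length_lsc:
  assumes cont: "continuous_on {a..b} \<gamma>" and t: "t \<in> {a..b}"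
  shows "y < curve_length \<gamma> a t \<Longrightarrow> eventually (\<lambda>t'. y < curve_length \<gamma> a t') (at t within {a..b})"
    and "y < curve_length \<gamma> t b \<Longrightarrow> eventually (\<lambda>t'. y < curve_length \<gamma> t' b) (at t within {a..b})"
proof -
  have gen: "eventually (\<lambda>t'. y < ennreal (variation_sum \<gamma> n (\<lambda>i. f (p i) t'))) (at t within {a..b})"
    if p: "\<And>i. i \<le> n \<Longrightarrow> f (p i) t = p i" and f: "\<And>x. continuous_on UNIV (f x)"
      and im: "\<And>x u. x \<in> {a..b} \<Longrightarrow> u \<in> {a..b} \<Longrightarrow> f x u \<in> {a..b}"
      and pab: "\<And>i. i \<le> n \<Longrightarrow> p i \<in> {a..b}" and y: "y < ennreal (variation_sum \<gamma> n p)"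
    for f :: "real \<Rightarrow> real \<Rightarrow> real" and n p
  proof -
    have c: "continuous_on {a..b} (\<lambda>t'. \<gamma> (f (p i) t'))" if "i \<le> n" for i
      using f[of "p i"] im pab[OF that]
      by (intro continuous_on_compose2[OF cont]) (auto intro: continuous_on_subset)
    have "continuous_on {a..b} (\<lambda>t'. ennreal (variation_sum \<gamma> n (\<lambda>i. f (p i) t')))"
      unfolding variation_sum_def
      by (intro continuous_on_ennreal continuous_on_sum continuous_on_dist c) auto
    then have "((\<lambda>t'. ennreal (variation_sum \<gamma> n (\<lambda>i. f (p i) t'))) \<longlongrightarrow>
        ennreal (variation_sum \<gamma> n (\<lambda>i. f (p i) t))) (at t within {a..b})"
      using t by (simp add: continuous_on_def)
    moreover have "variation_sum \<gamma> n (\<lambda>i. f (p i) t) = variation_sum \<gamma> n p"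
      unfolding variation_sum_def by (intro sum.cong) (auto simp: p)
    ultimately show ?thesis using y by (intro order_tendstoD(1)) auto
  qed
  have ev: "eventually (\<lambda>t'. t' \<in> {a..b}) (at t within {a..b})"
    by (auto simp: eventually_at_filter)
  show "eventually (\<lambda>t'. y < curve_length \<gamma> a t') (at t within {a..b})" if y: "y < curve_length \<gamma> a t"
  proof -
    obtain n p where p: "partition_of a t n p" "y < ennreal (variation_sum \<gamma> n p)"
      using less_curve_lengthE[OF y] .
    have "eventually (\<lambda>t'. y < ennreal (variation_sum \<gamma> n (\<lambda>i. min (p i) t'))) (at t within {a..b})"
      by (rule gen[where f = min and p = p and n = n])
         (use p t in \<open>auto simp: partition_of_def min_le_iff_disj le_max_iff_disj intro!: continuous_intros\<close>)
    then show ?thesis using ev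
    proof eventually_elim
      case (elim t')
      have "partition_of a t' n (\<lambda>i. min (p i) t')"
        using p(1) elim by (auto simp: partition_of_def min_le_iff_disj)
      from variation_sum_le_curve_length[OF this, of \<gamma>] elim show ?case by simp
    qed
  qed
  show "eventually (\<lambda>t'. y < curve_length \<gamma> t' b) (at t within {a..b})" if y: "y < curve_length \<gamma> t b"
  proof -
    obtain n p where p: "partition_of t b n p" "y < ennreal (variation_sum \<gamma> n p)"
      using less_curve_lengthE[OF y] .
    have "eventually (\<lambda>t'. y < ennreal (variation_sum \<gamma> n (\<lambda>i. max (p i) t'))) (at t within {a..b})"
      by (rule gen[where f = max and p = p and n = n])
         (use p t in \<open>auto simp: partition_of_def min_le_iff_disj le_max_iff_disj intro!: continuous_intros\<close>)
    then show ?thesis using ev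
    proof eventually_elim
      case (elim t')
      have "partition_of t' b n (\<lambda>i. max (p i) t')"
        using p(1) elim by (auto simp: partition_of_def le_max_iff_disj)
      from variation_sum_le_curve_length[OF this, of \<gamma>] elim show ?case by simp
    qed
  qed
qed

lemma curve_length_mono: "a \<le> c \<Longrightarrow> c \<le> b \<Longrightarrow> curve_length \<gamma> a c \<le> curve_length \<gamma> a b"
  by (simp add: curve_length_add[of a c b])

lemma curve_length_continuous:
  assumes cont: "continuous_on {a..b} \<gamma>" and fin: "curve_length \<gamma> a b < \<infinity>" and "a \<le> b"
  shows "continuous_on {a..b} (\<lambda>t. enn2real (curve_length \<gamma> a t))"
  unfolding continuous_on_def
proof (rule ballI, rule tendstoI)
  define L where "L t = enn2real (curve_length \<gamma> a t)" for t
  define R where "R t = enn2real (curve_length \<gamma> t b)" for t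
  fix t e :: real assume t: "t \<in> {a..b}" and "0 < e"
  have fL: "curve_length \<gamma> a s = ennreal (L s)" "curve_length \<gamma> s b = ennreal (R s)"
    "L s + R s = L b" "0 \<le> L s" "0 \<le> R s" if "s \<in> {a..b}" for s
  proof -
    have e: "curve_length \<gamma> a b = curve_length \<gamma> a s + curve_length \<gamma> s b"
      using that by (intro curve_length_add) auto
    then have f: "curve_length \<gamma> a s < \<infinity>" "curve_length \<gamma> s b < \<infinity>"
      using fin by (auto simp: ennreal_add_eq_top less_top)
    then show 1: "curve_length \<gamma> a s = ennreal (L s)" "curve_length \<gamma> s b = ennreal (R s)"
      "0 \<le> L s" "0 \<le> R s"
      by (auto simp: L_def R_def)
    have "L b = enn2real (curve_length \<gamma> a b)" by (simp add: L_def)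
    also have "\<dots> = enn2real (ennreal (L s) + ennreal (R s))" by (simp only: e 1)
    also have "\<dots> = L s + R s" using 1(3,4) by (simp add: ennreal_plus[symmetric] del: ennreal_plus)
    finally show "L s + R s = L b" ..
  qed
  have "eventually (\<lambda>t'. ennreal (L t - e) < curve_length \<gamma> a t') (at t within {a..b})" if "L t - e \<ge> 0"
    by (rule curve_length_lsc(1)[OF cont t])
       (use fL(1)[OF t] fL(4)[OF t] \<open>0 < e\<close> that in \<open>auto simp: ennreal_less_iff\<close>)
  moreover have "eventually (\<lambda>t'. ennreal (R t - e) < curve_length \<gamma> t' b) (at t within {a..b})" if "R t - e \<ge> 0"
    by (rule curve_length_lsc(2)[OF cont t])
       (use fL(2)[OF t] fL(5)[OF t] \<open>0 < e\<close> that in \<open>auto simp: ennreal_less_iff\<close>)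
  ultimately have "eventually (\<lambda>t'. (L t - e \<ge> 0 \<longrightarrow> ennreal (L t - e) < curve_length \<gamma> a t') \<and>
      (R t - e \<ge> 0 \<longrightarrow> ennreal (R t - e) < curve_length \<gamma> t' b) \<and> t' \<in> {a..b}) (at t within {a..b})"
    by (auto simp: eventually_conj_iff eventually_at_filter)
  then show "eventually (\<lambda>t'. dist (enn2real (curve_length \<gamma> a t')) (enn2real (curve_length \<gamma> a t)) < e) (at t within {a..b})"
  proof eventually_elim
    case (elim t')
    then have t': "t' \<in> {a..b}" by auto
    have "L t - e < L t'" using elim fL(1,4)[OF t'] \<open>0 < e\<close>
      by (cases "L t - e \<ge> 0") (auto simp: ennreal_less_iff)
    moreover have "R t - e < R t'" using elim fL(2,5)[OF t'] \<open>0 < e\<close>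
      by (cases "R t - e \<ge> 0") (auto simp: ennreal_less_iff)
    ultimately show ?case using fL(3)[OF t] fL(3)[OF t'] by (auto simp: dist_real_def L_def)
  qed
qed

text \<open>Any two parameters with the same length function value are mapped to the same point, so the
choice in the definition of \<^const>\<open>arc_length_param\<close> does not matter.\<close>
lemma arc_length_param_at:
  assumes fin: "curve_length \<gamma> a b < \<infinity>" and s: "s \<in> {a..b}"
  shows "arc_length_param (\<gamma>, a, b) (enn2real (curve_length \<gamma> a s)) = \<gamma> s"
proof -
  have fs: "curve_length \<gamma> a u < \<infinity>" if "u \<in> {a..b}" for u
    using that by (intro le_less_trans[OF curve_length_mono[of a u b \<gamma>] fin]) auto
  define s' where "s' = (SOME u. u \<in> {a..b} \<and> curve_length \<gamma> a u = ennreal (enn2real (curve_length \<gamma> a s)))"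
  have "s' \<in> {a..b} \<and> curve_length \<gamma> a s' = ennreal (enn2real (curve_length \<gamma> a s))"
    unfolding s'_def by (rule someI[of _ s]) (use s fs[OF s] in simp)
  then have s': "s' \<in> {a..b}" "curve_length \<gamma> a s' = curve_length \<gamma> a s" using fs[OF s] by simp_all
  have key: "\<gamma> p = \<gamma> q" if "p \<le> q" "p \<in> {a..b}" "q \<in> {a..b}" "curve_length \<gamma> a p = curve_length \<gamma> a q" for p q
  proof -
    have e: "curve_length \<gamma> a q = curve_length \<gamma> a p + curve_length \<gamma> p q"
      using that(1-3) by (intro curve_length_add) auto
    have "curve_length \<gamma> a p + curve_length \<gamma> p q = curve_length \<gamma> a q" by (rule e[symmetric])
    also have "\<dots> = curve_length \<gamma> a p + 0" using that(4) by simp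
    finally have "curve_length \<gamma> p q = 0"
      using fs[OF that(2)] unfolding ennreal_add_left_cancel by (simp add: less_top[symmetric])
    then show ?thesis using dist_le_curve_length[OF that(1), of \<gamma>] by simp
  qed
  have "\<gamma> s' = \<gamma> s"
  proof (cases "s \<le> s'")
    case True
    then show ?thesis using key[OF True s s'(1) s'(2)[symmetric]] by simp
  next
    case False
    then show ?thesis using key[of s' s] s s' by simp
  qed
  then show ?thesis unfolding arc_length_param_def s'_def by simp
qed

text \<open>The arc length parametrisation is defined on the whole interval, because the length function is
continuous and omits no value.\<close>
lemma curve_length_image:
  assumes cont: "continuous_on {a..b} \<gamma>" and fin: "curve_length \<gamma> a b < \<infinity>" and ab: "a \<le> b"
  shows "(\<lambda>t. enn2real (curve_length \<gamma> a t)) ` {a..b} = {0..enn2real (curve_length \<gamma> a b)}"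
proof
  show "(\<lambda>t. enn2real (curve_length \<gamma> a t)) ` {a..b} \<subseteq> {0..enn2real (curve_length \<gamma> a b)}"
    using fin by (auto intro!: enn2real_mono curve_length_mono)
  show "{0..enn2real (curve_length \<gamma> a b)} \<subseteq> (\<lambda>t. enn2real (curve_length \<gamma> a t)) ` {a..b}"
  proof
    fix l assume l: "l \<in> {0..enn2real (curve_length \<gamma> a b)}"
    have "\<exists>x\<ge>a. x \<le> b \<and> enn2real (curve_length \<gamma> a x) = l"
      by (rule IVT') (use l ab curve_length_continuous[OF assms] in \<open>auto simp: curve_length_refl\<close>)
    then show "l \<in> (\<lambda>t. enn2real (curve_length \<gamma> a t)) ` {a..b}" by auto
  qed
qed

lemma arc_length_param_lipschitz:
  assumes c: "(\<gamma>, a, b) \<in> curves"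
  defines "len \<equiv> enn2real (curve_length \<gamma> a b)"
  shows "1-lipschitz_on {0..len} (arc_length_param (\<gamma>, a, b))"
    and "arc_length_param (\<gamma>, a, b) 0 = \<gamma> a" and "arc_length_param (\<gamma>, a, b) len = \<gamma> b"
proof -
  have ab: "a < b" and cont: "continuous_on {a..b} \<gamma>" and fin: "curve_length \<gamma> a b < \<infinity>"
    using c by (auto simp: curves_def)
  let ?L = "\<lambda>t. enn2real (curve_length \<gamma> a t)"
  show "arc_length_param (\<gamma>, a, b) 0 = \<gamma> a"
    using arc_length_param_at[OF fin, of a] ab by (simp add: curve_length_refl)
  show "arc_length_param (\<gamma>, a, b) len = \<gamma> b"
    using arc_length_param_at[OF fin, of b] ab by (simp add: len_def)
  have key: "dist (\<gamma> p) (\<gamma> q) \<le> ?L q - ?L p" if pq: "p \<le> q" "p \<in> {a..b}" "q \<in> {a..b}" for p q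
  proof -
    have "curve_length \<gamma> a q < \<infinity>"
      using pq by (intro le_less_trans[OF curve_length_mono[of a q b \<gamma>] fin]) auto
    moreover have e: "curve_length \<gamma> a q = curve_length \<gamma> a p + curve_length \<gamma> p q"
      using pq by (intro curve_length_add) auto
    ultimately have f: "curve_length \<gamma> a p < \<infinity>" "curve_length \<gamma> p q < \<infinity>"
      by (auto simp: ennreal_add_eq_top less_top)
    have "?L q = ?L p + enn2real (curve_length \<gamma> p q)"
      using f by (simp add: e enn2real_plus)
    moreover have "dist (\<gamma> p) (\<gamma> q) \<le> enn2real (curve_length \<gamma> p q)"
      using enn2real_mono[OF dist_le_curve_length[OF pq(1), of \<gamma>]] f by simp
    ultimately show ?thesis by simp
  qed
  show "1-lipschitz_on {0..len} (arc_length_param (\<gamma>, a, b))"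
  proof (rule lipschitz_on_leI)
    fix x y assume x: "x \<in> {0..len}" and y: "y \<in> {0..len}" and "x \<le> y"
    have "x \<in> ?L ` {a..b}" "y \<in> ?L ` {a..b}"
      using x y unfolding curve_length_image[OF cont fin less_imp_le[OF ab]] len_def by blast+
    then obtain p q where p: "p \<in> {a..b}" "x = ?L p" and q: "q \<in> {a..b}" "y = ?L q"
      by blast
    have d: "dist (\<gamma> p) (\<gamma> q) \<le> y - x"
    proof (cases "p \<le> q")
      case True
      then show ?thesis using key[of p q] p q by auto
    next
      case False
      then show ?thesis using key[of q p] p q \<open>x \<le> y\<close> by (auto simp: dist_commute)
    qed
    then show "dist (arc_length_param (\<gamma>, a, b) x) (arc_length_param (\<gamma>, a, b) y) \<le> 1 * dist x y"
      using \<open>x \<le> y\<close> d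
      unfolding p(2) q(2) arc_length_param_at[OF fin p(1)] arc_length_param_at[OF fin q(1)]
      by (simp add: dist_real_def)
  qed simp
qed

lemma curve_length_lipschitz:
  assumes \<sigma>: "1-lipschitz_on {a..b} \<sigma>" and "a \<le> p" "p \<le> q" "q \<le> b"
  shows "curve_length \<sigma> p q \<le> ennreal (q - p)"
proof (rule curve_length_leI)
  fix n t assume t: "partition_of p q n t"
  have "variation_sum \<sigma> n t \<le> (\<Sum>i<n. t (Suc i) - t i)"
    unfolding variation_sum_def
  proof (rule sum_mono)
    fix i assume "i \<in> {..<n}"
    then have "t i \<le> t (Suc i)" "t i \<in> {p..q}" "t (Suc i) \<in> {p..q}" using t by (auto simp: partition_of_def)
    then show "dist (\<sigma> (t i)) (\<sigma> (t (Suc i))) \<le> t (Suc i) - t i"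
      using lipschitz_onD[OF \<sigma>, of "t i" "t (Suc i)"] assms by (auto simp: dist_real_def)
  qed
  also have "\<dots> = t n - t 0" by (rule sum_lessThan_telescope)
  also have "\<dots> \<le> q - p"
  proof -
    have "t n \<in> {p..q}" "t 0 \<in> {p..q}" using t unfolding partition_of_def by blast+
    then show ?thesis by simp
  qed
  finally show "ennreal (variation_sum \<sigma> n t) \<le> ennreal (q - p)" by (rule ennreal_leI)
qed

lemma curve_of_lipschitz:
  assumes \<sigma>: "1-lipschitz_on {a..b} \<sigma>" and ab: "a \<le> b" and ne: "\<sigma> a \<noteq> \<sigma> b"
  shows "(\<sigma>, a, b) \<in> curves"
proof -
  have "a \<noteq> b" using ne by auto
  moreover have "continuous_on {a..b} \<sigma>" using \<sigma> by (rule lipschitz_on_continuous_on)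
  moreover have "curve_length \<sigma> a b < \<infinity>"
    using le_less_trans[OF curve_length_lipschitz[OF \<sigma> order_refl ab order_refl] ennreal_less_top] by simp
  moreover have "\<not> \<sigma> constant_on {a..b}"
    unfolding constant_on_def using ne ab by (metis atLeastAtMost_iff order_refl)
  ultimately show ?thesis using ab by (auto simp: curves_def)
qed

text \<open>The length function of a 1-Lipschitz path is itself 1-Lipschitz, so passing to arc length cannot
increase the integral.\<close>
lemma curve_integral_le_path_int:
  assumes \<sigma>: "1-lipschitz_on {a..b} \<sigma>" and ab: "a \<le> b" and ne: "\<sigma> a \<noteq> \<sigma> b"
    and g: "g \<in> borel_measurable borel"
  shows "curve_integral (\<sigma>, a, b) g \<le> path_int g \<sigma> a b"
proof -
  have c: "(\<sigma>, a, b) \<in> curves" by (rule curve_of_lipschitz[OF \<sigma> ab ne])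
  then have cont: "continuous_on {a..b} \<sigma>" and fin: "curve_length \<sigma> a b < \<infinity>"
    by (auto simp: curves_def)
  let ?L = "\<lambda>t. enn2real (curve_length \<sigma> a t)"
  have lip: "1-lipschitz_on {a..b} ?L"
  proof (rule lipschitz_on_leI)
    fix x y assume x: "x \<in> {a..b}" and y: "y \<in> {a..b}" and "x \<le> y"
    have e: "curve_length \<sigma> a y = curve_length \<sigma> a x + curve_length \<sigma> x y"
      using x y \<open>x \<le> y\<close> by (intro curve_length_add) auto
    have xy: "curve_length \<sigma> x y \<le> ennreal (y - x)"
      using x y \<open>x \<le> y\<close> by (intro curve_length_lipschitz[OF \<sigma>]) auto
    have ax: "curve_length \<sigma> a x \<le> ennreal (x - a)"
      using x y \<open>x \<le> y\<close> by (intro curve_length_lipschitz[OF \<sigma>]) auto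
    have fin2: "curve_length \<sigma> a x < top" "curve_length \<sigma> x y < top"
      using le_less_trans[OF ax ennreal_less_top] le_less_trans[OF xy ennreal_less_top] by simp_all
    have "enn2real (curve_length \<sigma> x y) \<le> y - x"
      using enn2real_mono[OF xy] \<open>x \<le> y\<close> by simp
    moreover have "?L y = ?L x + enn2real (curve_length \<sigma> x y)"
      using fin2 by (simp add: e enn2real_plus)
    ultimately show "dist (?L x) (?L y) \<le> 1 * dist x y"
      using \<open>x \<le> y\<close> by (simp add: dist_real_def)
  qed simp
  have alc: "continuous_on {0..enn2real (curve_length \<sigma> a b)} (arc_length_param (\<sigma>, a, b))"
    using arc_length_param_lipschitz(1)[OF c] by (rule lipschitz_on_continuous_on)
  have "curve_integral (\<sigma>, a, b) g \<le> (\<integral>\<^sup>+ s \<in> {a..b}. g (arc_length_param (\<sigma>, a, b) (?L s)) \<partial>lborel)"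
    unfolding curve_integral_def prod.case
    by (rule nn_integral_lipschitz_image[OF lip curve_length_image[OF cont fin ab]])
       (rule path_int_measurable[OF alc g])
  also have "\<dots> = path_int g \<sigma> a b"
    unfolding path_int_def
    by (intro nn_integral_cong) (auto simp: indicator_def arc_length_param_at[OF fin])
  finally show ?thesis .
qed

section \<open>Upper gradients along Lipschitz paths\<close>

lemma upper_gradient_path_int:
  assumes ug: "upper_gradient u g"
    and s: "1-lipschitz_on {a..b} \<sigma>" "a \<le> b" "\<sigma> a \<noteq> \<sigma> b"
  shows "ext_diff (u (\<sigma> a)) (u (\<sigma> b)) \<le> path_int g \<sigma> a b"
proof -
  have "ext_diff (u (\<sigma> a)) (u (\<sigma> b)) \<le> curve_integral (\<sigma>, a, b) g"
    using ug curve_of_lipschitz[OF s] by (auto simp: upper_gradient_def upper_gradient_ineq_def)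
  also have "\<dots> \<le> path_int g \<sigma> a b"
    using ug by (intro curve_integral_le_path_int s) (auto simp: upper_gradient_def)
  finally show ?thesis .
qed

text \<open>The upper gradient inequality for real-valued functions, along 1-Lipschitz paths in place of curves.
Constant paths are included; for them the left-hand side is zero.\<close>
definition path_upper_gradient :: "('a::metric_space \<Rightarrow> real) \<Rightarrow> ('a \<Rightarrow> ennreal) \<Rightarrow> bool" where
  "path_upper_gradient f g \<longleftrightarrow> g \<in> borel_measurable borel \<and>
     (\<forall>\<sigma> len. 0 \<le> len \<longrightarrow> 1-lipschitz_on {0..len} \<sigma> \<longrightarrow>
        ennreal \<bar>f (\<sigma> 0) - f (\<sigma> len)\<bar> \<le> path_int g \<sigma> 0 len)"

lemma path_upper_gradient_imp_upper_gradient: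
  assumes "path_upper_gradient f g"
  shows "upper_gradient (\<lambda>x. ereal (f x)) g"
  unfolding upper_gradient_def
proof (intro conjI ballI)
  show "g \<in> borel_measurable borel" using assms by (simp add: path_upper_gradient_def)
  fix c :: "'a curve" assume c: "c \<in> curves"
  obtain \<gamma> a b where c': "c = (\<gamma>, a, b)" by (cases c)
  define len where "len = enn2real (curve_length \<gamma> a b)"
  note al = arc_length_param_lipschitz[OF c[unfolded c'], folded len_def]
  have "0 \<le> len" by (simp add: len_def)
  then have "ennreal \<bar>f (\<gamma> a) - f (\<gamma> b)\<bar> \<le> path_int g (arc_length_param (\<gamma>, a, b)) 0 len"
    using assms al unfolding path_upper_gradient_def by metis
  then show "upper_gradient_ineq (\<lambda>x. ereal (f x)) g c"
    by (simp add: c' upper_gradient_ineq_def ext_diff_def path_int_def curve_integral_def len_def)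
qed

section \<open>Covering and doubling\<close>

text \<open>By Zorn's lemma there is a maximal disjoint subfamily with the property that whatever meets it meets
one of its members of at least half the radius.  Maximality forces every ball to meet it, since
otherwise a ball of nearly the largest radius among the remaining ones could be added.  Only
the centres have to be covered, so tripling the radii is enough.\<close>
lemma vitali_covering:
  fixes s :: "'a::metric_space \<Rightarrow> real"
  assumes s: "\<And>y. y \<in> E \<Longrightarrow> 0 < s y \<and> s y \<le> s0"
  obtains S where "S \<subseteq> E" "disjoint_family_on (\<lambda>y. ball y (s y)) S"
    "E \<subseteq> (\<Union>y\<in>S. ball y (3 * s y))"
proof -
  define meets where "meets y z \<longleftrightarrow> ball y (s y) \<inter> ball z (s z) \<noteq> {}" for y z
  define \<Omega> where "\<Omega> = {S. S \<subseteq> E \<and> (\<forall>y\<in>S. \<forall>z\<in>S. y \<noteq> z \<longrightarrow> \<not> meets y z) \<and>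
      (\<forall>y\<in>E. (\<exists>z\<in>S. meets y z) \<longrightarrow> (\<exists>z\<in>S. meets y z \<and> s y \<le> 2 * s z))}"
  have \<Omega>D: "\<exists>z\<in>S. meets y z \<and> s y \<le> 2 * s z" if "S \<in> \<Omega>" "y \<in> E" "\<exists>z\<in>S. meets y z" for S y
    using that by (simp add: \<Omega>_def)
  have "\<exists>S\<in>\<Omega>. \<forall>X\<in>\<Omega>. S \<subseteq> X \<longrightarrow> X = S"
  proof (rule subset_Zorn')
    fix C assume C: "subset.chain \<Omega> C"
    then have ch: "\<And>X Y. X \<in> C \<Longrightarrow> Y \<in> C \<Longrightarrow> X \<subseteq> Y \<or> Y \<subseteq> X" and sub: "C \<subseteq> \<Omega>"
      by (auto simp: subset_chain_def)
    show "\<Union> C \<in> \<Omega>"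
      unfolding \<Omega>_def
    proof (intro CollectI conjI ballI impI)
      show "\<Union> C \<subseteq> E" using sub by (auto simp: \<Omega>_def)
    next
      fix y z assume "y \<in> \<Union> C" "z \<in> \<Union> C" and "y \<noteq> z"
      then obtain Y Z where "Y \<in> C" "y \<in> Y" "Z \<in> C" "z \<in> Z" by auto
      with ch[of Y Z] obtain X where X: "X \<in> C" "y \<in> X" "z \<in> X" by blast
      then have "X \<in> \<Omega>" using sub by blast
      then show "\<not> meets y z" using \<open>y \<in> X\<close> \<open>z \<in> X\<close> \<open>y \<noteq> z\<close> unfolding \<Omega>_def by blast
    next
      fix y assume "y \<in> E" "\<exists>z\<in>\<Union> C. meets y z"
      then obtain X where "X \<in> C" "X \<in> \<Omega>" "\<exists>z\<in>X. meets y z" using sub by auto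
      then have "\<exists>z\<in>X. meets y z \<and> s y \<le> 2 * s z" using \<Omega>D[of X y] \<open>y \<in> E\<close> by blast
      then show "\<exists>z\<in>\<Union> C. meets y z \<and> s y \<le> 2 * s z" using \<open>X \<in> C\<close> by blast
    qed
  qed
  then obtain S where S: "S \<in> \<Omega>" and max: "\<And>X. X \<in> \<Omega> \<Longrightarrow> S \<subseteq> X \<Longrightarrow> X = S" by blast
  define R where "R = {y \<in> E. \<forall>z\<in>S. \<not> meets y z}"
  have "R = {}"
  proof (rule ccontr)
    assume "R \<noteq> {}"
    have disj: "\<forall>y\<in>S. \<forall>z\<in>S. y \<noteq> z \<longrightarrow> \<not> meets y z" using S by (simp add: \<Omega>_def)
    have meets_commute: "meets y z \<longleftrightarrow> meets z y" for y z by (auto simp: meets_def)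
    have bdd: "bdd_above (s ` R)" using s by (auto simp: R_def intro!: bdd_aboveI[of _ s0])
    define t where "t = Sup (s ` R)"
    have le: "s y \<le> t" if "y \<in> R" for y unfolding t_def using bdd that by (intro cSup_upper) auto
    obtain y0 where y0: "y0 \<in> R" using \<open>R \<noteq> {}\<close> by auto
    then have "0 < t" using le[OF y0] s[of y0] by (auto simp: R_def)
    then have "t / 2 < Sup (s ` R)" unfolding t_def[symmetric] by simp
    then obtain y' where y': "y' \<in> R" "t / 2 < s y'"
      using less_cSup_iff[of "s ` R" "t / 2"] bdd \<open>R \<noteq> {}\<close> by blast
    have "insert y' S \<in> \<Omega>"
      unfolding \<Omega>_def
    proof (intro CollectI conjI ballI impI)
      show "insert y' S \<subseteq> E" using S y' by (auto simp: \<Omega>_def R_def)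
    next
      fix y z assume "y \<in> insert y' S" "z \<in> insert y' S" "y \<noteq> z"
      then show "\<not> meets y z"
        using disj y'(1) meets_commute unfolding R_def by blast
    next
      fix y assume y: "y \<in> E" "\<exists>z\<in>insert y' S. meets y z"
      show "\<exists>z\<in>insert y' S. meets y z \<and> s y \<le> 2 * s z"
      proof (cases "\<exists>z\<in>S. meets y z")
        case True
        then show ?thesis using \<Omega>D[OF S y(1)] by blast
      next
        case False
        then have "y \<in> R" "meets y y'" using y by (auto simp: R_def)
        then show ?thesis using le[of y] y'(2) by force
      qed
    qed
    from max[OF this] have "y' \<in> S" by auto
    moreover have "meets y' y'" using y' s[of y'] by (auto simp: meets_def R_def)
    ultimately show False using y' by (auto simp: R_def)
  qed
  show thesis
  proof (rule that[of S])
    show "S \<subseteq> E" using S by (auto simp: \<Omega>_def)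
    show "disjoint_family_on (\<lambda>y. ball y (s y)) S"
      using S by (auto simp: \<Omega>_def disjoint_family_on_def meets_def)
    show "E \<subseteq> (\<Union>y\<in>S. ball y (3 * s y))"
    proof
      fix y assume y: "y \<in> E"
      then have "\<exists>z\<in>S. meets y z" using \<open>R = {}\<close> by (auto simp: R_def)
      then obtain z where z: "z \<in> S" "meets y z" "s y \<le> 2 * s z"
        using \<Omega>D[OF S y] by blast
      then obtain w where "dist y w < s y" "dist z w < s z" by (auto simp: meets_def)
      then have "dist z y < 3 * s z" using z(3) dist_triangle2[of z y w] by simp
      then show "y \<in> (\<Union>y\<in>S. ball y (3 * s y))" using z by auto
    qed
  qed
qed

locale doubling_measure =
  fixes M :: "'a::complete_space measure" and D :: real
  assumes sets_M: "sets borel \<subseteq> sets M"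
    and space_M [simp]: "space M = UNIV"
    and D_ge_1: "1 \<le> D"
    and emeasure_ball_pos: "0 < r \<Longrightarrow> 0 < emeasure M (ball x r)"
    and emeasure_ball_finite: "emeasure M (ball x r) < \<infinity>"
    and emeasure_ball_double: "0 < r \<Longrightarrow> emeasure M (ball x (2 * r)) \<le> ennreal D * emeasure M (ball x r)"
begin

lemma open_M [measurable (raw)]: "open U \<Longrightarrow> U \<in> sets M"
  using sets_M by auto

lemma borel_M: "U \<in> sets borel \<Longrightarrow> U \<in> sets M"
  using sets_M by auto

lemma borel_measurable_M: "f \<in> borel_measurable borel \<Longrightarrow> f \<in> borel_measurable M"
  using sets_M by (auto simp: measurable_def)

abbreviation vol :: "'a \<Rightarrow> real \<Rightarrow> real" where
  "vol x r \<equiv> measure M (ball x r)"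

lemma emeasure_ball: "emeasure M (ball x r) = ennreal (vol x r)"
  using emeasure_ball_finite[of x r] by (simp add: emeasure_eq_ennreal_measure less_top)

lemma ball_fmeasurable [simp]: "ball x r \<in> fmeasurable M"
  using emeasure_ball_finite[of x r] by (intro fmeasurableI) auto

lemma vol_pos: "0 < r \<Longrightarrow> 0 < vol x r"
  using emeasure_ball_pos[of r x] by (simp add: emeasure_ball)

lemma measure_mono_ball:
  assumes "A \<subseteq> ball x r" "A \<in> sets M" shows "measure M A \<le> vol x r"
  using assms by (intro measure_mono_fmeasurable) auto

lemma fmeasurable_in_ball:
  assumes "A \<subseteq> ball x r" "A \<in> sets M" shows "A \<in> fmeasurable M"
  using assms by (intro fmeasurableI2[OF ball_fmeasurable])

lemma vol_double: "0 < r \<Longrightarrow> vol x (2 * r) \<le> D * vol x r"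
  using emeasure_ball_double[of r x] D_ge_1
  by (simp add: emeasure_ball ennreal_mult[symmetric])

lemma vol_double_iterate: "0 < r \<Longrightarrow> vol x (2 ^ n * r) \<le> D ^ n * vol x r"
proof (induction n)
  case (Suc n)
  have "vol x (2 ^ Suc n * r) \<le> D * vol x (2 ^ n * r)"
    using vol_double[of "2 ^ n * r" x] Suc.prems by (simp add: mult.assoc)
  also have "\<dots> \<le> D * (D ^ n * vol x r)"
    using Suc D_ge_1 by (intro mult_left_mono) auto
  finally show ?case by simp
qed simp

text \<open>The form in which doubling is used: a ball that lies in the \<open>2 ^ n\<close>-fold dilation of another
has at most \<open>D ^ n\<close> times its measure.\<close>
lemma vol_compare:
  assumes "0 < r" "dist x y + R \<le> 2 ^ n * r"
  shows "vol x R \<le> D ^ n * vol y r"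
proof -
  have "ball x R \<subseteq> ball y (2 ^ n * r)"
  proof
    fix z assume "z \<in> ball x R"
    then show "z \<in> ball y (2 ^ n * r)"
      using assms dist_triangle[of y z x] by (simp add: dist_commute)
  qed
  then have "vol x R \<le> vol y (2 ^ n * r)" by (intro measure_mono_ball) auto
  also have "\<dots> \<le> D ^ n * vol y r" by (rule vol_double_iterate[OF assms(1)])
  finally show ?thesis .
qed

lemma sum_disjoint_measure_le:
  assumes "finite F" "disjoint_family_on B F" "\<And>i. i \<in> F \<Longrightarrow> B i \<in> sets M"
    "\<And>i. i \<in> F \<Longrightarrow> B i \<subseteq> ball x R"
  shows "(\<Sum>i\<in>F. measure M (B i)) \<le> vol x R"
proof -
  have "measure M (\<Union>i\<in>F. B i) = (\<Sum>i\<in>F. measure M (B i))"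
  proof (rule measure_finite_Union)
    fix i assume "i \<in> F"
    then have "B i \<in> fmeasurable M" using fmeasurable_in_ball[of "B i" x R] assms by auto
    then show "emeasure M (B i) \<noteq> \<infinity>" by (auto simp: fmeasurable_def)
  qed (use assms in auto)
  moreover have "measure M (\<Union>i\<in>F. B i) \<le> vol x R"
    using assms by (intro measure_mono_ball) auto
  ultimately show ?thesis by simp
qed

lemma finite_disjoint_balls:
  fixes S :: "'a set"
  assumes disj: "disjoint_family_on (\<lambda>y. ball y (s y)) S"
    and sub: "\<And>y. y \<in> S \<Longrightarrow> ball y (s y) \<subseteq> ball x R"
    and c: "0 < c" "\<And>y. y \<in> S \<Longrightarrow> c \<le> vol y (s y)"
  shows "finite S"
proof -
  have "card G \<le> nat \<lfloor>vol x R / c\<rfloor>" if G: "G \<subseteq> S" "finite G" for G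
  proof -
    have "real (card G) * c = (\<Sum>y\<in>G. c)" by simp
    also have "\<dots> \<le> (\<Sum>y\<in>G. vol y (s y))" using c G by (intro sum_mono) auto
    also have "\<dots> \<le> vol x R"
      using G sub disj disjoint_family_on_mono[OF G(1) disj]
      by (intro sum_disjoint_measure_le) auto
    finally have "real (card G) \<le> vol x R / c" using c by (simp add: field_simps)
    then show ?thesis by linarith
  qed
  then show ?thesis using finite_if_finite_subsets_card_bdd by blast
qed

lemma countable_disjoint_balls:
  fixes S :: "'a set"
  assumes disj: "disjoint_family_on (\<lambda>y. ball y (s y)) S"
    and sub: "\<And>y. y \<in> S \<Longrightarrow> ball y (s y) \<subseteq> ball x R"
    and pos: "\<And>y. y \<in> S \<Longrightarrow> 0 < s y"
  shows "countable S"
proof -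
  have "finite {y \<in> S. 1 / real (Suc n) \<le> vol y (s y)}" for n
    by (rule finite_disjoint_balls[where s = s and x = x and R = R and c = "1 / real (Suc n)"])
       (use sub disjoint_family_on_mono[OF _ disj] in auto)
  then have "countable (\<Union>n. {y \<in> S. 1 / real (Suc n) \<le> vol y (s y)})"
    by (intro countable_UN) (auto intro: countable_finite)
  moreover have "S \<subseteq> (\<Union>n. {y \<in> S. 1 / real (Suc n) \<le> vol y (s y)})"
  proof
    fix y assume y: "y \<in> S"
    then obtain n where "inverse (real (Suc n)) < vol y (s y)"
      using reals_Archimedean[OF vol_pos[OF pos[OF y]]] by auto
    then show "y \<in> (\<Union>n. {y \<in> S. 1 / real (Suc n) \<le> vol y (s y)})"
      using y by (auto simp: inverse_eq_divide intro!: exI[of _ n])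
  qed
  ultimately show ?thesis by (rule countable_subset[rotated])
qed

text \<open>Separability: disjoint balls inside a ball form a countable family because each has positive measure.\<close>
lemma covering_sequence:
  assumes "0 < \<rho>"
  obtains q :: "nat \<Rightarrow> 'a" where "(\<Union>i. ball (q i) \<rho>) = UNIV"
proof -
  fix x0 :: 'a
  have "\<exists>S. countable S \<and> ball x0 (real n) \<subseteq> (\<Union>y\<in>S. ball y \<rho>)" for n
  proof -
    obtain S where S: "S \<subseteq> ball x0 (real n)" "disjoint_family_on (\<lambda>y. ball y (\<rho> / 3)) S"
      "ball x0 (real n) \<subseteq> (\<Union>y\<in>S. ball y (3 * (\<rho> / 3)))"
      using assms by (rule_tac vitali_covering[of "ball x0 (real n)" "\<lambda>_. \<rho> / 3" "\<rho> / 3"]) auto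
    have "countable S"
    proof (rule countable_disjoint_balls[OF S(2), of x0 "real n + \<rho> / 3"])
      fix y assume "y \<in> S"
      then have "dist x0 y < real n" using S by auto
      then show "ball y (\<rho> / 3) \<subseteq> ball x0 (real n + \<rho> / 3)"
      proof -
        have "dist x0 z < real n + \<rho> / 3" if "dist y z < \<rho> / 3" for z
          using dist_triangle[of x0 z y] that \<open>dist x0 y < real n\<close> by simp
        then show ?thesis by auto
      qed
    qed (use assms in auto)
    then show ?thesis using S(3) by auto
  qed
  then obtain S where S: "\<And>n. countable (S n)" "\<And>n. ball x0 (real n) \<subseteq> (\<Union>y\<in>S n. ball y \<rho>)"
    by metis
  define Q where "Q = insert x0 (\<Union>n. S n)"
  have Q: "countable Q" "Q \<noteq> {}" using S by (auto simp: Q_def)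
  show thesis
  proof (rule that[of "from_nat_into Q"])
    have "x \<in> (\<Union>i. ball (from_nat_into Q i) \<rho>)" for x
    proof -
      obtain n where "dist x0 x < real n" using reals_Archimedean2 by blast
      then obtain y where "y \<in> S n" "x \<in> ball y \<rho>" using S(2)[of n] by auto
      moreover from this have "y \<in> range (from_nat_into Q)"
        using Q by (auto simp: range_from_nat_into Q_def)
      ultimately show ?thesis by auto
    qed
    then show "(\<Union>i. ball (from_nat_into Q i) \<rho>) = UNIV" by auto
  qed
qed

text \<open>Disjoint balls of equal radius centred in a bounded set have comparable measures by doubling, so there are
only finitely many of them; hence bounded sets are totally bounded.\<close>
lemma compact_cball_M: "compact (cball (x :: 'a) R)"
  unfolding compact_eq_totally_bounded
proof (intro conjI allI impI)
  show "complete (cball x R)" by (simp add: complete_eq_closed)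
  fix \<epsilon> :: real assume "\<epsilon> > 0"
  show "\<exists>k. finite k \<and> cball x R \<subseteq> (\<Union>y\<in>k. ball y \<epsilon>)"
  proof (cases "R \<ge> 0")
    case False
    then show ?thesis by (intro exI[of _ "{}"]) auto
  next
    case True
    obtain S where S: "S \<subseteq> cball x R" "disjoint_family_on (\<lambda>y. ball y (\<epsilon> / 3)) S"
      "cball x R \<subseteq> (\<Union>y\<in>S. ball y (3 * (\<epsilon> / 3)))"
      using \<open>\<epsilon> > 0\<close> by (rule_tac vitali_covering[of "cball x R" "\<lambda>_. \<epsilon> / 3" "\<epsilon> / 3"]) auto
    obtain n where n: "(2 * R + \<epsilon>) / (\<epsilon> / 3) < 2 ^ n"
      using real_arch_pow[of 2] by auto
    have "finite S"
    proof (rule finite_disjoint_balls[OF S(2), of x "R + \<epsilon>" "vol x (R + \<epsilon>) / D ^ n"])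
      fix y assume y: "y \<in> S"
      then have d: "dist x y \<le> R" using S by auto
      show "ball y (\<epsilon> / 3) \<subseteq> ball x (R + \<epsilon>)"
      proof
        fix z assume "z \<in> ball y (\<epsilon> / 3)"
        then show "z \<in> ball x (R + \<epsilon>)" using dist_triangle[of x z y] d \<open>\<epsilon> > 0\<close> by simp
      qed
      have "vol x (R + \<epsilon>) \<le> D ^ n * vol y (\<epsilon> / 3)"
        using d n \<open>\<epsilon> > 0\<close> by (intro vol_compare) (auto simp: field_simps)
      then show "vol x (R + \<epsilon>) / D ^ n \<le> vol y (\<epsilon> / 3)"
        using D_ge_1 by (simp add: field_simps)
    next
      show "0 < vol x (R + \<epsilon>) / D ^ n" using D_ge_1 vol_pos[of "R + \<epsilon>" x] True \<open>\<epsilon> > 0\<close> by auto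
    qed
    then show ?thesis using S(3) by auto
  qed
qed

end

section \<open>Operations on Lipschitz paths\<close>

lemma path_int_shift:
  fixes \<sigma> :: "real \<Rightarrow> 'a::metric_space"
  assumes "continuous_on {p..q} \<sigma>" "g \<in> borel_measurable borel"
  shows "path_int g (\<lambda>l. \<sigma> (p + l)) 0 (q - p) = path_int g \<sigma> p q"
  unfolding path_int_def
  by (subst nn_integral_real_affine[OF path_int_measurable[OF assms], of 1 p])
     (auto intro!: nn_integral_cong simp: indicator_def)

lemma path_int_reverse:
  fixes \<sigma> :: "real \<Rightarrow> 'a::metric_space"
  assumes "continuous_on {0..len} \<sigma>" "g \<in> borel_measurable borel"
  shows "path_int g (\<lambda>l. \<sigma> (len - l)) 0 len = path_int g \<sigma> 0 len"
  unfolding path_int_def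
  by (subst nn_integral_real_affine[OF path_int_measurable[OF assms], of "-1" len])
     (auto intro!: nn_integral_cong simp: indicator_def)

lemma lipschitz_reverse:
  assumes "1-lipschitz_on {0..len} \<sigma>"
  shows "1-lipschitz_on {0..len::real} (\<lambda>l. \<sigma> (len - l))"
proof (rule lipschitz_onI)
  fix x y assume "x \<in> {0..len}" "y \<in> {0..len}"
  then show "dist (\<sigma> (len - x)) (\<sigma> (len - y)) \<le> 1 * dist x y"
    using lipschitz_onD[OF assms, of "len - x" "len - y"] by (auto simp: dist_real_def abs_minus_commute)
qed simp

lemma lipschitz_shift:
  assumes "1-lipschitz_on {p..q} \<sigma>"
  shows "1-lipschitz_on {0..q - p::real} (\<lambda>l. \<sigma> (p + l))"
proof (rule lipschitz_onI)
  fix x y assume "x \<in> {0..q - p}" "y \<in> {0..q - p}"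
  then show "dist (\<sigma> (p + x)) (\<sigma> (p + y)) \<le> 1 * dist x y"
    using lipschitz_onD[OF assms, of "p + x" "p + y"] by (auto simp: dist_real_def)
qed simp

lemma path_upper_gradientD:
  assumes f: "path_upper_gradient f g" and \<sigma>: "1-lipschitz_on {p..q} \<sigma>" and pq: "p \<le> q"
  shows "ennreal \<bar>f (\<sigma> p) - f (\<sigma> q)\<bar> \<le> path_int g \<sigma> p q"
proof -
  have "ennreal \<bar>f (\<sigma> (p + 0)) - f (\<sigma> (p + (q - p)))\<bar> \<le> path_int g (\<lambda>l. \<sigma> (p + l)) 0 (q - p)"
    using f lipschitz_shift[OF \<sigma>] pq unfolding path_upper_gradient_def
    by (metis diff_ge_0_iff_ge)
  then show ?thesis
    using path_int_shift[OF lipschitz_on_continuous_on[OF \<sigma>], of g] f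
    by (simp add: path_upper_gradient_def)
qed

text \<open>One-sided estimates suffice, because a path can be run backwards.\<close>
lemma path_upper_gradientI:
  fixes f :: "'a::metric_space \<Rightarrow> real"
  assumes g: "g \<in> borel_measurable borel"
    and le: "\<And>\<sigma> len. 0 \<le> len \<Longrightarrow> 1-lipschitz_on {0..len} \<sigma> \<Longrightarrow> f (\<sigma> len) < f (\<sigma> 0) \<Longrightarrow>
      ennreal (f (\<sigma> 0) - f (\<sigma> len)) \<le> path_int g \<sigma> 0 len"
  shows "path_upper_gradient f g"
  unfolding path_upper_gradient_def
proof (intro conjI allI impI g)
  fix \<sigma> :: "real \<Rightarrow> 'a" and len :: real assume s: "0 \<le> len" "1-lipschitz_on {0..len} \<sigma>"
  consider "f (\<sigma> len) < f (\<sigma> 0)" | "f (\<sigma> 0) < f (\<sigma> len)" | "f (\<sigma> 0) = f (\<sigma> len)" by linarith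
  then show "ennreal \<bar>f (\<sigma> 0) - f (\<sigma> len)\<bar> \<le> path_int g \<sigma> 0 len"
  proof cases
    case 1
    then show ?thesis using le[OF s] by simp
  next
    case 2
    then show ?thesis
      using le[OF s(1) lipschitz_reverse[OF s(2)]]
        path_int_reverse[OF lipschitz_on_continuous_on[OF s(2)] g] by simp
  qed simp
qed

section \<open>The path potential and its lower semicontinuity\<close>

text \<open>The distance from \<open>y\<close> to \<open>K\<close> in the length metric weighted by \<open>g\<close>.\<close>
definition path_potential :: "('a::metric_space \<Rightarrow> ennreal) \<Rightarrow> 'a set \<Rightarrow> 'a \<Rightarrow> ennreal" where
  "path_potential g K y = (INF (\<sigma>, len) \<in> {(\<sigma>, len). 0 \<le> len \<and> 1-lipschitz_on {0..len} \<sigma> \<and> \<sigma> 0 = y \<and> \<sigma> len \<in> K}.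
     path_int g \<sigma> 0 len)"

lemma path_potential_le:
  "0 \<le> len \<Longrightarrow> 1-lipschitz_on {0..len} \<sigma> \<Longrightarrow> \<sigma> len \<in> K \<Longrightarrow> path_potential g K (\<sigma> 0) \<le> path_int g \<sigma> 0 len"
  unfolding path_potential_def by (rule INF_lower2[of "(\<sigma>, len)"]) auto

lemma path_potential_geI:
  assumes "\<And>\<sigma> len. 0 \<le> len \<Longrightarrow> 1-lipschitz_on {0..len} \<sigma> \<Longrightarrow> \<sigma> 0 = y \<Longrightarrow> \<sigma> len \<in> K \<Longrightarrow> c \<le> path_int g \<sigma> 0 len"
  shows "c \<le> path_potential g K y"
  unfolding path_potential_def by (rule INF_greatest) (use assms in auto)

lemma path_potential_lessE:
  assumes "path_potential g K y < c"
  obtains \<sigma> len where "0 \<le> len" "1-lipschitz_on {0..len} \<sigma>" "\<sigma> 0 = y" "\<sigma> len \<in> K" "path_int g \<sigma> 0 len < c"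
  using assms unfolding path_potential_def INF_less_iff by auto

lemma path_int_singleton: "path_int g \<sigma> a a = 0"
proof -
  have "AE l in lborel. g (\<sigma> l) * indicator {a..a} l = 0"
    using AE_lborel_singleton[of a] by eventually_elim (auto simp: indicator_def)
  from nn_integral_cong_AE[OF this] show ?thesis by (simp add: path_int_def)
qed

lemma path_potential_on: "y \<in> K \<Longrightarrow> path_potential g K y = 0"
  using path_potential_le[of 0 "\<lambda>_. y" K g] by (simp add: path_int_singleton)

lemma path_int_concat:
  fixes \<sigma> \<tau> :: "real \<Rightarrow> 'a::metric_space"
  assumes s: "0 \<le> l1" "1-lipschitz_on {0..l1} \<sigma>" and t: "0 \<le> l2" "1-lipschitz_on {0..l2} \<tau>"
    and eq: "\<sigma> l1 = \<tau> 0" and g: "g \<in> borel_measurable borel"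
  obtains \<rho> where "1-lipschitz_on {0..l1 + l2} \<rho>" "\<rho> 0 = \<sigma> 0" "\<rho> (l1 + l2) = \<tau> l2"
    "path_int g \<rho> 0 (l1 + l2) \<le> path_int g \<sigma> 0 l1 + path_int g \<tau> 0 l2"
proof
  define \<rho> where "\<rho> l = (if l \<le> l1 then \<sigma> l else \<tau> (l - l1))" for l
  have lip2: "1-lipschitz_on {l1..l1 + l2} (\<lambda>l. \<tau> (l - l1))"
  proof (rule lipschitz_onI)
    fix x y assume "x \<in> {l1..l1 + l2}" "y \<in> {l1..l1 + l2}"
    then show "dist (\<tau> (x - l1)) (\<tau> (y - l1)) \<le> 1 * dist x y"
      using lipschitz_onD[OF t(2), of "x - l1" "y - l1"] by (auto simp: dist_real_def)
  qed simp
  show "1-lipschitz_on {0..l1 + l2} \<rho>"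
    unfolding \<rho>_def
    by (rule lipschitz_on_concat[OF s(2) lip2]) (use eq in auto)
  show "\<rho> 0 = \<sigma> 0" using s by (simp add: \<rho>_def)
  show "\<rho> (l1 + l2) = \<tau> l2" using s t eq by (cases "l2 = 0") (auto simp: \<rho>_def)
  have c2: "continuous_on {l1..l1 + l2} (\<lambda>l. \<tau> (l - l1))" using lip2 by (rule lipschitz_on_continuous_on)
  have c1: "continuous_on {0..l1} \<sigma>" using s(2) by (rule lipschitz_on_continuous_on)
  have "path_int g \<rho> 0 (l1 + l2) \<le>
    (\<integral>\<^sup>+ l. g (\<sigma> l) * indicator {0..l1} l + g (\<tau> (l - l1)) * indicator {l1..l1 + l2} l \<partial>lborel)"
    unfolding path_int_def by (intro nn_integral_mono) (auto simp: indicator_def \<rho>_def)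
  also have "\<dots> = path_int g \<sigma> 0 l1 + path_int g (\<lambda>l. \<tau> (l - l1)) l1 (l1 + l2)"
    unfolding path_int_def
    using path_int_measurable[OF c1 g] path_int_measurable[OF c2 g]
    by (intro nn_integral_add) auto
  also have "path_int g (\<lambda>l. \<tau> (l - l1)) l1 (l1 + l2) = path_int g \<tau> 0 l2"
    using path_int_shift[OF c2 g] by simp
  finally show "path_int g \<rho> 0 (l1 + l2) \<le> path_int g \<sigma> 0 l1 + path_int g \<tau> 0 l2" .
qed

lemma path_potential_path:
  fixes \<sigma> :: "real \<Rightarrow> 'a::metric_space"
  assumes g: "g \<in> borel_measurable borel" and s: "0 \<le> len" "1-lipschitz_on {0..len} \<sigma>"
  shows "path_potential g K (\<sigma> 0) \<le> path_int g \<sigma> 0 len + path_potential g K (\<sigma> len)"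
proof (cases "path_int g \<sigma> 0 len = top")
  case False
  have "path_potential g K (\<sigma> 0) - path_int g \<sigma> 0 len \<le> path_potential g K (\<sigma> len)"
  proof (rule path_potential_geI)
    fix \<tau> :: "real \<Rightarrow> 'a" and l2 :: real assume t: "0 \<le> l2" "1-lipschitz_on {0..l2} \<tau>" "\<tau> 0 = \<sigma> len" "\<tau> l2 \<in> K"
    obtain \<rho> where r: "1-lipschitz_on {0..len + l2} \<rho>" "\<rho> 0 = \<sigma> 0" "\<rho> (len + l2) = \<tau> l2"
      "path_int g \<rho> 0 (len + l2) \<le> path_int g \<sigma> 0 len + path_int g \<tau> 0 l2"
      using path_int_concat[OF s t(1,2) t(3)[symmetric] g] .
    have "path_potential g K (\<sigma> 0) \<le> path_int g \<rho> 0 (len + l2)"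
      using path_potential_le[of "len + l2" \<rho> K g] r t s by simp
    also note r(4)
    finally show "path_potential g K (\<sigma> 0) - path_int g \<sigma> 0 len \<le> path_int g \<tau> 0 l2"
      using False by (simp add: ennreal_minus_le_iff)
  qed
  then show ?thesis using False by (simp add: ennreal_minus_le_iff)
qed simp

text \<open>A pointwise form of the theorem of Arzela and Ascoli: convergence at the rationals by a diagonal
argument, and then everywhere since the paths are equicontinuous and the space is complete.\<close>
lemma lipschitz_paths_subsequence:
  fixes \<sigma> :: "nat \<Rightarrow> real \<Rightarrow> 'a::complete_space"
  assumes comp: "\<And>R. compact (cball y R)"
    and lip: "\<And>n. 1-lipschitz_on UNIV (\<sigma> n)" and start: "\<And>n. \<sigma> n 0 \<in> cball y R"
  obtains r s where "strict_mono r" "1-lipschitz_on UNIV s" "\<And>l. (\<lambda>n. \<sigma> (r n) l) \<longlonglongrightarrow> s l"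
proof -
  define q :: "nat \<Rightarrow> real" where "q = from_nat_into \<rat>"
  have q: "range q = \<rat>"
    unfolding q_def by (rule range_from_nat_into) (auto simp: countable_rat)
  interpret subseqs "\<lambda>k s. convergent (\<lambda>n. \<sigma> (s n) (q k))"
  proof
    fix k and s :: "nat \<Rightarrow> nat" assume "strict_mono s"
    have "\<sigma> (s n) (q k) \<in> cball y (R + \<bar>q k\<bar>)" for n
      using lipschitz_onD[OF lip[of "s n"], of 0 "q k"] start[of "s n"]
        dist_triangle[of y "\<sigma> (s n) (q k)" "\<sigma> (s n) 0"] by (simp add: dist_real_def)
    then obtain l r where "strict_mono r" "((\<lambda>n. \<sigma> (s n) (q k)) \<circ> r) \<longlonglongrightarrow> l"
      using comp[of "R + \<bar>q k\<bar>"] unfolding compact_def by meson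
    then show "\<exists>r'. strict_mono r' \<and> convergent (\<lambda>n. \<sigma> ((s \<circ> r') n) (q k))"
      by (auto simp: convergent_def o_def)
  qed
  define r where "r = diagseq"
  have conv: "convergent (\<lambda>n. \<sigma> (r n) (q k))" for k
  proof -
    have "convergent (\<lambda>n. \<sigma> ((diagseq \<circ> (+) (Suc k)) n) (q k))"
    proof (rule diagseq_holds)
      fix r s :: "nat \<Rightarrow> nat" and n assume "strict_mono r" "convergent (\<lambda>i. \<sigma> (s i) (q n))"
      then show "convergent (\<lambda>i. \<sigma> ((s \<circ> r) i) (q n))"
        using convergent_subseq_convergent[of "\<lambda>i. \<sigma> (s i) (q n)" r] by (simp add: o_def)
    qed
    then obtain L where "(\<lambda>n. \<sigma> (r (n + Suc k)) (q k)) \<longlonglongrightarrow> L"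
      by (auto simp: convergent_def r_def o_def add.commute)
    then show ?thesis
      unfolding convergent_def by (intro exI[of _ L]) (rule LIMSEQ_offset[where k = "Suc k"])
  qed
  have "Cauchy (\<lambda>n. \<sigma> (r n) l)" for l
  proof (rule metric_CauchyI)
    fix e :: real assume "0 < e"
    obtain x where x: "x \<in> \<rat>" "l < x" "x < l + e / 3"
      using Rats_dense_in_real[of l "l + e / 3"] \<open>0 < e\<close> by auto
    then obtain k where k: "x = q k" using q by auto
    obtain N where N: "\<And>m n. m \<ge> N \<Longrightarrow> n \<ge> N \<Longrightarrow> dist (\<sigma> (r m) x) (\<sigma> (r n) x) < e / 3"
      using convergent_Cauchy[OF conv[of k]] \<open>0 < e\<close> unfolding k Cauchy_def
      by (meson divide_pos_pos zero_less_numeral)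
    show "\<exists>N. \<forall>m\<ge>N. \<forall>n\<ge>N. dist (\<sigma> (r m) l) (\<sigma> (r n) l) < e"
    proof (intro exI allI impI)
      fix m n assume "N \<le> m" "N \<le> n"
      have d: "dist (\<sigma> i l) (\<sigma> i x) < e / 3" for i
        using lipschitz_onD[OF lip[of i], of l x] x by (auto simp: dist_real_def)
      show "dist (\<sigma> (r m) l) (\<sigma> (r n) l) < e"
        using N[OF \<open>N \<le> m\<close> \<open>N \<le> n\<close>] d[of "r m"] d[of "r n"]
          dist_triangle[of "\<sigma> (r m) l" "\<sigma> (r n) l" "\<sigma> (r m) x"]
          dist_triangle[of "\<sigma> (r m) x" "\<sigma> (r n) l" "\<sigma> (r n) x"]
        by (simp add: dist_commute)
    qed
  qed
  then have "\<exists>s. (\<lambda>n. \<sigma> (r n) l) \<longlonglongrightarrow> s" for l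
    using Cauchy_convergent_iff convergent_def by blast
  then obtain s where s: "\<And>l. (\<lambda>n. \<sigma> (r n) l) \<longlonglongrightarrow> s l" by metis
  have "1-lipschitz_on UNIV s"
  proof (rule lipschitz_onI)
    fix x y :: real
    have "(\<lambda>n. dist (\<sigma> (r n) x) (\<sigma> (r n) y)) \<longlonglongrightarrow> dist (s x) (s y)"
      by (intro tendsto_dist s)
    then show "dist (s x) (s y) \<le> 1 * dist x y"
      by (rule LIMSEQ_le_const2) (use lipschitz_onD[OF lip] in auto)
  qed simp
  with s show thesis using subseq_diagseq by (intro that[of r s]) (auto simp: r_def)
qed

text \<open>Fatou's lemma, once \<open>g \<circ> s\<close> is bounded by the lower limit of the values of \<open>g\<close> along the sequence.\<close>
lemma path_int_lsc:
  fixes \<sigma> :: "nat \<Rightarrow> real \<Rightarrow> 'a::metric_space"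
  assumes g: "g \<in> borel_measurable borel" and lsc: "\<And>t. open {y. t < g y}"
    and lip: "\<And>n. 1-lipschitz_on {0..len n} (\<sigma> n)"
    and conv: "\<And>l. (\<lambda>n. \<sigma> n l) \<longlonglongrightarrow> s l" and len: "len \<longlonglongrightarrow> L"
    and le: "\<And>n. path_int g (\<sigma> n) 0 (len n) \<le> C"
  shows "path_int g s 0 L \<le> C"
proof -
  define f where "f n l = g (\<sigma> n l) * indicator {0..len n} l" for n l
  have fm: "f n \<in> borel_measurable lborel" for n
    using path_int_measurable[OF lipschitz_on_continuous_on[OF lip] g, of n] by (simp add: f_def[abs_def])
  have *: "g (s l) \<le> liminf (\<lambda>n. f n l)" if "0 \<le> l" "l < L" for l
    unfolding le_Liminf_iff
  proof (intro allI impI)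
    fix z assume "z < g (s l)"
    then have "eventually (\<lambda>n. \<sigma> n l \<in> {y. z < g y}) sequentially"
      by (intro topological_tendstoD[OF conv lsc]) auto
    moreover have "eventually (\<lambda>n. l < len n) sequentially" using order_tendstoD(1)[OF len that(2)] .
    ultimately show "eventually (\<lambda>n. z < f n l) sequentially"
      by eventually_elim (use that in \<open>simp add: f_def\<close>)
  qed
  have "path_int g s 0 L \<le> (\<integral>\<^sup>+ l. liminf (\<lambda>n. f n l) \<partial>lborel)"
    unfolding path_int_def
  proof (rule nn_integral_mono_AE)
    have "AE l in lborel. l \<noteq> L" by (rule AE_lborel_singleton)
    then show "AE l in lborel. g (s l) * indicator {0..L} l \<le> liminf (\<lambda>n. f n l)"
      by eventually_elim (use * in \<open>auto simp: indicator_def\<close>)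
  qed
  also have "\<dots> \<le> liminf (\<lambda>n. integral\<^sup>N lborel (f n))" by (rule nn_integral_liminf[OF fm])
  also have "\<dots> \<le> limsup (\<lambda>n. integral\<^sup>N lborel (f n))" by (rule Liminf_le_Limsup) simp
  also have "\<dots> \<le> C"
    using le by (intro Limsup_bounded always_eventually) (simp add: f_def[abs_def] path_int_def)
  finally show ?thesis .
qed

text \<open>Nearly optimal paths from a convergent sequence of points have bounded length because \<open>g\<close> is bounded below.
A subsequence therefore converges, and its limit is a path that competes at the limit point.\<close>
lemma path_potential_lsc:
  fixes g :: "'a::complete_space \<Rightarrow> ennreal"
  assumes comp: "\<And>y R. compact (cball (y :: 'a) R)"
    and g: "g \<in> borel_measurable borel" and lsc: "\<And>t. open {y. t < g y}"
    and c: "0 < c" "\<And>y. ennreal c \<le> g y" and K: "closed K"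
  shows "open {y. t < path_potential g K y}"
proof -
  have "closed {y. path_potential g K y \<le> t}"
    unfolding closed_sequential_limits
  proof (intro allI impI, elim conjE)
    fix Y y assume Y: "\<forall>n. Y n \<in> {y. path_potential g K y \<le> t}" and lim: "Y \<longlonglongrightarrow> y"
    have "path_potential g K y \<le> t"
    proof (rule ennreal_le_epsilon)
      fix e :: real assume "t < top" "0 < e"
      obtain T where T: "t = ennreal T" "0 \<le> T" using \<open>t < top\<close> by (cases t) auto
      have "path_potential g K (Y n) < ennreal (T + e)" for n
      proof (rule le_less_trans)
        show "path_potential g K (Y n) \<le> ennreal T" using Y T by simp
        show "ennreal T < ennreal (T + e)" using T \<open>0 < e\<close> by (intro ennreal_lessI) auto
      qed
      then have "\<exists>s len. 0 \<le> len \<and> 1-lipschitz_on {0..len} s \<and> s 0 = Y n \<and> s len \<in> K \<and>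
          path_int g s 0 len < ennreal (T + e)" for n
        using path_potential_lessE[of g K "Y n"] by metis
      then obtain s len where s: "\<And>n. 0 \<le> len n" "\<And>n. 1-lipschitz_on {0..len n} (s n)"
        "\<And>n. s n 0 = Y n" "\<And>n. s n (len n) \<in> K" "\<And>n. path_int g (s n) 0 (len n) < ennreal (T + e)"
        by metis
      have lenb: "len n \<le> (T + e) / c" for n
      proof -
        have "ennreal (c * len n) = (\<integral>\<^sup>+ l. ennreal c * indicator {0..len n} l \<partial>lborel)"
          using s(1)[of n] c by (simp add: nn_integral_cmult_indicator ennreal_mult)
        also have "\<dots> \<le> path_int g (s n) 0 (len n)"
          unfolding path_int_def using c by (intro nn_integral_mono) (auto simp: indicator_def)
        also have "\<dots> \<le> ennreal (T + e)" using s(5) by (rule less_imp_le)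
        finally have "c * len n \<le> T + e"
          by (subst (asm) ennreal_le_iff) (use T \<open>0 < e\<close> in auto)
        then show ?thesis using c by (simp add: field_simps)
      qed
      define \<sigma> where "\<sigma> n l = s n (max 0 (min l (len n)))" for n l
      have lip: "1-lipschitz_on UNIV (\<sigma> n)" for n
      proof (rule lipschitz_onI)
        fix x y :: real
        have "dist (\<sigma> n x) (\<sigma> n y) \<le> 1 * dist (max 0 (min x (len n))) (max 0 (min y (len n)))"
          unfolding \<sigma>_def using s(1)[of n] by (intro lipschitz_onD[OF s(2)]) auto
        also have "\<dots> \<le> dist x y" by (auto simp: dist_real_def)
        finally show "dist (\<sigma> n x) (\<sigma> n y) \<le> 1 * dist x y" by simp
      qed simp
      have "bounded (range Y)" using lim by (rule convergent_imp_bounded)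
      then obtain R where R: "\<And>n. dist y (Y n) \<le> R" by (auto simp: bounded_any_center[where a = y])
      have "\<sigma> n 0 \<in> cball y R" for n using R[of n] s(1,3) by (simp add: \<sigma>_def)
      then obtain r \<gamma> where r: "strict_mono r" and \<gamma>: "1-lipschitz_on UNIV \<gamma>" "\<And>l. (\<lambda>n. \<sigma> (r n) l) \<longlonglongrightarrow> \<gamma> l"
        using lipschitz_paths_subsequence[of y \<sigma> R, OF comp lip] by blast
      have "\<forall>n. len (r n) \<in> {0..(T + e) / c}" using lenb s(1) by auto
      then obtain r' L where r': "strict_mono r'" "L \<in> {0..(T + e) / c}" "((\<lambda>n. len (r n)) \<circ> r') \<longlonglongrightarrow> L"
        using compact_Icc[of 0 "(T + e) / c"] unfolding compact_def
        by (elim allE[of _ "\<lambda>n. len (r n)"]) blast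
      define p where "p n = r (r' n)" for n
      have \<gamma>p: "(\<lambda>n. \<sigma> (p n) l) \<longlonglongrightarrow> \<gamma> l" for l
        using LIMSEQ_subseq_LIMSEQ[OF \<gamma>(2)[of l] r'(1)] by (simp add: o_def p_def)
      have Lp: "(\<lambda>n. len (p n)) \<longlonglongrightarrow> L" using r'(3) by (simp add: o_def p_def)
      have "strict_mono p" unfolding p_def using strict_mono_o[OF r r'(1)] by (simp add: o_def)
      then have "(\<lambda>n. Y (p n)) \<longlonglongrightarrow> y" using LIMSEQ_subseq_LIMSEQ[OF lim] by (simp add: o_def)
      moreover have "(\<lambda>n. Y (p n)) \<longlonglongrightarrow> \<gamma> 0" using \<gamma>p[of 0] s(1,3) by (simp add: \<sigma>_def)
      ultimately have \<gamma>0: "\<gamma> 0 = y" by (metis LIMSEQ_unique)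
      have "(\<lambda>n. \<sigma> (p n) (len (p n))) \<longlonglongrightarrow> \<gamma> L"
      proof (rule metric_tendsto_imp_tendsto)
        show "(\<lambda>n. dist (\<sigma> (p n) L) (\<gamma> L) + dist (len (p n)) L) \<longlonglongrightarrow> 0"
          using tendsto_add[OF tendsto_dist[OF \<gamma>p[of L] tendsto_const[of "\<gamma> L"]] tendsto_dist[OF Lp tendsto_const[of L]]]
          by simp
        show "eventually (\<lambda>n. dist (\<sigma> (p n) (len (p n))) (\<gamma> L) \<le> dist (dist (\<sigma> (p n) L) (\<gamma> L) + dist (len (p n)) L) 0) sequentially"
        proof (rule always_eventually, rule allI)
          fix n
          have "dist (\<sigma> (p n) (len (p n))) (\<sigma> (p n) L) \<le> dist (len (p n)) L"
            using lipschitz_onD[OF lip, of "len (p n)" L "p n"] by simp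
          then show "dist (\<sigma> (p n) (len (p n))) (\<gamma> L) \<le> dist (dist (\<sigma> (p n) L) (\<gamma> L) + dist (len (p n)) L) 0"
            using dist_triangle[of "\<sigma> (p n) (len (p n))" "\<gamma> L" "\<sigma> (p n) L"] by (simp add: dist_real_def)
        qed
      qed
      moreover have "\<sigma> (p n) (len (p n)) \<in> K" for n using s(1,4)[of "p n"] by (simp add: \<sigma>_def)
      ultimately have \<gamma>L: "\<gamma> L \<in> K"
        using closed_sequentially[OF K, of "\<lambda>n. \<sigma> (p n) (len (p n))"] by simp
      have "path_int g \<gamma> 0 L \<le> ennreal (T + e)"
      proof (rule path_int_lsc[OF g lsc _ \<gamma>p Lp])
        show "1-lipschitz_on {0..len (p n)} (\<sigma> (p n))" for n
          using lip by (rule lipschitz_on_subset) simp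
        fix n
        have "path_int g (\<sigma> (p n)) 0 (len (p n)) = path_int g (s (p n)) 0 (len (p n))"
          unfolding path_int_def by (intro nn_integral_cong) (auto simp: \<sigma>_def indicator_def)
        then show "path_int g (\<sigma> (p n)) 0 (len (p n)) \<le> ennreal (T + e)"
          using s(5)[of "p n"] by simp
      qed
      moreover have "path_potential g K (\<gamma> 0) \<le> path_int g \<gamma> 0 L"
        using r'(2) \<gamma>L \<gamma>(1) by (intro path_potential_le) (auto intro: lipschitz_on_subset)
      ultimately show "path_potential g K y \<le> t + ennreal e"
        using \<gamma>0 T \<open>0 < e\<close> by simp
    qed
    then show "y \<in> {y. path_potential g K y \<le> t}" by simp
  qed
  then show ?thesis by (simp add: closed_def Collect_neg_eq[symmetric] not_le)
qed

section \<open>Lower semicontinuous majorants\<close>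

text \<open>The sets that can be squeezed between closed and open sets up to any error form a sigma-algebra
that contains the open sets.\<close>
lemma finite_borel_measure_regular:
  fixes N :: "'a::metric_space measure"
  assumes fin: "finite_measure N" and borel: "sets borel \<subseteq> sets N"
    and B: "B \<in> sets borel" and "0 < e"
  obtains F U where "closed F" "open U" "F \<subseteq> B" "B \<subseteq> U" "measure N (U - F) < e"
proof -
  interpret finite_measure N by fact
  have op: "U \<in> sets N" if "open U" for U using borel that by auto
  have cl: "F \<in> sets N" if "closed F" for F using borel that by auto
  have "B \<in> sigma_sets UNIV {S. open S}" using B by (simp add: sets_borel)
  then have "\<forall>e>0. \<exists>F U. closed F \<and> open U \<and> F \<subseteq> B \<and> B \<subseteq> U \<and> measure N (U - F) < e"
  proof (induction rule: sigma_sets.induct)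
    case (Basic U)
    then have U: "open U" by simp
    show ?case
    proof (intro allI impI)
      fix e :: real assume "0 < e"
      show "\<exists>F U'. closed F \<and> open U' \<and> F \<subseteq> U \<and> U \<subseteq> U' \<and> measure N (U' - F) < e"
      proof (cases "- U = {}")
        case True
        then have "U = UNIV" by auto
        then show ?thesis using \<open>0 < e\<close> by (intro exI[of _ UNIV]) auto
      next
        case False
        define F where "F n = {y. 1 / real (Suc n) \<le> infdist y (- U)}" for n
        have F: "closed (F n)" for n
          unfolding F_def by (intro closed_Collect_le continuous_intros)
        have FU: "F n \<subseteq> U" for n
        proof
          fix y assume y: "y \<in> F n"
          show "y \<in> U"
          proof (rule ccontr)
            assume "y \<notin> U"
            then have "infdist y (- U) = 0" by simp
            then show False using y by (simp add: F_def)
          qed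
        qed
        have "(\<lambda>n. measure N (U - F n)) \<longlonglongrightarrow> measure N (\<Inter>n. U - F n)"
        proof (rule finite_Lim_measure_decseq)
          show "range (\<lambda>n. U - F n) \<subseteq> sets N" using op[OF U] cl[OF F] by auto
          have "F m \<subseteq> F n" if "m \<le> n" for m n
          proof -
            have "1 / real (Suc n) \<le> 1 / real (Suc m)" using that by (intro divide_left_mono) auto
            then show ?thesis by (auto simp: F_def)
          qed
          then show "decseq (\<lambda>n. U - F n)" by (auto simp: decseq_def)
        qed
        also have "(\<Inter>n. U - F n) = {}"
        proof -
          have "\<exists>n. y \<in> F n" if "y \<in> U" for y
          proof -
            have "infdist y (- U) \<noteq> 0"
              using in_closed_iff_infdist_zero[of "- U" y] U False that by auto
            then have "0 < infdist y (- U)" using infdist_nonneg[of y "- U"] by linarith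
            then obtain n where "inverse (real (Suc n)) < infdist y (- U)"
              using reals_Archimedean by auto
            then show ?thesis by (auto simp: F_def inverse_eq_divide intro!: exI[of _ n])
          qed
          then show ?thesis by auto
        qed
        finally have "eventually (\<lambda>n. measure N (U - F n) < e) sequentially"
          using \<open>0 < e\<close> by (intro order_tendstoD) auto
        then obtain n where "measure N (U - F n) < e" by (auto simp: eventually_sequentially)
        then show ?thesis using F FU U by blast
      qed
    qed
  next
    case Empty
    then show ?case by (intro allI impI exI[of _ "{}"]) auto
  next
    case (Compl A)
    show ?case
    proof (intro allI impI)
      fix e :: real assume "0 < e"
      then obtain F U where FU: "closed F" "open U" "F \<subseteq> A" "A \<subseteq> U" "measure N (U - F) < e"
        using Compl(2) by metis
      moreover have "- F - - U = U - F" by auto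
      ultimately show "\<exists>F U. closed F \<and> open U \<and> F \<subseteq> UNIV - A \<and> UNIV - A \<subseteq> U \<and> measure N (U - F) < e"
        by (intro exI[of _ "- U"] exI[of _ "- F"] conjI) (auto simp: closed_Compl open_Compl)
    qed
  next
    case (Union A)
    show ?case
    proof (intro allI impI)
      fix e :: real assume "0 < e"
      have "\<exists>F U. closed F \<and> open U \<and> F \<subseteq> A i \<and> A i \<subseteq> U \<and> measure N (U - F) < e / 2 * (1/2) ^ Suc i" for i
        by (rule Union(2)[rule_format]) (use \<open>0 < e\<close> in simp)
      then obtain F U where FU: "\<And>i. closed (F i)" "\<And>i. open (U i)" "\<And>i. F i \<subseteq> A i" "\<And>i. A i \<subseteq> U i"
        "\<And>i. measure N (U i - F i) < e / 2 * (1/2) ^ Suc i" by metis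
      have m: "U i - F i \<in> sets N" "F i \<in> sets N" "U i \<in> sets N" for i
        using op[OF FU(2)] cl[OF FU(1)] by auto
      have geo: "(\<lambda>i. e / 2 * (1/2) ^ Suc i) sums (e / 2 * 1)"
        by (intro sums_mult power_half_series)
      have summ: "summable (\<lambda>i. measure N (U i - F i))"
        by (rule summable_comparison_test'[OF sums_summable[OF geo], of 0]) (use FU(5) in \<open>auto intro: less_imp_le\<close>)
      have "measure N ((\<Union>i. U i) - (\<Union>i. F i)) \<le> measure N (\<Union>i. U i - F i)"
        using m by (intro finite_measure_mono) auto
      also have "\<dots> \<le> (\<Sum>i. measure N (U i - F i))"
        using m summ by (intro finite_measure_subadditive_countably) auto
      also have "\<dots> \<le> (\<Sum>i. e / 2 * (1/2) ^ Suc i)"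
        by (intro suminf_le summ sums_summable[OF geo] less_imp_le FU(5))
      also have "\<dots> = e / 2" using sums_unique[OF geo] by simp
      finally have 1: "measure N ((\<Union>i. U i) - (\<Union>i. F i)) \<le> e / 2" .
      have "(\<lambda>n. measure N ((\<Union>i. F i) - (\<Union>i<n. F i))) \<longlonglongrightarrow> measure N (\<Inter>n. (\<Union>i. F i) - (\<Union>i<n. F i))"
      proof (rule finite_Lim_measure_decseq)
        show "range (\<lambda>n. (\<Union>i. F i) - (\<Union>i<n. F i)) \<subseteq> sets N" using m by auto
        show "decseq (\<lambda>n. (\<Union>i. F i) - (\<Union>i<n. F i))" by (fastforce simp: decseq_def)
      qed
      also have "(\<Inter>n. (\<Union>i. F i) - (\<Union>i<n. F i)) = {}" by auto
      finally have "eventually (\<lambda>n. measure N ((\<Union>i. F i) - (\<Union>i<n. F i)) < e / 2) sequentially"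
        using \<open>0 < e\<close> by (intro order_tendstoD) auto
      then obtain n where 2: "measure N ((\<Union>i. F i) - (\<Union>i<n. F i)) < e / 2"
        by (auto simp: eventually_sequentially)
      have "measure N ((\<Union>i. U i) - (\<Union>i<n. F i)) \<le>
          measure N (((\<Union>i. U i) - (\<Union>i. F i)) \<union> ((\<Union>i. F i) - (\<Union>i<n. F i)))"
        using m by (intro finite_measure_mono) auto
      also have "\<dots> \<le> measure N ((\<Union>i. U i) - (\<Union>i. F i)) + measure N ((\<Union>i. F i) - (\<Union>i<n. F i))"
        using m by (intro measure_Un_le) auto
      also have "\<dots> < e" using 1 2 by simp
      finally have "measure N ((\<Union>i. U i) - (\<Union>i<n. F i)) < e" .
      moreover have "closed (\<Union>i<n. F i)" using FU(1) by auto
      moreover have "open (\<Union>i. U i)" using FU(2) by auto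
      moreover have "(\<Union>i<n. F i) \<subseteq> (\<Union>i. A i)" "(\<Union>i. A i) \<subseteq> (\<Union>i. U i)" using FU(3,4) by blast+
      ultimately show "\<exists>F U. closed F \<and> open U \<and> F \<subseteq> (\<Union>i. A i) \<and> (\<Union>i. A i) \<subseteq> U \<and> measure N (U - F) < e"
        by blast
    qed
  qed
  then show thesis using that \<open>0 < e\<close> by blast
qed

text \<open>Counting the multiples of \<open>\<eta>\<close> below \<open>x\<close> recovers \<open>x\<close> up to one step, also for \<open>x = \<infinity>\<close>.\<close>
lemma staircase_approximation:
  fixes x :: ennreal
  assumes \<eta>: "0 < \<eta>"
  defines "f \<equiv> \<lambda>n. if ennreal (real (Suc n) * \<eta>) < x then ennreal \<eta> else 0"
  shows "(\<Sum>n. f n) \<le> x" and "x \<le> ennreal \<eta> + (\<Sum>n. f n)"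
proof -
  have step: "ennreal (real N * \<eta>) + ennreal \<eta> = ennreal (real (Suc N) * \<eta>)" for N
    using \<eta> by (simp add: ennreal_plus[symmetric] algebra_simps del: ennreal_plus)
  have "(\<Sum>n<N. f n) \<le> x \<and> (\<Sum>n<N. f n) \<le> ennreal (real N * \<eta>)" for N
  proof (induction N)
    case (Suc N)
    show ?case
    proof (cases "ennreal (real (Suc N) * \<eta>) < x")
      case True
      have "(\<Sum>n<Suc N. f n) \<le> ennreal (real N * \<eta>) + ennreal \<eta>"
        using Suc True by (simp add: f_def add_right_mono)
      then show ?thesis using True unfolding step by (auto intro: order_trans less_imp_le)
    next
      case False
      then have eq: "(\<Sum>n<Suc N. f n) = (\<Sum>n<N. f n)" by (simp add: f_def)
      have "ennreal (real N * \<eta>) \<le> ennreal (real (Suc N) * \<eta>)"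
        using \<eta> by (intro ennreal_leI mult_right_mono) auto
      then show ?thesis unfolding eq using Suc order_trans by blast
    qed
  qed simp
  then show "(\<Sum>n. f n) \<le> x" by (intro suminf_le_const) auto
  show "x \<le> ennreal \<eta> + (\<Sum>n. f n)"
  proof (rule ccontr)
    assume "\<not> x \<le> ennreal \<eta> + (\<Sum>n. f n)"
    then have lt: "ennreal \<eta> + (\<Sum>n. f n) < x" by simp
    have ge: "ennreal (real N * \<eta>) \<le> (\<Sum>n<N. f n)" for N
    proof (induction N)
      case (Suc N)
      have "ennreal (real (Suc N) * \<eta>) \<le> ennreal \<eta> + (\<Sum>n<N. f n)"
        using Suc unfolding step[symmetric] by (simp add: add.commute add_left_mono)
      also have "\<dots> \<le> ennreal \<eta> + (\<Sum>n. f n)" by (intro add_left_mono sum_le_suminf) auto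
      also note lt
      finally have "f N = ennreal \<eta>" by (simp add: f_def)
      moreover have "ennreal (real N * \<eta>) + ennreal \<eta> \<le> (\<Sum>n<N. f n) + ennreal \<eta>"
        using Suc by (rule add_right_mono)
      ultimately show ?case unfolding step by simp
    qed simp
    have "(\<Sum>n. f n) = top"
    proof (rule ccontr)
      assume "(\<Sum>n. f n) \<noteq> top"
      then obtain s where s: "(\<Sum>n. f n) = ennreal s" "0 \<le> s" by (cases "\<Sum>n. f n") auto
      obtain N :: nat where "s < real N * \<eta>" using reals_Archimedean3[OF \<eta>] by blast
      then have "ennreal s < ennreal (real N * \<eta>)" using s by (intro ennreal_lessI) auto
      also have "\<dots> \<le> (\<Sum>n<N. f n)" by (rule ge)
      also have "\<dots> \<le> (\<Sum>n. f n)" by (intro sum_le_suminf) auto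
      finally show False using s by simp
    qed
    then show False using lt by (simp add: top_unique)
  qed
qed

text \<open>Write \<open>g\<close> as a sum of indicators of its superlevel sets at the multiples of \<open>\<eta>\<close>, and enlarge
each of these sets to an open one.  The additional constant \<open>\<eta>\<close> makes up for the rounding and
also keeps the majorant away from zero.\<close>
lemma lsc_majorant:
  fixes N :: "'a::metric_space measure" and g :: "'a \<Rightarrow> ennreal"
  assumes fin: "finite_measure N" and borel: "sets borel \<subseteq> sets N" and sp: "space N = UNIV"
    and g: "g \<in> borel_measurable borel" and lt: "(\<integral>\<^sup>+ y. g y \<partial>N) < K"
  obtains g' c where "\<And>t. open {y. t < g' y}" "\<And>y. g y \<le> g' y" "0 < c" "\<And>y. ennreal c \<le> g' y"
    "(\<integral>\<^sup>+ y. g' y \<partial>N) < K"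
proof -
  interpret finite_measure N by fact
  define I where "I = enn2real (\<integral>\<^sup>+ y. g y \<partial>N)"
  have I: "(\<integral>\<^sup>+ y. g y \<partial>N) = ennreal I" "0 \<le> I"
    using less_le_trans[OF lt top_greatest] by (auto simp: I_def)
  obtain z where z: "ennreal I < z" "z < K" using dense lt I by metis
  then obtain z' where z': "z = ennreal z'" "0 \<le> z'" by (cases z) auto
  define V where "V = measure N UNIV"
  have V: "emeasure N UNIV = ennreal V" "0 \<le> V" using emeasure_eq_measure by (auto simp: V_def)
  \<comment> \<open>The step is chosen so that the constant, the rounding and the enlarged sets cost \<open>z' - I\<close> together.\<close>
  define \<eta> where "\<eta> = (z' - I) / (V + 1)"
  have "I < z'" using z z' I by (simp add: ennreal_less_iff)
  then have \<eta>: "0 < \<eta>" using V by (simp add: \<eta>_def)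
  have \<eta>z: "\<eta> * V + I + \<eta> = z'"
  proof -
    have "\<eta> * (V + 1) = z' - I" using V by (simp add: \<eta>_def)
    then show ?thesis by (simp add: algebra_simps)
  qed
  define A where "A n = {y. ennreal (real (Suc n) * \<eta>) < g y}" for n
  have A: "A n \<in> sets borel" for n
  proof -
    have "{y \<in> space borel. ennreal (real (Suc n) * \<eta>) < g y} \<in> sets borel" using g by measurable
    then show ?thesis by (simp add: A_def)
  qed
  have "\<exists>U. open U \<and> A n \<subseteq> U \<and> measure N (U - A n) \<le> (1/2) ^ Suc n" for n
  proof -
    obtain F U where FU: "closed F" "open U" "F \<subseteq> A n" "A n \<subseteq> U" "measure N (U - F) < (1/2) ^ Suc n"
      using finite_borel_measure_regular[OF fin borel A, of "(1/2) ^ Suc n"] by auto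
    have "U \<in> sets N" "F \<in> sets N" using FU(1,2) borel by auto
    then have "measure N (U - A n) \<le> measure N (U - F)"
      using FU A[of n] borel by (intro finite_measure_mono) auto
    then show ?thesis using FU by (intro exI[of _ U]) auto
  qed
  then obtain U where U: "\<And>n. open (U n)" "\<And>n. A n \<subseteq> U n" "\<And>n. measure N (U n - A n) \<le> (1/2) ^ Suc n"
    by metis
  have UN: "U n \<in> sets N" "A n \<in> sets N" for n using U(1)[of n] A[of n] borel by auto
  define g' where "g' y = ennreal \<eta> + (\<Sum>n. ennreal \<eta> * indicator (U n) y)" for y
  have fA: "(\<lambda>n. if ennreal (real (Suc n) * \<eta>) < g y then ennreal \<eta> else 0) = (\<lambda>n. ennreal \<eta> * indicator (A n) y)" for y
    by (auto simp: A_def fun_eq_iff)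
  note stair = staircase_approximation[OF \<eta>, of "g y" for y, unfolded fA]
  show thesis
  proof (rule that[of g' \<eta>])
    show "0 < \<eta>" by fact
    show "ennreal \<eta> \<le> g' y" for y by (simp add: g'_def)
    show "g y \<le> g' y" for y
    proof -
      have "(\<Sum>n. ennreal \<eta> * indicator (A n) y) \<le> (\<Sum>n. ennreal \<eta> * indicator (U n) y)"
        using U(2) by (intro suminf_le mult_left_mono) (auto simp: indicator_def)
      then show ?thesis using stair(2)[of y] unfolding g'_def by (meson add_left_mono order_trans)
    qed
    show "open {y. t < g' y}" for t
    proof (subst open_subopen, intro ballI)
      fix y assume "y \<in> {y. t < g' y}"
      then have "t < ennreal \<eta> + (SUP N. \<Sum>n<N. ennreal \<eta> * indicator (U n) y)"
        unfolding mem_Collect_eq g'_def suminf_eq_SUP .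
      also have "\<dots> = (SUP N. ennreal \<eta> + (\<Sum>n<N. ennreal \<eta> * indicator (U n) y))"
        by (rule ennreal_SUP_add_right) auto
      finally obtain N where N: "t < ennreal \<eta> + (\<Sum>n<N. ennreal \<eta> * indicator (U n) y)"
        unfolding less_SUP_iff by blast
      define W where "W = (\<Inter>n\<in>{n. n < N \<and> y \<in> U n}. U n)"
      have "open W" unfolding W_def using U(1) by (intro open_INT) auto
      moreover have "y \<in> W" by (auto simp: W_def)
      moreover have "W \<subseteq> {y. t < g' y}"
      proof
        fix w assume w: "w \<in> W"
        have "(\<Sum>n<N. ennreal \<eta> * indicator (U n) y) \<le> (\<Sum>n<N. ennreal \<eta> * indicator (U n) w)"
          using w by (intro sum_mono mult_left_mono) (auto simp: W_def indicator_def)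
        also have "\<dots> \<le> (\<Sum>n. ennreal \<eta> * indicator (U n) w)" by (intro sum_le_suminf) auto
        finally show "w \<in> {y. t < g' y}" using N unfolding g'_def
          by (metis (no_types, lifting) add_left_mono less_le_trans mem_Collect_eq)
      qed
      ultimately show "\<exists>T. open T \<and> y \<in> T \<and> T \<subseteq> {y. t < g' y}" by blast
    qed
    have "(\<integral>\<^sup>+ y. g' y \<partial>N) = (\<integral>\<^sup>+ y. ennreal \<eta> \<partial>N) + (\<integral>\<^sup>+ y. (\<Sum>n. ennreal \<eta> * indicator (U n) y) \<partial>N)"
      unfolding g'_def using UN by (intro nn_integral_add) auto
    also have "(\<integral>\<^sup>+ y. ennreal \<eta> \<partial>N) = ennreal (\<eta> * V)"
      using V sp \<eta> by (simp add: ennreal_mult)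
    also have "(\<integral>\<^sup>+ y. (\<Sum>n. ennreal \<eta> * indicator (U n) y) \<partial>N) = (\<Sum>n. ennreal \<eta> * emeasure N (U n))"
      using UN by (subst nn_integral_suminf) (auto simp: nn_integral_cmult_indicator)
    also have "\<dots> \<le> (\<Sum>n. ennreal \<eta> * emeasure N (A n) + ennreal (\<eta> * (1/2) ^ Suc n))"
    proof (intro suminf_le)
      fix n
      have "emeasure N (U n) = emeasure N (A n) + emeasure N (U n - A n)"
        using UN U(2)[of n] by (subst plus_emeasure) (auto intro!: arg_cong[of _ _ "emeasure N"])
      also have "emeasure N (U n - A n) \<le> ennreal ((1/2) ^ Suc n)"
        using U(3)[of n] by (simp add: emeasure_eq_measure)
      finally have "ennreal \<eta> * emeasure N (U n) \<le> ennreal \<eta> * (emeasure N (A n) + ennreal ((1/2) ^ Suc n))"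
        by (intro mult_left_mono) auto
      then show "ennreal \<eta> * emeasure N (U n) \<le> ennreal \<eta> * emeasure N (A n) + ennreal (\<eta> * (1/2) ^ Suc n)"
        using \<eta> ennreal_mult[of \<eta> "(1/2) ^ Suc n"] by (simp only: distrib_left) simp
    qed auto
    also have "\<dots> = (\<Sum>n. ennreal \<eta> * emeasure N (A n)) + (\<Sum>n. ennreal (\<eta> * (1/2) ^ Suc n))"
      by (rule suminf_add[symmetric]) auto
    also have "(\<Sum>n. ennreal (\<eta> * (1/2) ^ Suc n)) = ennreal (\<eta> * 1)"
      by (rule suminf_ennreal_eq[OF _ sums_mult[OF power_half_series, of \<eta>]]) (use \<eta> in simp)
    also have "(\<Sum>n. ennreal \<eta> * emeasure N (A n)) = (\<integral>\<^sup>+ y. (\<Sum>n. ennreal \<eta> * indicator (A n) y) \<partial>N)"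
      using UN by (subst nn_integral_suminf) (auto simp: nn_integral_cmult_indicator)
    also have "\<dots> \<le> ennreal I" unfolding I(1)[symmetric] by (intro nn_integral_mono stair)
    finally have "(\<integral>\<^sup>+ y. g' y \<partial>N) \<le> ennreal (\<eta> * V) + (ennreal I + ennreal \<eta>)"
      by (simp add: add_left_mono add_right_mono)
    also have "\<dots> = ennreal z'"
      using V I \<eta> \<eta>z by (simp add: ennreal_plus[symmetric] add.assoc del: ennreal_plus)
    also have "\<dots> < K" using z z' by simp
    finally show "(\<integral>\<^sup>+ y. g' y \<partial>N) < K" .
  qed
qed

section \<open>Potentials that separate two sets\<close>

lemma lsc_borel_measurable:
  fixes g :: "'a::topological_space \<Rightarrow> 'b::{linorder_topology, second_countable_topology}"
  assumes "\<And>t. open {y. t < g y}"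
  shows "g \<in> borel_measurable borel"
  using assms by (intro borel_measurableI_greater) auto

text \<open>\<open>g\<close> is admissible for the family of paths that lead from \<open>E\<close> out of \<open>U\<close>.\<close>
definition separates :: "('a::metric_space \<Rightarrow> ennreal) \<Rightarrow> 'a set \<Rightarrow> 'a set \<Rightarrow> bool" where
  "separates g E U \<longleftrightarrow> (\<forall>\<sigma> len. 0 \<le> len \<and> 1-lipschitz_on {0..len} \<sigma> \<and> \<sigma> 0 \<in> E \<and> \<sigma> len \<notin> U \<longrightarrow>
     1 \<le> path_int g \<sigma> 0 len)"

context doubling_measure
begin

text \<open>The truncated weighted distance to the complement of \<open>U\<close>.  In contrast to an arbitrary function with
upper gradient \<open>g\<close>, its superlevel sets are open, so they have full density near every point of \<open>E\<close>.\<close>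
lemma potential_function:
  assumes g: "g \<in> borel_measurable borel" and U: "open U"
    and lt: "(\<integral>\<^sup>+ y \<in> ball x \<rho>. g y \<partial>M) < K"
    and sep: "separates g E U"
  obtains v g' c where "path_upper_gradient v g'" "\<And>y. 0 \<le> v y" "\<And>y. v y \<le> 1"
    "\<And>y. y \<in> E \<Longrightarrow> v y = 1" "\<And>y. y \<notin> U \<Longrightarrow> v y = 0" "\<And>t. open {y. t < v y}"
    "(\<integral>\<^sup>+ y \<in> ball x \<rho>. g' y \<partial>M) < K" "0 < c" "\<And>y. ennreal c \<le> g' y"
proof -
  define N where "N = density M (indicator (ball x \<rho>) :: 'a \<Rightarrow> ennreal)"
  have N_int: "(\<integral>\<^sup>+ y. f y \<partial>N) = (\<integral>\<^sup>+ y \<in> ball x \<rho>. f y \<partial>M)" if "f \<in> borel_measurable borel" for f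
    unfolding N_def using borel_measurable_M[OF that] open_M[OF open_ball[of x \<rho>]]
    by (subst nn_integral_density) (auto simp: mult.commute intro!: borel_measurable_indicator)
  have fin: "finite_measure N"
  proof
    have "emeasure N (space N) = emeasure M (ball x \<rho>)"
      unfolding N_def by (subst emeasure_density) (auto intro!: borel_measurable_indicator)
    then show "emeasure N (space N) \<noteq> \<infinity>" using emeasure_ball_finite[of x \<rho>] by simp
  qed
  have bN: "sets borel \<subseteq> sets N" "space N = UNIV" using sets_M by (auto simp: N_def)
  have ltN: "(\<integral>\<^sup>+ y. g y \<partial>N) < K" using lt by (simp add: N_int[OF g])
  obtain g' c where g': "\<And>t. open {y. t < g' y}" "\<And>y. g y \<le> g' y" "0 < c" "\<And>y. ennreal c \<le> g' y"
    "(\<integral>\<^sup>+ y. g' y \<partial>N) < K"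
    using lsc_majorant[OF fin bN g ltN] by blast
  have g'm: "g' \<in> borel_measurable borel" using g'(1) by (rule lsc_borel_measurable)
  define pot where "pot = path_potential g' (- U)"
  define v where "v y = enn2real (min 1 (pot y))" for y
  have v_enn: "ennreal (v y) = min 1 (pot y)" for y
  proof -
    have "min 1 (pot y) \<le> 1" by simp
    then have "min 1 (pot y) < top" by (rule le_less_trans) simp
    then show ?thesis by (simp add: v_def)
  qed
  have v0: "0 \<le> v y" for y by (simp add: v_def)
  show thesis
  proof (rule that[of v g' c])
    show "path_upper_gradient v g'"
    proof (rule path_upper_gradientI[OF g'm])
      fix \<sigma> :: "real \<Rightarrow> 'a" and len :: real assume s: "0 \<le> len" "1-lipschitz_on {0..len} \<sigma>"
      let ?P = "path_int g' \<sigma> 0 len"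
      have "ennreal (v (\<sigma> 0)) \<le> min 1 (?P + pot (\<sigma> len))"
        using path_potential_path[OF g'm s, of "- U"] by (simp add: v_enn pot_def min.coboundedI2)
      also have "\<dots> \<le> ?P + ennreal (v (\<sigma> len))"
        unfolding v_enn by (cases "pot (\<sigma> len) \<le> 1")
          (auto simp: min_def add_increasing intro: order_trans)
      finally show "ennreal (v (\<sigma> 0) - v (\<sigma> len)) \<le> ?P"
        using v0 by (simp add: ennreal_minus[symmetric] ennreal_minus_le_iff add.commute)
    qed
    show "0 \<le> v y" for y by (rule v0)
    show "v y \<le> 1" for y
    proof -
      have "ennreal (v y) \<le> ennreal 1" by (simp add: v_enn)
      then show ?thesis by (subst (asm) ennreal_le_iff) auto
    qed
    show "v y = 1" if "y \<in> E" for y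
    proof -
      have "1 \<le> pot y"
        unfolding pot_def
      proof (rule path_potential_geI)
        fix \<sigma> :: "real \<Rightarrow> 'a" and len :: real assume s: "0 \<le> len" "1-lipschitz_on {0..len} \<sigma>" "\<sigma> 0 = y" "\<sigma> len \<in> - U"
        have "1 \<le> path_int g \<sigma> 0 len" using sep s that unfolding separates_def by auto
        also have "\<dots> \<le> path_int g' \<sigma> 0 len"
          unfolding path_int_def by (intro nn_integral_mono mult_right_mono g') auto
        finally show "1 \<le> path_int g' \<sigma> 0 len" .
      qed
      then show ?thesis by (simp add: v_def min_absorb1)
    qed
    show "v y = 0" if "y \<notin> U" for y
      using path_potential_on[of y "- U" g'] that by (simp add: v_def pot_def)
    show "open {y. t < v y}" for t
    proof (cases "t < 0")
      case True
      then have "{y. t < v y} = UNIV" using v0 by (auto intro: less_le_trans)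
      then show ?thesis by simp
    next
      case False
      have "{y. t < v y} = {y. ennreal t < 1} \<inter> {y. ennreal t < pot y}"
      proof -
        have "t < v y \<longleftrightarrow> ennreal t < ennreal (v y)" for y using False by (simp add: ennreal_less_iff)
        then show ?thesis by (auto simp: v_enn)
      qed
      moreover have "open {y. ennreal t < pot y}"
        unfolding pot_def using U g'
        by (intro path_potential_lsc[OF compact_cball_M g'm g'(1) g'(3,4)]) auto
      ultimately show ?thesis by auto
    qed
    show "(\<integral>\<^sup>+ y \<in> ball x \<rho>. g' y \<partial>M) < K" using g'(5) by (simp add: N_int[OF g'm])
  qed fact+
qed

end

section \<open>Upper gradients supported in a strip\<close>

text \<open>The increments of \<open>v\<close> along the path are bounded by integrals of an integrable function over
shrinking intervals.\<close>
lemma path_upper_gradient_continuous: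
  fixes v :: "'a::metric_space \<Rightarrow> real"
  assumes v: "path_upper_gradient v g" and s: "1-lipschitz_on {0..len} \<sigma>"
    and fin: "path_int g \<sigma> 0 len < \<infinity>"
  shows "continuous_on {0..len} (\<lambda>l. v (\<sigma> l))"
  unfolding continuous_on_sequentially
proof (intro allI ballI impI, elim conjE)
  fix x :: "nat \<Rightarrow> real" and a assume a: "a \<in> {0..len}" and x: "\<forall>n. x n \<in> {0..len}" "x \<longlonglongrightarrow> a"
  have g: "g \<in> borel_measurable borel" using v by (simp add: path_upper_gradient_def)
  define F where "F n l = (g (\<sigma> l) * indicator {0..len} l) * indicator {min a (x n)..max a (x n)} l" for n l
  have cont: "continuous_on {0..len} \<sigma>" using s by (rule lipschitz_on_continuous_on)
  have m[measurable]: "(\<lambda>l. g (\<sigma> l) * indicator {0..len} l) \<in> borel_measurable borel"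
    by (rule path_int_measurable[OF cont g])
  have "(\<lambda>n. \<integral>\<^sup>+ l. F n l \<partial>lborel) \<longlonglongrightarrow> (\<integral>\<^sup>+ (l::real). 0 \<partial>lborel)"
  proof (rule nn_integral_dominated_convergence[where u = F and u' = "\<lambda>_. 0" and w = "\<lambda>l. g (\<sigma> l) * indicator {0..len} l"])
    show "F n \<in> borel_measurable lborel" for n unfolding F_def[abs_def] by measurable
    show "AE l in lborel. F n l \<le> g (\<sigma> l) * indicator {0..len} l" for n
      by (auto simp: F_def indicator_def)
    show "(\<integral>\<^sup>+ l. g (\<sigma> l) * indicator {0..len} l \<partial>lborel) < \<infinity>" using fin by (simp add: path_int_def)
    show "AE l in lborel. (\<lambda>n. F n l) \<longlonglongrightarrow> 0"
      using AE_lborel_singleton[of a]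
    proof eventually_elim
      case (elim l)
      have "eventually (\<lambda>n. dist (x n) a < dist l a) sequentially"
        using tendstoD[OF x(2)] elim by simp
      then have "eventually (\<lambda>n. F n l = 0) sequentially"
        by eventually_elim (auto simp: F_def indicator_def dist_real_def min_def max_def split: if_splits)
      then show ?case by (rule tendsto_eventually)
    qed
  qed auto
  then have lim: "(\<lambda>n. \<integral>\<^sup>+ l. F n l \<partial>lborel) \<longlonglongrightarrow> 0" by simp
  have le: "ennreal \<bar>v (\<sigma> (x n)) - v (\<sigma> a)\<bar> \<le> (\<integral>\<^sup>+ l. F n l \<partial>lborel)" for n
  proof -
    have "ennreal \<bar>v (\<sigma> (min a (x n))) - v (\<sigma> (max a (x n)))\<bar> \<le> path_int g \<sigma> (min a (x n)) (max a (x n))"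
      using a x by (intro path_upper_gradientD[OF v] lipschitz_on_subset[OF s]) auto
    moreover have "\<bar>v (\<sigma> (min a (x n))) - v (\<sigma> (max a (x n)))\<bar> = \<bar>v (\<sigma> (x n)) - v (\<sigma> a)\<bar>"
      by (auto simp: min_def max_def)
    moreover have "path_int g \<sigma> (min a (x n)) (max a (x n)) \<le> (\<integral>\<^sup>+ l. F n l \<partial>lborel)"
      unfolding path_int_def using a x(1)[rule_format, of n]
      by (intro nn_integral_mono) (auto simp: F_def indicator_def min_def max_def split: if_splits)
    ultimately show ?thesis by simp
  qed
  have "(\<lambda>n. ennreal \<bar>v (\<sigma> (x n)) - v (\<sigma> a)\<bar>) \<longlonglongrightarrow> 0"
    by (rule tendsto_sandwich[OF _ _ tendsto_const lim]) (use le in auto)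
  then have "(\<lambda>n. ennreal \<bar>v (\<sigma> (x n)) - v (\<sigma> a)\<bar>) \<longlonglongrightarrow> ennreal 0" by simp
  then have "(\<lambda>n. \<bar>v (\<sigma> (x n)) - v (\<sigma> a)\<bar>) \<longlonglongrightarrow> 0"
    by (rule tendsto_ennrealD) auto
  then have "(\<lambda>n. v (\<sigma> (x n)) - v (\<sigma> a)) \<longlonglongrightarrow> 0" by (rule tendsto_rabs_zero_cancel)
  then have "(\<lambda>n. v (\<sigma> (x n))) \<longlonglongrightarrow> v (\<sigma> a)" by (rule LIM_zero_cancel)
  then show "((\<lambda>l. v (\<sigma> l)) \<circ> x) \<longlonglongrightarrow> v (\<sigma> a)" by (simp add: o_def)
qed

text \<open>If \<open>g\<close> has finite integral along the path, then \<open>v\<close> is continuous along it, and the whole change of the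
cut-off function happens on an interval of parameters on which \<open>v\<close> lies in the strip.  On the other paths
the second summand \<open>g\<close> makes the bound trivial.\<close>
lemma strip_upper_gradient:
  fixes v :: "'a::metric_space \<Rightarrow> real"
  assumes v: "path_upper_gradient v g" and vm: "v \<in> borel_measurable borel" and h: "0 < h"
  shows "path_upper_gradient (\<lambda>y. max 0 (min 1 ((v y - t) / h)))
    (\<lambda>y. ennreal (1 / h) * (g y * indicator {y. t < v y \<and> v y \<le> t + h} y) + g y)"
    (is "path_upper_gradient ?w ?G")
proof (rule path_upper_gradientI)
  let ?S = "{y. t < v y \<and> v y \<le> t + h}"
  have g[measurable]: "g \<in> borel_measurable borel" using v by (simp add: path_upper_gradient_def)
  have S[measurable]: "?S \<in> sets borel"
  proof -
    have "{y \<in> space borel. t < v y \<and> v y \<le> t + h} \<in> sets borel" using vm by measurable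
    then show ?thesis by simp
  qed
  show G: "?G \<in> borel_measurable borel" by measurable
  fix \<sigma> :: "real \<Rightarrow> 'a" and len :: real
  assume s: "0 \<le> len" "1-lipschitz_on {0..len} \<sigma>" and lt: "?w (\<sigma> len) < ?w (\<sigma> 0)"
  have cont: "continuous_on {0..len} \<sigma>" using s(2) by (rule lipschitz_on_continuous_on)
  show "ennreal (?w (\<sigma> 0) - ?w (\<sigma> len)) \<le> path_int ?G \<sigma> 0 len"
  proof (cases "path_int g \<sigma> 0 len < \<infinity>")
    case False
    have "path_int g \<sigma> 0 len \<le> path_int ?G \<sigma> 0 len"
      unfolding path_int_def by (intro nn_integral_mono mult_right_mono) auto
    then show ?thesis using False by (auto simp: top_unique not_less)
  next
    case True
    let ?f = "\<lambda>l. v (\<sigma> l)"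
    have fc: "continuous_on {0..len} ?f" by (rule path_upper_gradient_continuous[OF v s(2) True])
    define \<alpha> where "\<alpha> = max (?f len) t"
    define \<beta> where "\<beta> = min (?f 0) (t + h)"
    have f0: "t < ?f 0"
    proof (rule ccontr)
      assume "\<not> t < ?f 0"
      then have "(?f 0 - t) / h \<le> 0" using h by (simp add: divide_le_0_iff)
      then have "?w (\<sigma> 0) = 0" by simp
      then show False using lt by simp
    qed
    have fl: "?f len < t + h"
    proof (rule ccontr)
      assume "\<not> ?f len < t + h"
      then have "1 \<le> (?f len - t) / h" using h by simp
      then have "?w (\<sigma> len) = 1" by simp
      then show False using lt by simp
    qed
    have w0: "?w (\<sigma> 0) = (\<beta> - t) / h"
    proof (cases "?f 0 \<le> t + h")
      case True
      then have "(?f 0 - t) / h \<le> 1" "0 \<le> (?f 0 - t) / h" using f0 h by simp_all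
      then show ?thesis using True by (simp add: \<beta>_def)
    next
      case False
      then have "1 \<le> (?f 0 - t) / h" using h by simp
      then show ?thesis using False h by (simp add: \<beta>_def)
    qed
    have wl: "?w (\<sigma> len) = (\<alpha> - t) / h"
    proof (cases "t \<le> ?f len")
      case True
      then have "(?f len - t) / h \<le> 1" "0 \<le> (?f len - t) / h" using fl h by simp_all
      then show ?thesis using True by (simp add: \<alpha>_def)
    next
      case False
      then have "(?f len - t) / h \<le> 0" using h by (simp add: divide_le_0_iff)
      then show ?thesis using False by (simp add: \<alpha>_def)
    qed
    have ab: "\<alpha> < \<beta>" using lt h unfolding w0 wl by (simp add: divide_less_cancel)
    define A where "A = {l \<in> {0..len}. \<beta> \<le> ?f l}"
    have A: "A = {0..len} \<inter> ({0..len} \<inter> ?f -` {\<beta>..})" by (auto simp: A_def)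
    have "compact A"
      unfolding A by (intro compact_Int_closed compact_Icc continuous_closed_preimage[OF fc]) auto
    moreover have "0 \<in> A" using s by (auto simp: A_def \<beta>_def)
    ultimately obtain l1 where l1: "l1 \<in> A" "\<And>l. l \<in> A \<Longrightarrow> l \<le> l1"
      using compact_attains_sup[of A] by blast
    define B where "B = {l \<in> {l1..len}. ?f l \<le> \<alpha>}"
    have l1': "0 \<le> l1" "l1 \<le> len" "\<beta> \<le> ?f l1" using l1 by (auto simp: A_def)
    have fc1: "continuous_on {l1..len} ?f" using fc l1' by (auto intro: continuous_on_subset)
    have B: "B = {l1..len} \<inter> ({l1..len} \<inter> ?f -` {..\<alpha>})" by (auto simp: B_def)
    have "compact B"
      unfolding B by (intro compact_Int_closed compact_Icc continuous_closed_preimage[OF fc1]) auto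
    moreover have "len \<in> B" using l1' by (auto simp: B_def \<alpha>_def)
    ultimately obtain l2 where l2: "l2 \<in> B" "\<And>l. l \<in> B \<Longrightarrow> l2 \<le> l"
      using compact_attains_inf[of B] by blast
    have l2': "l1 \<le> l2" "l2 \<le> len" "?f l2 \<le> \<alpha>" using l2 by (auto simp: B_def)
    have strip: "\<sigma> l \<in> ?S" if "l1 < l" "l < l2" for l
    proof -
      have "?f l < \<beta>" using l1(2)[of l] that l1' l2' by (force simp: A_def)
      moreover have "\<alpha> < ?f l" using l2(2)[of l] that l1' l2' by (force simp: B_def)
      ultimately show ?thesis by (auto simp: \<alpha>_def \<beta>_def)
    qed
    have "ennreal (\<beta> - \<alpha>) \<le> ennreal \<bar>?f l1 - ?f l2\<bar>" using l1' l2' ab by (intro ennreal_leI) auto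
    also have "\<dots> \<le> path_int g \<sigma> l1 l2"
      using l1' l2' by (intro path_upper_gradientD[OF v] lipschitz_on_subset[OF s(2)]) auto
    also have "\<dots> \<le> (\<integral>\<^sup>+ l \<in> {0..len}. g (\<sigma> l) * indicator ?S (\<sigma> l) \<partial>lborel)"
      unfolding path_int_def
    proof (rule nn_integral_mono_AE)
      show "AE l in lborel. g (\<sigma> l) * indicator {l1..l2} l \<le> g (\<sigma> l) * indicator ?S (\<sigma> l) * indicator {0..len} l"
        using AE_lborel_singleton[of l1] AE_lborel_singleton[of l2]
      proof eventually_elim
        case (elim l)
        then show ?case using strip[of l] l1' l2' by (auto simp: indicator_def)
      qed
    qed
    finally have le: "ennreal (\<beta> - \<alpha>) \<le> (\<integral>\<^sup>+ l \<in> {0..len}. g (\<sigma> l) * indicator ?S (\<sigma> l) \<partial>lborel)" .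
    have "?w (\<sigma> 0) - ?w (\<sigma> len) = 1 / h * (\<beta> - \<alpha>)" unfolding w0 wl by (simp add: diff_divide_distrib[symmetric])
    then have "ennreal (?w (\<sigma> 0) - ?w (\<sigma> len)) = ennreal (1 / h) * ennreal (\<beta> - \<alpha>)"
      using h ab by (simp add: ennreal_mult[symmetric])
    also have "\<dots> \<le> ennreal (1 / h) * (\<integral>\<^sup>+ l \<in> {0..len}. g (\<sigma> l) * indicator ?S (\<sigma> l) \<partial>lborel)"
      using le by (rule mult_left_mono) simp
    also have "\<dots> = (\<integral>\<^sup>+ l. ennreal (1 / h) * (g (\<sigma> l) * indicator ?S (\<sigma> l) * indicator {0..len} l) \<partial>lborel)"
      using path_int_measurable[OF cont, of "\<lambda>y. g y * indicator ?S y"]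
      by (intro nn_integral_cmult[symmetric]) auto
    also have "\<dots> \<le> path_int ?G \<sigma> 0 len"
      unfolding path_int_def by (intro nn_integral_mono) (auto simp: indicator_def)
    finally show ?thesis .
  qed
qed

section \<open>Content of codimension one\<close>

context doubling_measure
begin

text \<open>A radius that is not positive contributes an empty ball and the term zero, so finite covers are included.\<close>
definition codim_content :: "real \<Rightarrow> 'a set \<Rightarrow> ennreal" where
  "codim_content R S = (INF (c, \<rho>) \<in> {(c :: nat \<Rightarrow> 'a, \<rho> :: nat \<Rightarrow> real). (\<forall>i. \<rho> i \<le> R) \<and> S \<subseteq> (\<Union>i. ball (c i) (\<rho> i))}.
     \<Sum>i. ennreal (vol (c i) (\<rho> i) / \<rho> i))"

lemma codim_content_le:
  "(\<And>i. \<rho> i \<le> R) \<Longrightarrow> S \<subseteq> (\<Union>i. ball (c i) (\<rho> i)) \<Longrightarrow> codim_content R S \<le> (\<Sum>i. ennreal (vol (c i) (\<rho> i) / \<rho> i))"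
  unfolding codim_content_def by (rule INF_lower2[of "(c, \<rho>)"]) auto

lemma codim_content_lessE:
  assumes "codim_content R S < K"
  obtains c \<rho> where "\<And>i. \<rho> i \<le> R" "S \<subseteq> (\<Union>i. ball (c i) (\<rho> i))"
    "(\<Sum>i. ennreal (vol (c i) (\<rho> i) / \<rho> i)) < K"
  using assms unfolding codim_content_def INF_less_iff by auto

lemma codim_content_mono: "S \<subseteq> T \<Longrightarrow> codim_content R S \<le> codim_content R T"
  unfolding codim_content_def by (rule INF_superset_mono) auto

lemma codim_content_antimono: "R \<le> R' \<Longrightarrow> codim_content R' S \<le> codim_content R S"
  unfolding codim_content_def by (rule INF_superset_mono) (auto intro: order_trans)

lemma vol_div_nonneg: "0 \<le> vol c \<rho> / \<rho>"
  by (cases "\<rho> \<le> 0") (auto simp: ball_empty)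

lemma codim_content_ball:
  assumes "\<rho> \<le> R" "0 < R"
  shows "codim_content R (ball c \<rho>) \<le> ennreal (vol c \<rho> / \<rho>)"
proof -
  have "codim_content R (ball c \<rho>) \<le> (\<Sum>i. ennreal (vol c (if i = (0::nat) then \<rho> else 0) / (if i = 0 then \<rho> else 0)))"
    by (rule codim_content_le) (use assms in \<open>auto split: if_splits\<close>)
  also have "\<dots> = ennreal (vol c \<rho> / \<rho>)"
    using suminf_finite[of "{0::nat}" "\<lambda>i. ennreal (vol c (if i = (0::nat) then \<rho> else 0) / (if i = 0 then \<rho> else 0))"]
    by simp
  finally show ?thesis .
qed

lemma codim_content_empty: "0 < R \<Longrightarrow> codim_content R {} = 0"
  using codim_content_ball[of 0 R] by simp

lemma codim_content_countable_subadditive: "codim_content R (\<Union>n. S n) \<le> (\<Sum>n. codim_content R (S n))"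
proof (cases "(\<Sum>n. codim_content R (S n)) = top")
  case False
  then have fin: "codim_content R (S n) \<noteq> top" for n
    using ennreal_suminf_lessD[of "\<lambda>n. codim_content R (S n)" top n] by (simp add: less_top)
  show ?thesis
  proof (rule ennreal_le_epsilon)
    fix e :: real assume "0 < e"
    define good where "good n c \<rho> \<longleftrightarrow> (\<forall>i. \<rho> i \<le> R) \<and> S n \<subseteq> (\<Union>i. ball (c i) (\<rho> i)) \<and>
       (\<Sum>i. ennreal (vol (c i) (\<rho> i) / \<rho> i)) \<le> codim_content R (S n) + ennreal (e * (1/2) ^ Suc n)"
      for n and c :: "nat \<Rightarrow> 'a" and \<rho> :: "nat \<Rightarrow> real"
    have "\<exists>c \<rho>. good n c \<rho>" for n
    proof -
      have "codim_content R (S n) < codim_content R (S n) + ennreal (e * (1/2) ^ Suc n)"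
        using fin[of n] \<open>0 < e\<close>
        by (cases "codim_content R (S n)") (auto simp: ennreal_plus[symmetric] simp del: ennreal_plus intro!: ennreal_lessI add_nonneg_pos)
      then obtain c \<rho> where "\<And>i. \<rho> i \<le> R" "S n \<subseteq> (\<Union>i. ball (c i) (\<rho> i))"
        "(\<Sum>i. ennreal (vol (c i) (\<rho> i) / \<rho> i)) < codim_content R (S n) + ennreal (e * (1/2) ^ Suc n)"
        by (rule codim_content_lessE) blast
      then have "good n c \<rho>" unfolding good_def by (simp add: less_imp_le)
      then show ?thesis by blast
    qed
    then obtain c \<rho> where good: "\<And>n. good n (c n) (\<rho> n)" by metis
    then have c: "\<And>n i. \<rho> n i \<le> R" "\<And>n. S n \<subseteq> (\<Union>i. ball (c n i) (\<rho> n i))"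
      "\<And>n. (\<Sum>i. ennreal (vol (c n i) (\<rho> n i) / \<rho> n i)) \<le> codim_content R (S n) + ennreal (e * (1/2) ^ Suc n)"
      unfolding good_def by blast+
    define f where "f p = ennreal (vol (c (fst p) (snd p)) (\<rho> (fst p) (snd p)) / \<rho> (fst p) (snd p))" for p
    have "codim_content R (\<Union>n. S n) \<le> (\<Sum>i. f (prod_decode i))"
      unfolding f_def
    proof (rule codim_content_le)
      show "(\<Union>n. S n) \<subseteq> (\<Union>i. ball (c (fst (prod_decode i)) (snd (prod_decode i))) (\<rho> (fst (prod_decode i)) (snd (prod_decode i))))"
      proof
        fix x assume "x \<in> (\<Union>n. S n)"
        then obtain n i where "x \<in> ball (c n i) (\<rho> n i)" using c(2) by blast
        then show "x \<in> (\<Union>i. ball (c (fst (prod_decode i)) (snd (prod_decode i))) (\<rho> (fst (prod_decode i)) (snd (prod_decode i))))"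
          by (intro UN_I[of "prod_encode (n, i)"]) auto
      qed
    qed (use c in auto)
    also have "\<dots> = (\<Sum>n. \<Sum>i. f (n, i))"
      by (rule suminf_ennreal_2dimen) simp
    also have "\<dots> \<le> (\<Sum>n. codim_content R (S n) + ennreal (e * (1/2) ^ Suc n))"
    proof (rule suminf_le)
      show "(\<Sum>i. f (n, i)) \<le> codim_content R (S n) + ennreal (e * (1/2) ^ Suc n)" for n
        unfolding f_def fst_conv snd_conv by (rule c(3))
    qed auto
    also have "\<dots> = (\<Sum>n. codim_content R (S n)) + (\<Sum>n. ennreal (e * (1/2) ^ Suc n))"
      by (rule suminf_add[symmetric]) auto
    also have "(\<Sum>n. ennreal (e * (1/2) ^ Suc n)) = ennreal (e * 1)"
      by (rule suminf_ennreal_eq[OF _ sums_mult[OF power_half_series, of e]]) (use \<open>0 < e\<close> in simp)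
    finally show "codim_content R (\<Union>n. S n) \<le> (\<Sum>n. codim_content R (S n)) + ennreal e" by simp
  qed
qed simp

text \<open>For the families of balls that a Vitali covering produces, it is enough to bound finite partial sums.\<close>
lemma codim_content_le_countable:
  assumes S: "countable S" and \<rho>: "\<And>y. y \<in> S \<Longrightarrow> \<rho> y \<le> R" "0 < R"
    and E: "E \<subseteq> (\<Union>y\<in>S. ball y (\<rho> y))"
    and le: "\<And>F. finite F \<Longrightarrow> F \<subseteq> S \<Longrightarrow> (\<Sum>y\<in>F. vol y (\<rho> y) / \<rho> y) \<le> K"
  shows "codim_content R E \<le> ennreal K"
proof -
  define I where "I = to_nat_on S ` S"
  define c where "c n = from_nat_into S n" for n
  define r where "r n = (if n \<in> I then \<rho> (c n) else 0)" for n
  have c: "c n \<in> S" if "n \<in> I" for n using that S by (auto simp: I_def c_def)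
  have inj: "inj_on c I" using S by (auto simp: inj_on_def I_def c_def)
  have "codim_content R E \<le> (\<Sum>n. ennreal (vol (c n) (r n) / r n))"
  proof (rule codim_content_le)
    show "r i \<le> R" for i using \<rho> c by (auto simp: r_def intro: less_imp_le)
    show "E \<subseteq> (\<Union>i. ball (c i) (r i))"
    proof
      fix x assume "x \<in> E"
      then obtain y where y: "y \<in> S" "x \<in> ball y (\<rho> y)" using E by auto
      then have "c (to_nat_on S y) = y" "to_nat_on S y \<in> I" using S by (auto simp: c_def I_def)
      then show "x \<in> (\<Union>i. ball (c i) (r i))"
        using y by (intro UN_I[of "to_nat_on S y"]) (auto simp: r_def)
    qed
  qed
  also have "\<dots> \<le> ennreal K"
  proof (rule suminf_le_const)
    fix N
    have "(\<Sum>n<N. vol (c n) (r n) / r n) = (\<Sum>n\<in>{..<N} \<inter> I. vol (c n) (\<rho> (c n)) / \<rho> (c n))"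
      by (rule sum.mono_neutral_cong_right) (auto simp: r_def)
    also have "\<dots> = (\<Sum>y\<in>c ` ({..<N} \<inter> I). vol y (\<rho> y) / \<rho> y)"
      using inj by (subst sum.reindex) (auto intro: inj_on_subset)
    also have "\<dots> \<le> K" using c by (intro le) auto
    finally show "(\<Sum>n<N. ennreal (vol (c n) (r n) / r n)) \<le> ennreal K"
      by (simp add: sum_ennreal vol_div_nonneg ennreal_leI)
  qed auto
  finally show ?thesis .
qed

text \<open>Any nearly optimal cover of \<open>A\<close> near \<open>F\<close> can be improved by the factor 1/2 on finitely many balls that
carry almost the whole sum, after shrinking the neighbourhood below the radii of these balls.  So
the infimum of the contents of the neighbourhoods cannot be positive.\<close>
lemma codim_content_neighbourhoods_vanish:
  assumes R: "0 < R" and F: "F \<subseteq> ball q (R / 2)" and \<delta>: "0 \<le> \<delta>" "\<delta> * D ^ 3 \<le> 3 / 2"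
    and thin: "\<And>f r. f \<in> F \<Longrightarrow> 0 < r \<Longrightarrow> r \<le> 3 * R \<Longrightarrow> codim_content (r / 3) (A \<inter> ball f r) \<le> ennreal (\<delta> * vol f r / r)"
    and e: "0 < e"
  shows "\<exists>h>0. codim_content R (A \<inter> (\<Union>f\<in>F. ball f h)) \<le> ennreal e"
proof -
  define N where "N h = A \<inter> (\<Union>f\<in>F. ball f h)" for h
  define c' where "c' = (INF h \<in> {0<..}. codim_content R (N h))"
  have Nmono: "N h \<subseteq> N h'" if "h \<le> h'" for h h'
    unfolding N_def using that by (intro Int_mono UN_mono order_refl subset_ball)
  have c'le: "c' \<le> codim_content R (N h)" if "0 < h" for h
    unfolding c'_def by (rule INF_lower) (use that in auto)
  have "N (R / 2) \<subseteq> ball q R"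
  proof
    fix x assume "x \<in> N (R / 2)"
    then obtain f where "f \<in> F" "dist f x < R / 2" by (auto simp: N_def)
    moreover from this have "dist q f < R / 2" using F by auto
    ultimately show "x \<in> ball q R" using dist_triangle[of q x f] by simp
  qed
  then have "c' \<le> codim_content R (ball q R)"
    using c'le[of "R / 2"] codim_content_mono[of "N (R / 2)" "ball q R" R] R by (auto intro: order_trans)
  also have "\<dots> \<le> ennreal (vol q R / R)" using R by (intro codim_content_ball) auto
  finally obtain c where c: "c' = ennreal c" "0 \<le> c" by (cases c') (auto simp: top_unique)
  have "c = 0"
  proof (rule ccontr)
    assume "c \<noteq> 0"
    then have "0 < c" using c by simp
    \<comment> \<open>An error of \<open>c/8\<close> in both the cover and its finite part still leaves \<open>s - (c - c/8)/2 < c\<close> after halving.\<close>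
    have "c' < ennreal (c + c / 8)" unfolding c using \<open>0 < c\<close> by (intro ennreal_lessI) auto
    then obtain h0 where h0: "0 < h0" "codim_content R (N h0) < ennreal (c + c / 8)"
      unfolding c'_def INF_less_iff by auto
    from h0(2) obtain x \<rho> where x: "\<And>i. \<rho> i \<le> R" "N h0 \<subseteq> (\<Union>i. ball (x i) (\<rho> i))"
      "(\<Sum>i. ennreal (vol (x i) (\<rho> i) / \<rho> i)) < ennreal (c + c / 8)"
      by (rule codim_content_lessE) blast
    define a where "a i = vol (x i) (\<rho> i) / \<rho> i" for i
    have a0: "0 \<le> a i" for i by (simp add: a_def vol_div_nonneg)
    have a_less: "(\<Sum>i. ennreal (a i)) < ennreal (c + c / 8)" using x(3) by (simp only: a_def)
    then have "(\<Sum>i. ennreal (a i)) \<noteq> top" by auto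
    then have "summable a" by (rule summable_suminf_not_top[OF a0])
    define s where "s = suminf a"
    have as: "a sums s" using \<open>summable a\<close> by (simp add: s_def summable_sums)
    have suma: "(\<Sum>i. ennreal (a i)) = ennreal s" using as a0 by (rule suminf_ennreal_eq[rotated])
    have s_less: "s < c + c / 8"
      using a_less c unfolding suma by (subst (asm) ennreal_less_iff) (use suminf_nonneg[OF \<open>summable a\<close> a0] in \<open>auto simp: s_def\<close>)
    have "ennreal c \<le> codim_content R (N h0)" using c'le[OF h0(1)] c by simp
    also have "\<dots> \<le> ennreal s" unfolding suma[symmetric] a_def by (rule codim_content_le[OF x(1,2)])
    finally have s_ge: "c \<le> s"
      using s_less c(2) as a0 suminf_nonneg[OF \<open>summable a\<close> a0] by (subst (asm) ennreal_le_iff) (auto simp: s_def)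
    have "eventually (\<lambda>n. c - c / 8 < (\<Sum>i<n. a i)) sequentially"
      using as s_ge \<open>0 < c\<close> unfolding sums_def by (intro order_tendstoD) auto
    then obtain n where n: "c - c / 8 < (\<Sum>i<n. a i)" by (auto simp: eventually_sequentially)
    \<comment> \<open>Below this value the neighbourhood sees each of the first \<open>n\<close> balls at the scale of its radius.\<close>
    define h where "h = Min (insert h0 (\<rho> ` {i. i < n \<and> 0 < \<rho> i}))"
    have h: "0 < h" "h \<le> h0" "\<And>i. i < n \<Longrightarrow> 0 < \<rho> i \<Longrightarrow> h \<le> \<rho> i"
      unfolding h_def using h0 by (auto intro!: Min_le)
    define b where "b i = a i - (if i \<in> {..<n} then a i / 2 else 0)" for i
    have b0: "0 \<le> b i" for i using a0[of i] by (simp add: b_def)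
    have bs: "b sums (s - (\<Sum>i<n. a i / 2))"
      unfolding b_def by (intro sums_diff as sums_If_finite_set) auto
    \<comment> \<open>Only the first \<open>n\<close> balls are covered again; the others are kept as they are.\<close>
    define S where "S i = (if i < n then N h \<inter> ball (x i) (\<rho> i) else ball (x i) (\<rho> i))" for i
    have S_le: "codim_content R (S i) \<le> ennreal (b i)" for i
    proof (cases "i < n \<and> N h \<inter> ball (x i) (\<rho> i) \<noteq> {}")
      case False
      then show ?thesis
      proof (cases "i < n")
        case True
        with False show ?thesis using R by (simp add: S_def codim_content_empty)
      next
        case False
        then show ?thesis using codim_content_ball[OF x(1)[of i] R, of "x i"] by (simp add: S_def b_def a_def)
      qed
    next
      case True
      then obtain z f where z: "z \<in> A" "f \<in> F" "dist f z < h" "dist (x i) z < \<rho> i" "i < n"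
        by (auto simp: N_def)
      then have \<rho>: "0 < \<rho> i" by (metis le_less_trans zero_le_dist)
      have hr: "h \<le> \<rho> i" using h(3) z \<rho> by auto
      have fx: "dist f (x i) < 2 * \<rho> i"
        using dist_triangle2[of f "x i" z] z hr by simp
      have "S i \<subseteq> A \<inter> ball f (3 * \<rho> i)"
      proof
        fix w assume "w \<in> S i"
        then have "w \<in> A" "dist (x i) w < \<rho> i" using z by (auto simp: S_def N_def)
        then show "w \<in> A \<inter> ball f (3 * \<rho> i)" using dist_triangle[of f w "x i"] fx by simp
      qed
      then have "codim_content R (S i) \<le> codim_content (\<rho> i) (A \<inter> ball f (3 * \<rho> i))"
        using codim_content_mono codim_content_antimono[OF x(1)] order_trans by blast
      also have "\<dots> \<le> ennreal (\<delta> * vol f (3 * \<rho> i) / (3 * \<rho> i))"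
        using thin[OF z(2), of "3 * \<rho> i"] \<rho> x(1)[of i] by simp
      also have "\<dots> \<le> ennreal (b i)"
      proof (rule ennreal_leI)
        have "vol f (3 * \<rho> i) \<le> D ^ 3 * vol (x i) (\<rho> i)"
          using fx \<rho> by (intro vol_compare) auto
        then have "\<delta> * vol f (3 * \<rho> i) \<le> \<delta> * (D ^ 3 * vol (x i) (\<rho> i))"
          using \<delta> by (intro mult_left_mono)
        also have "\<dots> = (\<delta> * D ^ 3) * vol (x i) (\<rho> i)" by simp
        also have "\<dots> \<le> 3 / 2 * vol (x i) (\<rho> i)" using \<delta> by (intro mult_right_mono) auto
        finally have "\<delta> * vol f (3 * \<rho> i) / (3 * \<rho> i) \<le> 3 / 2 * vol (x i) (\<rho> i) / (3 * \<rho> i)"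
          using \<rho> by (intro divide_right_mono) auto
        then show "\<delta> * vol f (3 * \<rho> i) / (3 * \<rho> i) \<le> b i"
          using z(5) by (simp add: b_def a_def)
      qed
      finally show ?thesis .
    qed
    have "N h \<subseteq> (\<Union>i. S i)"
    proof
      fix w assume w: "w \<in> N h"
      then have "w \<in> N h0" using Nmono[OF h(2)] by auto
      then obtain i where "w \<in> ball (x i) (\<rho> i)" using x(2) by auto
      then show "w \<in> (\<Union>i. S i)" using w by (intro UN_I[of i]) (auto simp: S_def)
    qed
    then have "codim_content R (N h) \<le> codim_content R (\<Union>i. S i)" by (rule codim_content_mono)
    also have "\<dots> \<le> (\<Sum>i. codim_content R (S i))" by (rule codim_content_countable_subadditive)
    also have "\<dots> \<le> (\<Sum>i. ennreal (b i))" by (intro suminf_le S_le) auto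
    also have "\<dots> = ennreal (s - (\<Sum>i<n. a i / 2))" using bs b0 by (rule suminf_ennreal_eq[rotated])
    also have "\<dots> < ennreal c"
    proof (rule ennreal_lessI)
      have "(\<Sum>i<n. a i / 2) = (\<Sum>i<n. a i) / 2" by (simp add: sum_divide_distrib)
      then show "s - (\<Sum>i<n. a i / 2) < c" using n s_less \<open>0 < c\<close> by simp
    qed (use \<open>0 < c\<close> in auto)
    finally show False using c'le[OF h(1)] c by simp
  qed
  then have "c' < ennreal e" using c e by (simp add: ennreal_less_iff)
  then obtain h where "0 < h" "codim_content R (N h) < ennreal e"
    unfolding c'_def INF_less_iff by auto
  then show ?thesis by (intro exI[of _ h]) (auto simp: N_def)
qed

text \<open>The points of \<open>T\<close> are sorted according to the range of radii in which the bound holds, and each class is cut into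
countably many pieces small enough for the preceding lemma.\<close>
lemma codim_content_choquet:
  assumes \<delta>: "0 \<le> \<delta>" "\<delta> * D ^ 3 \<le> 3 / 2" and e: "0 < e"
    and thin: "\<And>x. x \<in> T \<Longrightarrow> \<exists>r0>0. \<forall>r. 0 < r \<longrightarrow> r < r0 \<longrightarrow> codim_content (r / 3) (A \<inter> ball x r) \<le> ennreal (\<delta> * vol x r / r)"
  shows "\<exists>W. open W \<and> T \<subseteq> W \<and> codim_content 1 (W \<inter> A) \<le> ennreal e"
proof -
  define T' where "T' k = {x. \<forall>r. 0 < r \<longrightarrow> r < 1 / real (Suc k) \<longrightarrow>
      codim_content (r / 3) (A \<inter> ball x r) \<le> ennreal (\<delta> * vol x r / r)}" for k
  \<comment> \<open>Radii up to \<open>3 * R k\<close> must stay below \<open>1 / Suc k\<close>.\<close>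
  define R where "R k = 1 / (4 * real (Suc k))" for k
  have R: "0 < R k" "R k \<le> 1" "3 * R k < 1 / real (Suc k)" for k
    by (auto simp: R_def field_simps)
  have "\<exists>q :: nat \<Rightarrow> 'a. (\<Union>i. ball (q i) (R k / 2)) = UNIV" for k
    using covering_sequence[of "R k / 2"] R(1)[of k] by (metis half_gt_zero)
  then obtain q :: "nat \<Rightarrow> nat \<Rightarrow> 'a" where q: "\<And>k. (\<Union>i. ball (q k i) (R k / 2)) = UNIV" by metis
  define F where "F k i = T' k \<inter> ball (q k i) (R k / 2)" for k i
  have "\<exists>h>0. codim_content (R k) (A \<inter> (\<Union>f\<in>F k i. ball f h)) \<le> ennreal (e * (1/2) ^ Suc n)" for k i n
  proof (rule codim_content_neighbourhoods_vanish[OF R(1) _ \<delta>])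
    show "F k i \<subseteq> ball (q k i) (R k / 2)" by (auto simp: F_def)
    show "0 < e * (1/2) ^ Suc n" using e by simp
    fix f r assume "f \<in> F k i" "0 < r" "r \<le> 3 * R k"
    then show "codim_content (r / 3) (A \<inter> ball f r) \<le> ennreal (\<delta> * vol f r / r)"
      using R(3)[of k] by (auto simp: F_def T'_def)
  qed
  then obtain h where h: "\<And>k i n. 0 < h k i n"
    "\<And>k i n. codim_content (R k) (A \<inter> (\<Union>f\<in>F k i. ball f (h k i n))) \<le> ennreal (e * (1/2) ^ Suc n)"
    by metis
  define V where "V n = (case prod_decode n of (k, i) \<Rightarrow> \<Union>f\<in>F k i. ball f (h k i n))" for n
  define W where "W = (\<Union>n. V n)"
  show ?thesis
  proof (intro exI[of _ W] conjI)
    show "open W" unfolding W_def V_def case_prod_unfold by (intro open_UN ballI open_ball)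
    show "T \<subseteq> W"
    proof
      fix x assume "x \<in> T"
      then obtain r0 where r0: "0 < r0" "\<And>r. 0 < r \<Longrightarrow> r < r0 \<Longrightarrow> codim_content (r / 3) (A \<inter> ball x r) \<le> ennreal (\<delta> * vol x r / r)"
        using thin by blast
      obtain k where "inverse (real (Suc k)) < r0" using reals_Archimedean[OF r0(1)] by auto
      then have "x \<in> T' k" using r0(2) by (auto simp: T'_def inverse_eq_divide)
      moreover obtain i where "x \<in> ball (q k i) (R k / 2)" using q[of k] by blast
      ultimately have "x \<in> F k i" by (simp add: F_def)
      then have "x \<in> V (prod_encode (k, i))" using h(1) by (auto simp: V_def intro!: bexI[of _ x])
      then show "x \<in> W" by (auto simp: W_def)
    qed
    have V: "codim_content 1 (V n \<inter> A) \<le> ennreal (e * (1/2) ^ Suc n)" for n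
    proof -
      obtain k i where ki: "prod_decode n = (k, i)" by (cases "prod_decode n")
      have "codim_content 1 (V n \<inter> A) \<le> codim_content (R k) (V n \<inter> A)" by (rule codim_content_antimono) (rule R)
      also have "\<dots> \<le> ennreal (e * (1/2) ^ Suc n)" using h(2)[of k i n] by (simp add: V_def ki Int_commute)
      finally show ?thesis .
    qed
    have "codim_content 1 (W \<inter> A) = codim_content 1 (\<Union>n. V n \<inter> A)" by (simp add: W_def)
    also have "\<dots> \<le> (\<Sum>n. codim_content 1 (V n \<inter> A))" by (rule codim_content_countable_subadditive)
    also have "\<dots> \<le> (\<Sum>n. ennreal (e * (1/2) ^ Suc n))" by (intro suminf_le V) auto
    also have "\<dots> = ennreal (e * 1)"
      by (rule suminf_ennreal_eq[OF _ sums_mult[OF power_half_series, of e]]) (use e in simp)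
    finally show "codim_content 1 (W \<inter> A) \<le> ennreal e" by simp
  qed
qed

end

section \<open>Capacity is bounded by content\<close>

lemma N11_norm_le_upper_gradient:
  assumes "upper_gradient u g"
  shows "N11_norm \<mu> u \<le> (\<integral>\<^sup>+ x. e2ennreal \<bar>u x\<bar> \<partial>outer_to_measure \<mu>) + (\<integral>\<^sup>+ x. g x \<partial>outer_to_measure \<mu>)"
proof -
  have "modulus1 \<mu> {} \<le> (\<integral>\<^sup>+ x. 0 \<partial>outer_to_measure \<mu>)"
    unfolding modulus1_def by (rule INF_lower) auto
  then have "weak_upper_gradient \<mu> u g"
    using assms unfolding weak_upper_gradient_def upper_gradient_def by (intro conjI exI[of _ "{}"]) auto
  then show ?thesis
    unfolding N11_norm_def by (intro add_left_mono INF_lower) auto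
qed

text \<open>A path that starts where the tent is positive stays in the dilated ball at least up to parameter \<open>2 \<rho>\<close>,
which is long enough for a function of slope \<open>1 / \<rho>\<close> and height one.\<close>
lemma (in doubling_measure) tent_path_upper_gradient:
  fixes c :: 'a
  assumes "0 < \<rho>"
  shows "path_upper_gradient (\<lambda>y. max 0 (min 1 (2 - dist c y / \<rho>)))
    (\<lambda>y. ennreal (1 / \<rho>) * indicator (ball c (4 * \<rho>)) y)" (is "path_upper_gradient ?f ?g")
proof (rule path_upper_gradientI)
  show "?g \<in> borel_measurable borel"
    by (intro borel_measurable_times_ennreal borel_measurable_const borel_measurable_indicator) auto
  fix \<sigma> :: "real \<Rightarrow> 'a" and len :: real
  assume s: "0 \<le> len" "1-lipschitz_on {0..len} \<sigma>" and lt: "?f (\<sigma> len) < ?f (\<sigma> 0)"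
  have "dist c (\<sigma> 0) < 2 * \<rho>"
  proof (rule ccontr)
    assume "\<not> dist c (\<sigma> 0) < 2 * \<rho>"
    then have "2 \<le> dist c (\<sigma> 0) / \<rho>" using assms by (simp add: field_simps)
    then have "?f (\<sigma> 0) = 0" by simp
    then show False using lt by simp
  qed
  then have near: "\<sigma> l \<in> ball c (4 * \<rho>)" if "l \<in> {0..min len (2 * \<rho>)}" for l
    using lipschitz_onD[OF s(2), of 0 l] that dist_triangle[of c "\<sigma> l" "\<sigma> 0"] by (simp add: dist_real_def)
  have "?f (\<sigma> 0) - ?f (\<sigma> len) \<le> 1 / \<rho> * min len (2 * \<rho>)"
  proof -
    have "?f (\<sigma> 0) - ?f (\<sigma> len) \<le> 1" by simp
    moreover have "?f (\<sigma> 0) - ?f (\<sigma> len) \<le> len / \<rho>"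
    proof -
      have "dist c (\<sigma> len) \<le> dist c (\<sigma> 0) + len"
        using lipschitz_onD[OF s(2), of 0 len] s(1) dist_triangle[of c "\<sigma> len" "\<sigma> 0"] by (simp add: dist_real_def)
      then have "dist c (\<sigma> len) / \<rho> \<le> dist c (\<sigma> 0) / \<rho> + len / \<rho>"
        using assms by (simp add: divide_right_mono flip: add_divide_distrib)
      moreover have "0 \<le> len / \<rho>" using s assms by simp
      ultimately show ?thesis by (auto simp: max_def min_def)
    qed
    ultimately show ?thesis using assms by (auto simp: min_def)
  qed
  then have "ennreal (?f (\<sigma> 0) - ?f (\<sigma> len)) \<le> ennreal (1 / \<rho> * min len (2 * \<rho>))" by (rule ennreal_leI)
  also have "\<dots> = (\<integral>\<^sup>+ l. ennreal (1 / \<rho>) * indicator {0..min len (2 * \<rho>)} l \<partial>lborel)"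
    using s assms by (subst nn_integral_cmult_indicator) (auto simp: ennreal_mult[symmetric])
  also have "\<dots> \<le> path_int ?g \<sigma> 0 len"
    unfolding path_int_def using near by (intro nn_integral_mono) (auto simp: indicator_def)
  finally show "ennreal (?f (\<sigma> 0) - ?f (\<sigma> len)) \<le> path_int ?g \<sigma> 0 len" .
qed

text \<open>The supremum of the tents over the balls of the cover has the sum of their gradients as an upper
gradient.  Since the radii are at most one, the integral of the function is controlled by the same sum.\<close>
lemma (in doubling_measure) Cap1_le_cover:
  assumes M: "M = outer_to_measure \<mu>" and \<rho>: "\<And>i. \<rho> i \<le> 1" and S: "S \<subseteq> (\<Union>i. ball (c i) (\<rho> i))"
  shows "Cap1 \<mu> S \<le> ennreal (2 * D ^ 2) * (\<Sum>i. ennreal (vol (c i) (\<rho> i) / \<rho> i))"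
proof -
  let ?\<Sigma> = "\<Sum>i. ennreal (vol (c i) (\<rho> i) / \<rho> i)"
  define \<phi> where "\<phi> i y = (if 0 < \<rho> i then max 0 (min 1 (2 - dist (c i) y / \<rho> i)) else 0)" for i y
  define g' where "g' i y = (if 0 < \<rho> i then ennreal (1 / \<rho> i) * indicator (ball (c i) (4 * \<rho> i)) y else 0)" for i y
  define u where "u y = (SUP i. \<phi> i y)" for y
  define g where "g y = (\<Sum>i. g' i y)" for y
  have \<phi>01: "0 \<le> \<phi> i y" "\<phi> i y \<le> 1" for i y by (auto simp: \<phi>_def)
  have bdd: "bdd_above (range (\<lambda>i. \<phi> i y))" for y using \<phi>01 by (intro bdd_aboveI[of _ 1]) auto
  have \<phi>u: "\<phi> i y \<le> u y" for i y unfolding u_def by (rule cSUP_upper[OF _ bdd]) simp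
  have u01: "0 \<le> u y" "u y \<le> 1" for y
    using \<phi>u[of 0 y] \<phi>01(1)[of 0 y] \<phi>01(2) by (auto simp: u_def intro!: cSUP_least)
  have g'm[measurable]: "g' i \<in> borel_measurable borel" for i
    unfolding g'_def[abs_def]
    by (cases "0 < \<rho> i") (auto intro!: borel_measurable_times_ennreal borel_measurable_indicator)
  have gm[measurable]: "g \<in> borel_measurable borel" unfolding g_def[abs_def] by measurable
  have \<phi>m[measurable]: "\<phi> i \<in> borel_measurable borel" for i
    unfolding \<phi>_def[abs_def] by (cases "0 < \<rho> i") (auto intro!: borel_measurable_continuous_onI continuous_intros)
  have um[measurable]: "u \<in> borel_measurable borel"
    unfolding u_def[abs_def] using bdd by (intro borel_measurable_cSUP) auto
  have g'g: "g' i y \<le> g y" for i y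
  proof -
    have "sum (\<lambda>i. g' i y) {i} \<le> (\<Sum>i. g' i y)" by (rule sum_le_suminf) auto
    then show ?thesis by (simp add: g_def)
  qed
  have \<phi>g: "path_upper_gradient (\<phi> i) g" for i
  proof (rule path_upper_gradientI[OF gm])
    fix \<sigma> :: "real \<Rightarrow> 'a" and len :: real
    assume s: "0 \<le> len" "1-lipschitz_on {0..len} \<sigma>" and lt: "\<phi> i (\<sigma> len) < \<phi> i (\<sigma> 0)"
    then have "0 < \<rho> i" by (auto simp: \<phi>_def split: if_splits)
    then have "\<phi> i = (\<lambda>y. max 0 (min 1 (2 - dist (c i) y / \<rho> i)))"
      "g' i = (\<lambda>y. ennreal (1 / \<rho> i) * indicator (ball (c i) (4 * \<rho> i)) y)" by (auto simp: \<phi>_def g'_def)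
    then have "path_upper_gradient (\<phi> i) (g' i)" using tent_path_upper_gradient[OF \<open>0 < \<rho> i\<close>, of "c i"] by simp
    then have "ennreal \<bar>\<phi> i (\<sigma> 0) - \<phi> i (\<sigma> len)\<bar> \<le> path_int (g' i) \<sigma> 0 len"
      using s unfolding path_upper_gradient_def by blast
    also have "\<dots> \<le> path_int g \<sigma> 0 len"
      unfolding path_int_def by (intro nn_integral_mono mult_right_mono g'g) auto
    finally show "ennreal (\<phi> i (\<sigma> 0) - \<phi> i (\<sigma> len)) \<le> path_int g \<sigma> 0 len" using lt by simp
  qed
  have "path_upper_gradient u g"
  proof (rule path_upper_gradientI[OF gm])
    fix \<sigma> :: "real \<Rightarrow> 'a" and len :: real
    assume s: "0 \<le> len" "1-lipschitz_on {0..len} \<sigma>" and lt: "u (\<sigma> len) < u (\<sigma> 0)"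
    show "ennreal (u (\<sigma> 0) - u (\<sigma> len)) \<le> path_int g \<sigma> 0 len"
    proof (cases "path_int g \<sigma> 0 len")
      case (real p)
      have "u (\<sigma> 0) \<le> u (\<sigma> len) + p"
        unfolding u_def[of "\<sigma> 0"]
      proof (rule cSUP_least)
        fix i
        have "ennreal \<bar>\<phi> i (\<sigma> 0) - \<phi> i (\<sigma> len)\<bar> \<le> ennreal p"
          using \<phi>g[of i] s real unfolding path_upper_gradient_def by metis
        then have "\<bar>\<phi> i (\<sigma> 0) - \<phi> i (\<sigma> len)\<bar> \<le> p" using real by (subst (asm) ennreal_le_iff) auto
        then show "\<phi> i (\<sigma> 0) \<le> u (\<sigma> len) + p" using \<phi>u[of i "\<sigma> len"] by linarith
      qed simp
      then show ?thesis using real by (auto intro: ennreal_leI)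
    qed simp
  qed
  then have ug: "upper_gradient (\<lambda>y. ereal (u y)) g" by (rule path_upper_gradient_imp_upper_gradient)
  have vol4: "vol (c i) (4 * \<rho> i) \<le> D ^ 2 * vol (c i) (\<rho> i)" if "0 < \<rho> i" for i
    using vol_double_iterate[OF that, of "c i" 2] by simp
  have ball4: "ball (c i) (4 * \<rho> i) \<in> sets M" for i by (intro open_M) auto
  have "(\<integral>\<^sup>+ x. ennreal (u x) \<partial>M) \<le> (\<integral>\<^sup>+ x. (\<Sum>i. indicator (ball (c i) (4 * \<rho> i)) x) \<partial>M)"
  proof (rule nn_integral_mono)
    fix x
    show "ennreal (u x) \<le> (\<Sum>i. indicator (ball (c i) (4 * \<rho> i)) x)"
    proof (cases "\<exists>i. 0 < \<phi> i x")
      case True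
      then obtain i where i: "0 < \<phi> i x" by blast
      then have "0 < \<rho> i" by (auto simp: \<phi>_def split: if_splits)
      moreover have "dist (c i) x < 4 * \<rho> i"
      proof (rule ccontr)
        assume "\<not> dist (c i) x < 4 * \<rho> i"
        then have "2 \<le> dist (c i) x / \<rho> i" using \<open>0 < \<rho> i\<close> by (simp add: field_simps)
        then show False using i by (simp add: \<phi>_def split: if_splits)
      qed
      ultimately have "ennreal (u x) \<le> sum (\<lambda>i. indicator (ball (c i) (4 * \<rho> i)) x) {i}"
        using u01(2)[of x] by (simp add: ennreal_le_1)
      also have "\<dots> \<le> (\<Sum>i. indicator (ball (c i) (4 * \<rho> i)) x)" by (rule sum_le_suminf) auto
      finally show ?thesis .
    next
      case False
      then have "u x \<le> 0" unfolding u_def by (intro cSUP_least) (auto simp: not_less)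
      then show ?thesis by (simp add: ennreal_neg)
    qed
  qed
  also have "\<dots> = (\<Sum>i. emeasure M (ball (c i) (4 * \<rho> i)))"
    using ball4 by (subst nn_integral_suminf) (auto intro!: borel_measurable_indicator)
  also have "\<dots> \<le> (\<Sum>i. ennreal (D ^ 2) * ennreal (vol (c i) (\<rho> i) / \<rho> i))"
  proof (rule suminf_le)
    fix i
    show "emeasure M (ball (c i) (4 * \<rho> i)) \<le> ennreal (D ^ 2) * ennreal (vol (c i) (\<rho> i) / \<rho> i)"
    proof (cases "0 < \<rho> i")
      case True
      have "vol (c i) (\<rho> i) * \<rho> i \<le> vol (c i) (\<rho> i) * 1" using \<rho> by (intro mult_left_mono) auto
      then have "vol (c i) (\<rho> i) \<le> vol (c i) (\<rho> i) / \<rho> i" using True by (simp add: field_simps)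
      then have "D ^ 2 * vol (c i) (\<rho> i) \<le> D ^ 2 * (vol (c i) (\<rho> i) / \<rho> i)" by (intro mult_left_mono) auto
      then show ?thesis using vol4[OF True]
        by (simp add: emeasure_ball ennreal_mult[symmetric] vol_div_nonneg ennreal_leI del: times_divide_eq_right)
    qed (simp add: ball_empty)
  qed auto
  finally have 1: "(\<integral>\<^sup>+ x. ennreal (u x) \<partial>M) \<le> ennreal (D ^ 2) * ?\<Sigma>" by simp
  have "(\<integral>\<^sup>+ x. g x \<partial>M) = (\<Sum>i. \<integral>\<^sup>+ x. g' i x \<partial>M)"
    unfolding g_def by (rule nn_integral_suminf) (rule borel_measurable_M[OF g'm])
  also have "\<dots> \<le> (\<Sum>i. ennreal (D ^ 2) * ennreal (vol (c i) (\<rho> i) / \<rho> i))"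
  proof (rule suminf_le)
    fix i
    show "(\<integral>\<^sup>+ x. g' i x \<partial>M) \<le> ennreal (D ^ 2) * ennreal (vol (c i) (\<rho> i) / \<rho> i)"
    proof (cases "0 < \<rho> i")
      case True
      have "(\<integral>\<^sup>+ x. g' i x \<partial>M) = ennreal (1 / \<rho> i) * ennreal (vol (c i) (4 * \<rho> i))"
        unfolding g'_def using True ball4[of i] by (simp add: nn_integral_cmult_indicator emeasure_ball)
      also have "\<dots> = ennreal (vol (c i) (4 * \<rho> i) / \<rho> i)" using True by (simp add: ennreal_mult[symmetric])
      also have "\<dots> \<le> ennreal (D ^ 2 * vol (c i) (\<rho> i) / \<rho> i)"
        using vol4[OF True] True by (intro ennreal_leI divide_right_mono) auto
      finally show ?thesis by (simp add: ennreal_mult[symmetric] vol_div_nonneg)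
    qed (simp add: g'_def)
  qed auto
  finally have 2: "(\<integral>\<^sup>+ x. g x \<partial>M) \<le> ennreal (D ^ 2) * ?\<Sigma>" by simp
  have norm: "N11_norm \<mu> (\<lambda>y. ereal (u y)) \<le> ennreal (2 * D ^ 2) * ?\<Sigma>"
  proof -
    have "N11_norm \<mu> (\<lambda>y. ereal (u y)) \<le> (\<integral>\<^sup>+ x. ennreal (u x) \<partial>M) + (\<integral>\<^sup>+ x. g x \<partial>M)"
      using N11_norm_le_upper_gradient[OF ug, of \<mu>] u01(1) by (simp add: M)
    also have "\<dots> \<le> ennreal (D ^ 2) * ?\<Sigma> + ennreal (D ^ 2) * ?\<Sigma>" using 1 2 by (rule add_mono)
    also have "\<dots> = (ennreal (D ^ 2) + ennreal (D ^ 2)) * ?\<Sigma>" by (rule distrib_right[symmetric])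
    also have "ennreal (D ^ 2) + ennreal (D ^ 2) = ennreal (2 * D ^ 2)"
      by (subst ennreal_plus[symmetric]) auto
    finally show ?thesis .
  qed
  show ?thesis
  proof (cases "?\<Sigma> = top")
    case True
    then show ?thesis using D_ge_1 by (simp add: ennreal_mult_top)
  next
    case False
    then have "N11_norm \<mu> (\<lambda>y. ereal (u y)) < \<infinity>"
      using norm by (auto simp: less_top[symmetric] ennreal_mult_eq_top_iff top_unique)
    moreover have "(\<lambda>y. ereal (u y)) \<in> borel_measurable (outer_to_measure \<mu>)"
      using borel_measurable_M[OF um] by (simp add: M)
    moreover have "1 \<le> ereal (u y)" if y: "y \<in> S" for y
    proof -
      obtain i where i: "dist (c i) y < \<rho> i" using S y by auto
      then have "0 < \<rho> i" by (metis le_less_trans zero_le_dist)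
      then have "dist (c i) y / \<rho> i \<le> 1" using i by (simp add: field_simps)
      then have "\<phi> i y = 1" using \<open>0 < \<rho> i\<close> by (simp add: \<phi>_def)
      then show ?thesis using \<phi>u[of i y] by simp
    qed
    ultimately have "Cap1 \<mu> S \<le> N11_norm \<mu> (\<lambda>y. ereal (u y))"
      unfolding Cap1_def N11_def by (intro INF_lower) auto
    then show ?thesis using norm by (rule order_trans)
  qed
qed

section \<open>Two-level form of the Poincare inequality\<close>

text \<open>The Poincare inequality enters only in this form: if a function with values in \<open>[0,1]\<close> takes both extreme values
on a proportion \<open>a\<close> of a ball, then its gradient is large near that ball.\<close>
locale poincare_space = doubling_measure M D for M :: "'a::complete_space measure" and D +
  fixes C \<tau> :: real
  assumes C_pos: "0 < C" and \<tau>_ge_1: "1 \<le> \<tau>"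
    and two_level: "\<And>w g x s a. path_upper_gradient w g \<Longrightarrow> w \<in> borel_measurable borel \<Longrightarrow>
      (\<And>y. 0 \<le> w y \<and> w y \<le> 1) \<Longrightarrow> 0 < s \<Longrightarrow>
      a * vol x s \<le> measure M ({y. w y = 0} \<inter> ball x s) \<Longrightarrow>
      a * vol x s \<le> measure M ({y. w y = 1} \<inter> ball x s) \<Longrightarrow>
      ennreal (a * vol x (\<tau> * s)) \<le> ennreal (C * s) * (\<integral>\<^sup>+ y \<in> ball x (\<tau> * s). g y \<partial>M)"

text \<open>Whatever the mean value is, one of the two extreme values differs from it by at least 1/2.\<close>
lemma (in doubling_measure) poincare_space_of_poincare_1_1:
  assumes M: "M = outer_to_measure \<mu>" and \<mu>: "\<And>x r. \<mu> (ball x r) = ennreal (vol x r)"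
    and P: "poincare_1_1 \<mu>"
  shows "\<exists>C \<tau>. poincare_space M D C \<tau>"
proof -
  obtain C \<tau> where C: "0 < C" "1 \<le> \<tau>" and P': "\<And>x r u g. 0 < r \<Longrightarrow> u \<in> L1_loc \<mu> \<Longrightarrow> upper_gradient u g \<Longrightarrow>
     (\<integral>\<^sup>+ y \<in> ball x r. e2ennreal \<bar>u y - ereal (ball_mean \<mu> u x r)\<bar> \<partial>M) / \<mu> (ball x r)
          \<le> ennreal (C * r) * ((\<integral>\<^sup>+ y \<in> ball x (\<tau> * r). g y \<partial>M) / \<mu> (ball x (\<tau> * r)))"
    using P unfolding poincare_1_1_def M by blast
  have "poincare_space M D (2 * C) \<tau>"
  proof (unfold_locales)
    show "0 < 2 * C" "1 \<le> \<tau>" using C by auto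
    fix w :: "'a \<Rightarrow> real" and g x and s a :: real
    assume wg: "path_upper_gradient w g" and wm: "w \<in> borel_measurable borel"
      and w: "\<And>y. 0 \<le> w y \<and> w y \<le> 1" and s: "0 < s"
      and 0: "a * vol x s \<le> measure M ({y. w y = 0} \<inter> ball x s)"
      and 1: "a * vol x s \<le> measure M ({y. w y = 1} \<inter> ball x s)"
    let ?I = "\<integral>\<^sup>+ y \<in> ball x (\<tau> * s). g y \<partial>M"
    have vs: "0 < vol x s" "0 < vol x (\<tau> * s)" using s C by (auto intro!: vol_pos mult_pos_pos)
    define m where "m = ball_mean \<mu> (\<lambda>y. ereal (w y)) x s"
    have L1: "(\<lambda>y. ereal (w y)) \<in> L1_loc \<mu>"
      unfolding L1_loc_def M[symmetric]
    proof (intro CollectI conjI allI)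
      show "(\<lambda>y. ereal (w y)) \<in> borel_measurable M" using borel_measurable_M[OF wm] by simp
      fix z
      have "(\<integral>\<^sup>+ y \<in> ball z 1. e2ennreal \<bar>ereal (w y)\<bar> \<partial>M) \<le> (\<integral>\<^sup>+ y. indicator (ball z 1) y \<partial>M)"
        using w by (intro nn_integral_mono) (auto simp: indicator_def ennreal_le_1)
      also have "\<dots> = emeasure M (ball z 1)" by (intro nn_integral_indicator open_M) auto
      also have "\<dots> < \<infinity>" by (rule emeasure_ball_finite)
      finally show "\<exists>r>0. (\<integral>\<^sup>+ y \<in> ball z r. e2ennreal \<bar>ereal (w y)\<bar> \<partial>M) < \<infinity>"
        by (intro exI[of _ 1]) auto
    qed
    have main: "ennreal (a / 2 * vol x s) \<le> (\<integral>\<^sup>+ y \<in> ball x s. e2ennreal \<bar>ereal (w y) - ereal m\<bar> \<partial>M)"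
    proof -
      \<comment> \<open>The extreme value that is further away from the mean.\<close>
      define j :: real where "j = (if 1/2 \<le> m then 0 else 1)"
      let ?S = "{y. w y = j} \<inter> ball x s"
      have S: "?S \<in> sets M"
      proof -
        have "{y \<in> space borel. w y = j} \<in> sets borel" using wm by measurable
        then show ?thesis by (intro sets.Int borel_M) auto
      qed
      have "a * vol x s \<le> measure M ?S" using 0 1 by (simp add: j_def)
      then have "ennreal (a / 2 * vol x s) \<le> ennreal (1 / 2 * measure M ?S)" by (intro ennreal_leI) simp
      also have "\<dots> = ennreal (1 / 2) * emeasure M ?S"
      proof -
        have "emeasure M ?S = ennreal (measure M ?S)"
          by (rule emeasure_eq_measure2) (rule fmeasurable_in_ball[OF _ S, of x s], blast)
        then show ?thesis by (simp only:) (subst ennreal_mult[symmetric], auto)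
      qed
      also have "\<dots> = (\<integral>\<^sup>+ y. ennreal (1 / 2) * indicator ?S y \<partial>M)"
        using S by (simp add: nn_integral_cmult_indicator)
      also have "\<dots> \<le> (\<integral>\<^sup>+ y \<in> ball x s. e2ennreal \<bar>ereal (w y) - ereal m\<bar> \<partial>M)"
      proof (rule nn_integral_mono)
        fix y
        have "ennreal (1 / 2) \<le> ennreal \<bar>w y - m\<bar>" if "y \<in> ?S"
          using that by (intro ennreal_leI) (auto simp: j_def split: if_splits)
        then show "ennreal (1 / 2) * indicator ?S y \<le> e2ennreal \<bar>ereal (w y) - ereal m\<bar> * indicator (ball x s) y"
          by (cases "y \<in> ?S") auto
      qed
      finally show ?thesis .
    qed
    have "ennreal (a / 2) \<le> (\<integral>\<^sup>+ y \<in> ball x s. e2ennreal \<bar>ereal (w y) - ereal m\<bar> \<partial>M) / \<mu> (ball x s)"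
    proof -
      have "ennreal (a / 2) = ennreal (a / 2 * vol x s) / ennreal (vol x s)"
      proof (cases "0 \<le> a")
        case True
        then show ?thesis using vs by (subst divide_ennreal) auto
      next
        case False
        then have "a / 2 * vol x s \<le> 0" using vs by (auto intro!: mult_nonpos_nonneg)
        then show ?thesis using False by (simp add: ennreal_neg)
      qed
      also have "\<dots> \<le> (\<integral>\<^sup>+ y \<in> ball x s. e2ennreal \<bar>ereal (w y) - ereal m\<bar> \<partial>M) / \<mu> (ball x s)"
        unfolding \<mu> by (intro divide_right_mono_ennreal main)
      finally show ?thesis .
    qed
    also have "\<dots> \<le> ennreal (C * s) * (?I / \<mu> (ball x (\<tau> * s)))"
      unfolding m_def by (rule P'[OF s L1 path_upper_gradient_imp_upper_gradient[OF wg]])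
    finally have "ennreal (a / 2) \<le> ennreal (C * s) * (?I / ennreal (vol x (\<tau> * s)))" unfolding \<mu> .
    then have le: "ennreal (a / 2) * ennreal (2 * vol x (\<tau> * s)) \<le>
        ennreal (C * s) * (?I / ennreal (vol x (\<tau> * s))) * ennreal (2 * vol x (\<tau> * s))"
      by (rule mult_right_mono) simp
    have "ennreal (a * vol x (\<tau> * s)) = ennreal (a / 2) * ennreal (2 * vol x (\<tau> * s))"
    proof (cases "0 \<le> a")
      case True
      then show ?thesis using vs by (subst ennreal_mult[symmetric]) auto
    next
      case False
      then have "a * vol x (\<tau> * s) \<le> 0" using vs by (auto intro!: mult_nonpos_nonneg)
      then show ?thesis using False by (simp add: ennreal_neg)
    qed
    also note le
    also have "ennreal (2 * vol x (\<tau> * s)) = ennreal (vol x (\<tau> * s)) * ennreal 2"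
      using vs by (subst ennreal_mult[symmetric]) (auto simp: mult.commute)
    also have "ennreal (C * s) * (?I / ennreal (vol x (\<tau> * s))) * (ennreal (vol x (\<tau> * s)) * ennreal 2) =
       (ennreal (C * s) * ennreal 2) * (?I / ennreal (vol x (\<tau> * s)) * ennreal (vol x (\<tau> * s)))"
      by (simp add: mult_ac)
    also have "?I / ennreal (vol x (\<tau> * s)) * ennreal (vol x (\<tau> * s)) = ?I"
      using vs by (simp add: ennreal_divide_times ennreal_mult_divide_eq)
    also have "ennreal (C * s) * ennreal 2 = ennreal (2 * C * s)"
      using C s by (subst ennreal_mult[symmetric]) (auto simp: mult_ac)
    finally show "ennreal (a * vol x (\<tau> * s)) \<le> ennreal (2 * C * s) * ?I" .
  qed
  then show ?thesis by blast
qed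

section \<open>Selection of a level\<close>

text \<open>Otherwise \<open>G\<close> would grow with slope more than \<open>m\<close> to the right of every point, and running from
\<open>a\<close> to the last point reached with average slope \<open>m\<close> would lead as far as \<open>b\<close>.\<close>
lemma level_selection:
  fixes G :: "real \<Rightarrow> real"
  assumes G: "mono G" and ab: "a < b" and m: "G b - G a < m * (b - a)"
  shows "\<exists>t. a \<le> t \<and> t < b \<and> (\<forall>h0>0. \<exists>h>0. h < h0 \<and> G (t + h) - G t \<le> m * h)"
proof (rule ccontr)
  assume "\<not> ?thesis"
  then have contr: "\<exists>h0>0. \<forall>h>0. h < h0 \<longrightarrow> m * h < G (t + h) - G t" if "a \<le> t" "t < b" for t
    using that by (meson not_le)
  have Gm: "G x \<le> G y" if "x \<le> y" for x y using G that by (simp add: monoD)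
  have "0 < m * (b - a)" using m Gm[of a b] ab by simp
  then have m0: "0 < m" using ab by (simp add: zero_less_mult_iff)
  define S where "S = {t \<in> {a..b}. m * (t - a) \<le> G t - G a}"
  have "a \<in> S" using ab by (simp add: S_def)
  have bdd: "bdd_above S" by (auto simp: S_def)
  define s where "s = Sup S"
  have s: "a \<le> s" "s \<le> b"
    using \<open>a \<in> S\<close> bdd by (auto simp: s_def S_def intro!: cSup_upper cSup_least)
  have "s \<le> a + (G s - G a) / m"
    unfolding s_def
  proof (rule cSup_least)
    fix t assume t: "t \<in> S"
    then have "t \<le> s" unfolding s_def using bdd by (rule cSup_upper)
    then have "m * (t - a) \<le> G s - G a" using t Gm[of t s] by (auto simp: S_def)
    then have "t - a \<le> (G s - G a) / m" using m0 by (simp add: field_simps)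
    then show "t \<le> a + (G (Sup S) - G a) / m" by (simp add: s_def)
  qed (use \<open>a \<in> S\<close> in auto)
  then have sS: "m * (s - a) \<le> G s - G a" using m0 by (simp add: field_simps)
  have "s < b" using sS m s by (cases "s = b") auto
  then obtain h0 where h0: "0 < h0" "\<And>h. 0 < h \<Longrightarrow> h < h0 \<Longrightarrow> m * h < G (s + h) - G s"
    using contr[of s] s by auto
  define h where "h = min (h0 / 2) (b - s)"
  have h: "0 < h" "h < h0" "s + h \<le> b" using h0 \<open>s < b\<close> by (auto simp: h_def)
  have "m * (s + h - a) = m * (s - a) + m * h" by (simp add: algebra_simps)
  also have "\<dots> \<le> G (s + h) - G a" using h0(2)[OF h(1,2)] sS by simp
  finally have "s + h \<in> S" using h s by (auto simp: S_def)
  then have "s + h \<le> s" unfolding s_def using bdd by (rule cSup_upper)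
  then show False using h by simp
qed

section \<open>The boxing inequality\<close>

context poincare_space
begin

text \<open>The Poincare inequality makes the space connected: if the annulus were empty, the indicator of the inner
ball would have upper gradient zero although it is not constant.\<close>
lemma annulus_point:
  fixes x x' :: 'a
  assumes r: "0 < r" "4 * r \<le> dist x x'"
  shows "\<exists>z. 3 * r \<le> dist x z \<and> dist x z \<le> 7 / 2 * r"
proof (rule ccontr)
  assume no: "\<not> ?thesis"
  define w :: "'a \<Rightarrow> real" where "w = indicator (ball x (3 * r))"
  define d where "d = dist x x'"
  have d: "0 < d" "4 * r \<le> d" using r by (auto simp: d_def)
  have wg: "path_upper_gradient w (\<lambda>_. 0)"
  proof (rule path_upper_gradientI)
    fix \<sigma> :: "real \<Rightarrow> 'a" and len :: real
    assume s: "0 \<le> len" "1-lipschitz_on {0..len} \<sigma>" and lt: "w (\<sigma> len) < w (\<sigma> 0)"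
    then have "dist x (\<sigma> 0) \<le> 3 * r" "3 * r \<le> dist x (\<sigma> len)"
      by (auto simp: w_def indicator_def split: if_splits)
    moreover have "continuous_on {0..len} (\<lambda>l. dist x (\<sigma> l))"
      by (intro continuous_intros lipschitz_on_continuous_on[OF s(2)])
    ultimately obtain l where "dist x (\<sigma> l) = 3 * r"
      using IVT'[of "\<lambda>l. dist x (\<sigma> l)" 0 "3 * r" len] s by auto
    then have "\<exists>z. 3 * r \<le> dist x z \<and> dist x z \<le> 7 / 2 * r" using r by (intro exI[of _ "\<sigma> l"]) auto
    then show "ennreal (w (\<sigma> 0) - w (\<sigma> len)) \<le> path_int (\<lambda>_. 0) \<sigma> 0 len" using no by blast
  qed simp
  define b where "b = min (vol x (3 * r)) (vol x' (d / 4))"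
  have b: "0 < b" unfolding b_def using r d by (auto intro!: vol_pos)
  have v: "0 < vol x (2 * d)" "0 < vol x (\<tau> * (2 * d))" using d \<tau>_ge_1 by (auto intro!: vol_pos mult_pos_pos)
  have wm: "w \<in> borel_measurable borel" unfolding w_def by (intro borel_measurable_indicator) auto
  have lev: "{y. w y = j} \<inter> ball x (2 * d) \<in> sets M" for j
  proof -
    have "{y \<in> space borel. w y = j} \<in> sets borel" using wm by measurable
    then show ?thesis by (intro sets.Int borel_M) auto
  qed
  have "ennreal (b / vol x (2 * d) * vol x (\<tau> * (2 * d))) \<le>
      ennreal (C * (2 * d)) * (\<integral>\<^sup>+ y \<in> ball x (\<tau> * (2 * d)). 0 \<partial>M)"
  proof (rule two_level[OF wg wm])
    have "ball x' (d / 4) \<subseteq> {y. w y = 0} \<inter> ball x (2 * d)"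
    proof
      fix y assume "y \<in> ball x' (d / 4)"
      then have y: "dist x' y < d / 4" by simp
      then have "dist x y < 2 * d" using dist_triangle[of x y x'] d(1) unfolding d_def by linarith
      moreover have "3 * r \<le> dist x y" using dist_triangle2[of x x' y] y d unfolding d_def by linarith
      ultimately show "y \<in> {y. w y = 0} \<inter> ball x (2 * d)" by (auto simp: w_def)
    qed
    then have "vol x' (d / 4) \<le> measure M ({y. w y = 0} \<inter> ball x (2 * d))"
      using lev[of 0] by (intro measure_mono_fmeasurable fmeasurable_in_ball[of _ x "2 * d"]) auto
    then show "b / vol x (2 * d) * vol x (2 * d) \<le> measure M ({y. w y = 0} \<inter> ball x (2 * d))"
      using v by (simp add: b_def)
    have "ball x (3 * r) \<subseteq> {y. w y = 1} \<inter> ball x (2 * d)"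
      using d by (auto simp: w_def)
    then have "vol x (3 * r) \<le> measure M ({y. w y = 1} \<inter> ball x (2 * d))"
      using lev[of 1] by (intro measure_mono_fmeasurable fmeasurable_in_ball[of _ x "2 * d"]) auto
    then show "b / vol x (2 * d) * vol x (2 * d) \<le> measure M ({y. w y = 1} \<inter> ball x (2 * d))"
      using v by (simp add: b_def)
  qed (use d in \<open>auto simp: w_def indicator_def\<close>)
  then have "b / vol x (2 * d) * vol x (\<tau> * (2 * d)) \<le> 0" by (simp add: ennreal_eq_0_iff)
  moreover have "0 < b / vol x (2 * d) * vol x (\<tau> * (2 * d))" using b v by simp
  ultimately show False by linarith
qed

text \<open>In each ball the cut-off function for the strip above \<open>t\<close> vanishes where \<open>v \<le> t\<close> and equals one where
\<open>v > t + h\<close>.  The second set exhausts \<open>{v > t}\<close> as \<open>h\<close> tends to zero, so for small \<open>h\<close> it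
has a fixed proportion of the measure in each of the finitely many balls.  The Poincare inequality
bounds each term, and disjointness lets the bounds be added up to the integral of \<open>g\<close> over the strip,
divided by \<open>h\<close>, plus the integral of \<open>g\<close>.\<close>
lemma isoperimetric_sum:
  fixes v :: "'a \<Rightarrow> real" and x :: 'a
  assumes v: "path_upper_gradient v g" "v \<in> borel_measurable borel"
    and I: "(\<integral>\<^sup>+ y \<in> ball x \<rho>. g y \<partial>M) = ennreal I" "0 \<le> I"
    and level: "\<And>h0. 0 < h0 \<Longrightarrow> \<exists>h>0. h < h0 \<and>
      enn2real (\<integral>\<^sup>+ y \<in> ball x \<rho>. g y * indicator {y. v y \<le> t + h} y \<partial>M)
      - enn2real (\<integral>\<^sup>+ y \<in> ball x \<rho>. g y * indicator {y. v y \<le> t} y \<partial>M) \<le> m * h"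
    and F: "finite F" "disjoint_family_on (\<lambda>y. ball y (\<tau> * s y)) F" "\<And>y. y \<in> F \<Longrightarrow> ball y (\<tau> * s y) \<subseteq> ball x \<rho>"
    and s: "\<And>y. y \<in> F \<Longrightarrow> 0 < s y"
    and low: "\<And>y. y \<in> F \<Longrightarrow> measure M ({z. t < v z} \<inter> ball y (s y)) \<le> vol y (s y) / 2"
    and high: "\<And>y. y \<in> F \<Longrightarrow> vol y (s y) / (2 * D) < measure M ({z. t < v z} \<inter> ball y (s y))"
  shows "(\<Sum>y\<in>F. vol y (\<tau> * s y) / s y) \<le> 2 * D * C * (m + I)"
proof -
  have g[measurable]: "g \<in> borel_measurable borel" using v(1) by (simp add: path_upper_gradient_def)
  have above: "{z. r < v z} \<in> sets borel" and below: "{z. v z \<le> r} \<in> sets borel" for r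
  proof -
    have "{z \<in> space borel. r < v z} \<in> sets borel" "{z \<in> space borel. v z \<le> r} \<in> sets borel"
      using v(2) by measurable
    then show "{z. r < v z} \<in> sets borel" "{z. v z \<le> r} \<in> sets borel" by simp_all
  qed
  have aboveM: "{z. r < v z} \<inter> ball y q \<in> sets M" for r y q
    using above by (intro sets.Int borel_M open_M) auto
  have belowM: "{z. v z \<le> r} \<inter> ball y q \<in> sets M" for r y q
    using below by (intro sets.Int borel_M open_M) auto
  have ev: "eventually (\<lambda>n. vol y (s y) / (2 * D) < measure M ({z. t + 1 / real (Suc n) < v z} \<inter> ball y (s y))) sequentially"
    if y: "y \<in> F" for y
  proof -
    have "(\<lambda>n. measure M ({z. t + 1 / real (Suc n) < v z} \<inter> ball y (s y))) \<longlonglongrightarrow>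
        measure M (\<Union>n. {z. t + 1 / real (Suc n) < v z} \<inter> ball y (s y))"
    proof (rule Lim_measure_incseq)
      show "range (\<lambda>n. {z. t + 1 / real (Suc n) < v z} \<inter> ball y (s y)) \<subseteq> sets M" using aboveM by blast
      have "1 / real (Suc j) \<le> 1 / real (Suc i)" if "i \<le> j" for i j
        using that by (intro divide_left_mono) auto
      then show "incseq (\<lambda>n. {z. t + 1 / real (Suc n) < v z} \<inter> ball y (s y))"
        unfolding incseq_def by force
      have "emeasure M (\<Union>n. {z. t + 1 / real (Suc n) < v z} \<inter> ball y (s y)) \<le> emeasure M (ball y (s y))"
        by (intro emeasure_mono open_M) auto
      then show "emeasure M (\<Union>n. {z. t + 1 / real (Suc n) < v z} \<inter> ball y (s y)) \<noteq> \<infinity>"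
        using emeasure_ball_finite[of y "s y"] by (auto simp: top_unique)
    qed
    also have "(\<Union>n. {z. t + 1 / real (Suc n) < v z} \<inter> ball y (s y)) = {z. t < v z} \<inter> ball y (s y)"
    proof -
      have "\<exists>n. t + 1 / real (Suc n) < v z" if "t < v z" for z
        using reals_Archimedean[of "v z - t"] that by (auto simp: inverse_eq_divide algebra_simps)
      moreover have "t < v z" if "t + 1 / real (Suc n) < v z" for z n
      proof -
        have "0 < 1 / real (Suc n)" by simp
        then show ?thesis using that by linarith
      qed
      ultimately show ?thesis by blast
    qed
    finally show ?thesis using high[OF y] by (intro order_tendstoD) auto
  qed
  have "eventually (\<lambda>n. \<forall>y\<in>F. vol y (s y) / (2 * D) < measure M ({z. t + 1 / real (Suc n) < v z} \<inter> ball y (s y))) sequentially"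
    using ev F(1) by (simp add: eventually_ball_finite)
  then obtain n where n: "\<And>y. y \<in> F \<Longrightarrow> vol y (s y) / (2 * D) < measure M ({z. t + 1 / real (Suc n) < v z} \<inter> ball y (s y))"
    by (auto simp: eventually_sequentially)
  define G where "G r = enn2real (\<integral>\<^sup>+ y \<in> ball x \<rho>. g y * indicator {y. v y \<le> r} y \<partial>M)" for r
  obtain h where h: "0 < h" "h < 1 / real (Suc n)" "G (t + h) - G t \<le> m * h"
    using level[of "1 / real (Suc n)"] unfolding G_def by auto
  define w where "w y = max 0 (min 1 ((v y - t) / h))" for y
  define S where "S = {y. t < v y \<and> v y \<le> t + h}"
  define gs where "gs y = ennreal (1 / h) * (g y * indicator S y) + g y" for y
  have wg: "path_upper_gradient w gs"
    using strip_upper_gradient[OF v h(1), of t] by (simp add: w_def[abs_def] gs_def[abs_def] S_def)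
  have wm: "w \<in> borel_measurable borel" unfolding w_def[abs_def] using v(2) by measurable
  have Sm[measurable]: "S \<in> sets borel"
  proof -
    have "S = {z. t < v z} \<inter> {z. v z \<le> t + h}" by (auto simp: S_def)
    then show ?thesis using above below by auto
  qed
  have Gfin: "(\<integral>\<^sup>+ y \<in> ball x \<rho>. g y * indicator {y. v y \<le> r} y \<partial>M) = ennreal (G r)" for r
  proof -
    have "(\<integral>\<^sup>+ y \<in> ball x \<rho>. g y * indicator {y. v y \<le> r} y \<partial>M) \<le> (\<integral>\<^sup>+ y \<in> ball x \<rho>. g y \<partial>M)"
      by (intro nn_integral_mono) (auto simp: indicator_def)
    then have "(\<integral>\<^sup>+ y \<in> ball x \<rho>. g y * indicator {y. v y \<le> r} y \<partial>M) < top"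
      unfolding I(1) by (rule le_less_trans) simp
    then show ?thesis unfolding G_def by simp
  qed
  have bm[measurable]: "indicator (ball x \<rho>) \<in> borel_measurable borel" for x :: 'a and \<rho>
    by (intro borel_measurable_indicator) auto
  have strip: "(\<integral>\<^sup>+ y \<in> ball x \<rho>. g y * indicator S y \<partial>M) = ennreal (G (t + h) - G t)"
  proof -
    have "ennreal (G (t + h)) = (\<integral>\<^sup>+ y. g y * indicator {y. v y \<le> t} y * indicator (ball x \<rho>) y +
        g y * indicator S y * indicator (ball x \<rho>) y \<partial>M)"
      unfolding Gfin[symmetric] using h(1) by (intro nn_integral_cong) (auto simp: indicator_def S_def)
    also have "\<dots> = ennreal (G t) + (\<integral>\<^sup>+ y \<in> ball x \<rho>. g y * indicator S y \<partial>M)"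
      unfolding Gfin[symmetric] using below[of t]
      by (intro nn_integral_add borel_measurable_M borel_measurable_times_ennreal g bm borel_measurable_indicator Sm)
    finally have e: "ennreal (G (t + h)) = ennreal (G t) + (\<integral>\<^sup>+ y \<in> ball x \<rho>. g y * indicator S y \<partial>M)" .
    have "(\<integral>\<^sup>+ y \<in> ball x \<rho>. g y * indicator S y \<partial>M) = ennreal (G (t + h)) - ennreal (G t)"
      unfolding e by (simp add: add.commute)
    then show ?thesis by (simp add: ennreal_minus G_def)
  qed
  have m: "0 \<le> m"
  proof -
    have "ennreal (G t) \<le> ennreal (G (t + h))"
      unfolding Gfin[symmetric] using h(1) by (intro nn_integral_mono) (auto simp: indicator_def)
    then have "G t \<le> G (t + h)" by (subst (asm) ennreal_le_iff) (auto simp: G_def)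
    then have "0 \<le> m * h" using h(3) by linarith
    then show ?thesis using h(1) by (simp add: zero_le_mult_iff)
  qed
  have gsm: "gs \<in> borel_measurable borel" unfolding gs_def[abs_def] by measurable
  have total: "(\<integral>\<^sup>+ y \<in> ball x \<rho>. gs y \<partial>M) \<le> ennreal (m + I)"
  proof -
    have "(\<integral>\<^sup>+ y \<in> ball x \<rho>. gs y \<partial>M) = (\<integral>\<^sup>+ y. ennreal (1 / h) * (g y * indicator S y * indicator (ball x \<rho>) y) + g y * indicator (ball x \<rho>) y \<partial>M)"
      by (intro nn_integral_cong) (auto simp: gs_def indicator_def)
    also have "\<dots> = ennreal (1 / h) * (\<integral>\<^sup>+ y \<in> ball x \<rho>. g y * indicator S y \<partial>M) + (\<integral>\<^sup>+ y \<in> ball x \<rho>. g y \<partial>M)"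
    proof (subst nn_integral_add)
      show "(\<integral>\<^sup>+ y. ennreal (1 / h) * (g y * indicator S y * indicator (ball x \<rho>) y) \<partial>M) + (\<integral>\<^sup>+ y \<in> ball x \<rho>. g y \<partial>M)
          = ennreal (1 / h) * (\<integral>\<^sup>+ y \<in> ball x \<rho>. g y * indicator S y \<partial>M) + (\<integral>\<^sup>+ y \<in> ball x \<rho>. g y \<partial>M)"
        by (subst nn_integral_cmult)
          (intro borel_measurable_M borel_measurable_times_ennreal g bm borel_measurable_indicator Sm, rule refl)
    qed (intro borel_measurable_M borel_measurable_times_ennreal borel_measurable_const g bm borel_measurable_indicator Sm)+
    also have "\<dots> = ennreal (1 / h) * ennreal (G (t + h) - G t) + ennreal I" by (simp only: strip I)
    also have "\<dots> \<le> ennreal (1 / h) * ennreal (m * h) + ennreal I"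
      using h(3) by (intro add_right_mono mult_left_mono ennreal_leI) auto
    also have "ennreal (1 / h) * ennreal (m * h) = ennreal m"
      using h(1) m by (simp add: ennreal_mult[symmetric])
    also have "ennreal m + ennreal I = ennreal (m + I)" using I m by (simp add: ennreal_plus)
    finally show ?thesis .
  qed
  have mI: "0 \<le> m + I" using m I by simp
  have each: "ennreal (vol y (\<tau> * s y) / s y) \<le> ennreal (2 * D * C) * (\<integral>\<^sup>+ z \<in> ball y (\<tau> * s y). gs z \<partial>M)"
    if y: "y \<in> F" for y
  proof -
    have vs: "0 < vol y (s y)" by (rule vol_pos[OF s[OF y]])
    have lev: "{z. w z = j} \<inter> ball y (s y) \<in> sets M" for j
    proof -
      have "{z \<in> space borel. w z = j} \<in> sets borel" using wm by measurable
      then show ?thesis by (intro sets.Int borel_M) auto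
    qed
    have levf: "{z. w z = j} \<inter> ball y (s y) \<in> fmeasurable M" for j
      by (rule fmeasurable_in_ball[OF _ lev]) blast
    have "ennreal (1 / (2 * D) * vol y (\<tau> * s y)) \<le> ennreal (C * s y) * (\<integral>\<^sup>+ z \<in> ball y (\<tau> * s y). gs z \<partial>M)"
    proof (rule two_level[OF wg wm _ s[OF y]])
      show "0 \<le> w z \<and> w z \<le> 1" for z by (auto simp: w_def)
      have "1 / (2 * D) * vol y (s y) \<le> vol y (s y) / 2"
        using D_ge_1 vs by (simp add: field_simps)
      also have "\<dots> \<le> vol y (s y) - measure M ({z. t < v z} \<inter> ball y (s y))" using low[OF y] by simp
      also have "\<dots> = measure M (ball y (s y) - ({z. t < v z} \<inter> ball y (s y)))"
        using aboveM[of t y "s y"] by (subst measurable_measure_Diff) auto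
      also have "\<dots> \<le> measure M ({z. w z = 0} \<inter> ball y (s y))"
      proof (rule measure_mono_fmeasurable)
        show "ball y (s y) - {z. t < v z} \<inter> ball y (s y) \<subseteq> {z. w z = 0} \<inter> ball y (s y)"
        proof
          fix z assume z: "z \<in> ball y (s y) - {z. t < v z} \<inter> ball y (s y)"
          then have "(v z - t) / h \<le> 0" using h(1) by (auto simp: divide_le_0_iff)
          then show "z \<in> {z. w z = 0} \<inter> ball y (s y)" using z by (simp add: w_def)
        qed
      qed (use aboveM open_M levf in auto)
      finally show "1 / (2 * D) * vol y (s y) \<le> measure M ({z. w z = 0} \<inter> ball y (s y))" .
      have "1 / (2 * D) * vol y (s y) \<le> measure M ({z. t + 1 / real (Suc n) < v z} \<inter> ball y (s y))"
        using n[OF y] by simp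
      also have "\<dots> \<le> measure M ({z. w z = 1} \<inter> ball y (s y))"
      proof (rule measure_mono_fmeasurable)
        show "{z. t + 1 / real (Suc n) < v z} \<inter> ball y (s y) \<subseteq> {z. w z = 1} \<inter> ball y (s y)"
        proof
          fix z assume z: "z \<in> {z. t + 1 / real (Suc n) < v z} \<inter> ball y (s y)"
          then have "h \<le> v z - t" using h(2) by auto
          then have "1 \<le> (v z - t) / h" using h(1) by simp
          then show "z \<in> {z. w z = 1} \<inter> ball y (s y)" using z by (simp add: w_def)
        qed
      qed (use aboveM levf in auto)
      finally show "1 / (2 * D) * vol y (s y) \<le> measure M ({z. w z = 1} \<inter> ball y (s y))" .
    qed
    then have "ennreal (2 * D / s y) * ennreal (1 / (2 * D) * vol y (\<tau> * s y)) \<le>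
        ennreal (2 * D / s y) * (ennreal (C * s y) * (\<integral>\<^sup>+ z \<in> ball y (\<tau> * s y). gs z \<partial>M))"
      by (rule mult_left_mono) simp
    also have "\<dots> = (ennreal (2 * D / s y) * ennreal (C * s y)) * (\<integral>\<^sup>+ z \<in> ball y (\<tau> * s y). gs z \<partial>M)"
      by (simp only: mult.assoc)
    also have "ennreal (2 * D / s y) * ennreal (C * s y) = ennreal (2 * D * C)"
      using s[OF y] D_ge_1 C_pos by (subst ennreal_mult[symmetric]) auto
    finally have "ennreal (2 * D / s y) * ennreal (1 / (2 * D) * vol y (\<tau> * s y)) \<le>
        ennreal (2 * D * C) * (\<integral>\<^sup>+ z \<in> ball y (\<tau> * s y). gs z \<partial>M)" .
    moreover have "ennreal (2 * D / s y) * ennreal (1 / (2 * D) * vol y (\<tau> * s y)) = ennreal (vol y (\<tau> * s y) / s y)"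
      using s[OF y] D_ge_1 by (subst ennreal_mult[symmetric]) auto
    ultimately show ?thesis by simp
  qed
  have "ennreal (\<Sum>y\<in>F. vol y (\<tau> * s y) / s y) = (\<Sum>y\<in>F. ennreal (vol y (\<tau> * s y) / s y))"
    using s by (subst sum_ennreal) (auto intro!: divide_nonneg_pos)
  also have "\<dots> \<le> (\<Sum>y\<in>F. ennreal (2 * D * C) * (\<integral>\<^sup>+ z \<in> ball y (\<tau> * s y). gs z \<partial>M))"
    by (intro sum_mono each)
  also have "\<dots> = ennreal (2 * D * C) * (\<Sum>y\<in>F. \<integral>\<^sup>+ z \<in> ball y (\<tau> * s y). gs z \<partial>M)"
    by (rule sum_distrib_left[symmetric])
  also have "(\<Sum>y\<in>F. \<integral>\<^sup>+ z \<in> ball y (\<tau> * s y). gs z \<partial>M) = (\<integral>\<^sup>+ z. (\<Sum>y\<in>F. gs z * indicator (ball y (\<tau> * s y)) z) \<partial>M)"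
    by (rule nn_integral_sum[symmetric]) (intro borel_measurable_M borel_measurable_times_ennreal gsm bm)
  also have "\<dots> \<le> (\<integral>\<^sup>+ z \<in> ball x \<rho>. gs z \<partial>M)"
  proof (rule nn_integral_mono)
    fix z
    show "(\<Sum>y\<in>F. gs z * indicator (ball y (\<tau> * s y)) z) \<le> gs z * indicator (ball x \<rho>) z"
    proof (cases "\<exists>y\<in>F. z \<in> ball y (\<tau> * s y)")
      case True
      then obtain y where y: "y \<in> F" "z \<in> ball y (\<tau> * s y)" by blast
      have "(\<Sum>y\<in>F. gs z * indicator (ball y (\<tau> * s y)) z) = (\<Sum>y'\<in>{y}. gs z * indicator (ball y' (\<tau> * s y')) z)"
      proof (rule sum.mono_neutral_right[OF F(1)])
        show "{y} \<subseteq> F" using y by simp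
        show "\<forall>i\<in>F - {y}. gs z * indicator (ball i (\<tau> * s i)) z = 0"
        proof
          fix i assume "i \<in> F - {y}"
          then have "ball i (\<tau> * s i) \<inter> ball y (\<tau> * s y) = {}" using F(2) y unfolding disjoint_family_on_def by blast
          then show "gs z * indicator (ball i (\<tau> * s i)) z = 0" using y(2) by (auto simp: indicator_def)
        qed
      qed
      also have "\<dots> = gs z * indicator (ball y (\<tau> * s y)) z"
        by (simp only: sum.insert finite.emptyI empty_iff not_False_eq_True sum.empty add_0_right)
      also have "\<dots> \<le> gs z * indicator (ball x \<rho>) z"
        using F(3)[OF y(1)] by (intro mult_left_mono) (auto simp: indicator_def)
      finally show ?thesis .
    next
      case False
      then have "(\<Sum>y\<in>F. gs z * indicator (ball y (\<tau> * s y)) z) = 0" by (intro sum.neutral) (auto simp: indicator_def)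
      then show ?thesis by simp
    qed
  qed
  also note total
  finally have "ennreal (\<Sum>y\<in>F. vol y (\<tau> * s y) / s y) \<le> ennreal (2 * D * C) * ennreal (m + I)"
    by (simp add: mult_left_mono)
  also have "\<dots> = ennreal (2 * D * C * (m + I))"
    using D_ge_1 C_pos mI by (subst ennreal_mult[symmetric]) auto
  finally show ?thesis
    using D_ge_1 C_pos mI by (subst (asm) ennreal_le_iff) auto
qed

text \<open>Halve the radius until \<open>U\<close> has more than half of the measure of the ball, and take the last
ball before that.\<close>
lemma density_scale:
  fixes U :: "'a set" and y :: 'a
  assumes U: "open U" "y \<in> U" and s0: "0 < s0" and top: "measure M (U \<inter> ball y s0) \<le> vol y s0 / 2"
  shows "\<exists>s. 0 < s \<and> s \<le> s0 \<and> measure M (U \<inter> ball y s) \<le> vol y s / 2 \<and> vol y s / (2 * D) < measure M (U \<inter> ball y s)"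
proof -
  define P where "P j \<longleftrightarrow> vol y (s0 / 2 ^ j) / 2 < measure M (U \<inter> ball y (s0 / 2 ^ j))" for j :: nat
  have UM: "U \<inter> ball y r \<in> sets M" for r using U(1) by (intro open_M) auto
  obtain e where e: "0 < e" "ball y e \<subseteq> U" using U openE by blast
  obtain j where "s0 / e < 2 ^ j" using real_arch_pow[of 2 "s0 / e"] by auto
  then have "s0 / 2 ^ j < e" using e(1) by (simp add: field_simps)
  then have "U \<inter> ball y (s0 / 2 ^ j) = ball y (s0 / 2 ^ j)" using e(2) by auto
  moreover have "0 < vol y (s0 / 2 ^ j)" using s0 by (intro vol_pos) auto
  ultimately have "P j" by (simp add: P_def)
  then have ex: "\<exists>j. P j" ..
  have "\<not> P 0" using top by (simp add: P_def)
  define k where "k = (LEAST j. P j)"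
  have "P k" unfolding k_def using ex by (rule LeastI_ex)
  then obtain i where k: "k = Suc i" using \<open>\<not> P 0\<close> by (cases k) auto
  then have "\<not> P i" using not_less_Least[of i P] by (simp add: k_def)
  define s where "s = s0 / 2 ^ i"
  have s: "0 < s" "s \<le> s0" using s0 by (auto simp: s_def field_simps)
  have half: "s0 / 2 ^ k = s / 2" by (simp add: s_def k)
  have "vol y s / D \<le> vol y (s / 2)"
    using vol_double[of "s / 2" y] s D_ge_1 by (simp add: field_simps)
  then have "vol y s / (2 * D) \<le> vol y (s / 2) / 2" by simp
  also have "\<dots> < measure M (U \<inter> ball y (s / 2))" using \<open>P k\<close> by (simp add: P_def half)
  also have "\<dots> \<le> measure M (U \<inter> ball y s)"
    using s UM by (intro measure_mono_fmeasurable fmeasurable_in_ball[of "U \<inter> ball y s" y s]) auto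
  finally show ?thesis using \<open>\<not> P i\<close> s by (intro exI[of _ s]) (auto simp: P_def s_def)
qed

text \<open>The set \<open>E\<close> lies in the open set \<open>{v > t}\<close> for the potential \<open>v\<close> of \<open>g\<close>.  Since \<open>v\<close> vanishes outside
\<open>B(x,2r)\<close>, in particular on a ball of comparable measure, and \<open>g\<close> is small, \<open>{v > t}\<close> has small density at the scale of \<open>r\<close>.  So
each point of \<open>E\<close> has a smaller ball of intermediate density, and these balls are selected by a
Vitali covering.\<close>
lemma boxing:
  assumes two: "\<exists>x y :: 'a. x \<noteq> y"
  shows "\<exists>C0>0. \<exists>\<delta>0>0. \<forall>x :: 'a. \<exists>r0>0. \<forall>r \<delta> E g. 0 < r \<longrightarrow> r < r0 \<longrightarrow> 0 < \<delta> \<longrightarrow> \<delta> \<le> \<delta>0 \<longrightarrow> E \<subseteq> ball x r \<longrightarrow>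
    g \<in> borel_measurable borel \<longrightarrow> (\<integral>\<^sup>+ y. g y \<partial>M) < ennreal (\<delta> * vol x r / r) \<longrightarrow>
    separates g E (ball x (2 * r)) \<longrightarrow>
    codim_content (r / 3) E \<le> ennreal (C0 * \<delta> * vol x r / r)"
proof -
  \<comment> \<open>The ball \<open>B(x,4r)\<close> is compared with balls of radius \<open>s0 = r / (9 * \<tau>)\<close> around points of \<open>B(x,r)\<close>: \<open>5 r = 45 \<tau> s0\<close>.\<close>
  obtain n :: nat where n: "45 * \<tau> < 2 ^ n" using real_arch_pow[of 2 "45 * \<tau>"] by auto
  have n4: "4 \<le> n"
  proof (rule ccontr)
    assume "\<not> 4 \<le> n"
    then have "(2::real) ^ n \<le> 2 ^ 3" by (intro power_increasing) auto
    then show False using n \<tau>_ge_1 by simp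
  qed
  define \<kappa> where "\<kappa> = 1 / (2 * D ^ n)"
  have Dn: "0 < D ^ n" using D_ge_1 by simp
  have \<kappa>: "0 < \<kappa>" using Dn by (simp add: \<kappa>_def)
  have \<kappa>4: "\<kappa> * D ^ 4 \<le> 1"
  proof -
    have "D ^ 4 \<le> D ^ n" using n4 D_ge_1 by (rule power_increasing)
    then show ?thesis using Dn by (simp add: \<kappa>_def field_simps)
  qed
  define \<delta>0 where "\<delta>0 = \<kappa> / (20 * C)"
  define C0 where "C0 = 18 * C * D ^ 3"
  have pos: "0 < C0" "0 < \<delta>0" using C_pos D_ge_1 \<kappa> by (auto simp: C0_def \<delta>0_def)
  have "\<exists>r0>0. \<forall>r \<delta> E g. 0 < r \<longrightarrow> r < r0 \<longrightarrow> 0 < \<delta> \<longrightarrow> \<delta> \<le> \<delta>0 \<longrightarrow> E \<subseteq> ball x r \<longrightarrow>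
    g \<in> borel_measurable borel \<longrightarrow> (\<integral>\<^sup>+ y. g y \<partial>M) < ennreal (\<delta> * vol x r / r) \<longrightarrow>
    separates g E (ball x (2 * r)) \<longrightarrow>
    codim_content (r / 3) E \<le> ennreal (C0 * \<delta> * vol x r / r)" for x :: 'a
  proof -
    obtain x' where "x' \<noteq> x" using two by metis
    define r0 where "r0 = dist x x' / 4"
    have "0 < r0" using \<open>x' \<noteq> x\<close> by (simp add: r0_def)
    moreover have "codim_content (r / 3) E \<le> ennreal (C0 * \<delta> * vol x r / r)"
      if r: "0 < r" "r < r0" and \<delta>: "0 < \<delta>" "\<delta> \<le> \<delta>0" and E: "E \<subseteq> ball x r"
        and g: "g \<in> borel_measurable borel" and g_int: "(\<integral>\<^sup>+ y. g y \<partial>M) < ennreal (\<delta> * vol x r / r)"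
        and sep: "separates g E (ball x (2 * r))"
      for r \<delta> E g
    proof -
      have \<tau>r: "r \<le> \<tau> * r" using \<tau>_ge_1 r(1) by simp
      define B where "B = \<tau> * (4 * r)"
      have "(\<integral>\<^sup>+ y \<in> ball x B. g y \<partial>M) \<le> (\<integral>\<^sup>+ y. g y \<partial>M)"
        by (intro nn_integral_mono) (auto simp: indicator_def)
      then have gB: "(\<integral>\<^sup>+ y \<in> ball x B. g y \<partial>M) < ennreal (\<delta> * vol x r / r)" using g_int by (rule le_less_trans)
      obtain v g' c where v: "path_upper_gradient v g'" "\<And>y. 0 \<le> v y" "\<And>y. v y \<le> 1"
        "\<And>y. y \<in> E \<Longrightarrow> v y = 1" "\<And>y. y \<notin> ball x (2 * r) \<Longrightarrow> v y = 0" "\<And>t. open {y. t < v y}"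
        "(\<integral>\<^sup>+ y \<in> ball x B. g' y \<partial>M) < ennreal (\<delta> * vol x r / r)" "0 < c" "\<And>y. ennreal c \<le> g' y"
        by (rule potential_function[OF g open_ball[of x "2 * r"] gB sep]) blast+
      have vm: "v \<in> borel_measurable borel" using v(6) by (rule lsc_borel_measurable)
      have g'm: "g' \<in> borel_measurable borel" using v(1) by (simp add: path_upper_gradient_def)
      define I where "I = enn2real (\<integral>\<^sup>+ y \<in> ball x B. g' y \<partial>M)"
      have I: "(\<integral>\<^sup>+ y \<in> ball x B. g' y \<partial>M) = ennreal I" "0 \<le> I"
        using less_trans[OF v(7) ennreal_less_top] by (auto simp: I_def)
      have I_less: "I < \<delta> * vol x r / r"
        using v(7) I by (simp add: ennreal_less_iff)
      have I_pos: "0 < I"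
      proof -
        have "ennreal (c * vol x B) = (\<integral>\<^sup>+ y \<in> ball x B. ennreal c \<partial>M)"
          using v(8) by (simp add: nn_integral_cmult_indicator emeasure_ball ennreal_mult)
        also have "\<dots> \<le> ennreal I" unfolding I(1)[symmetric]
          using v(9) by (intro nn_integral_mono mult_right_mono) auto
        finally have "c * vol x B \<le> I" using I(2) by (subst (asm) ennreal_le_iff) auto
        moreover have "0 < c * vol x B" using v(8) r \<tau>_ge_1 by (auto simp: B_def intro!: mult_pos_pos vol_pos)
        ultimately show ?thesis by linarith
      qed
      have levM: "{y. t < v y} \<inter> ball y' q \<in> sets M" for t y' q using v(6) by (intro open_M) auto
      have top: "measure M ({y. 1 / 4 < v y} \<inter> ball x (4 * r)) < \<kappa> * vol x (4 * r)"
      proof (rule ccontr)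
        assume "\<not> ?thesis"
        then have big: "\<kappa> * vol x (4 * r) \<le> measure M ({y. 1 / 4 < v y} \<inter> ball x (4 * r))" by simp
        obtain z where z: "3 * r \<le> dist x z" "dist x z \<le> 7 / 2 * r"
          using annulus_point[of r x x'] r by (auto simp: r0_def)
        \<comment> \<open>If \<open>{v > 1/4}\<close> were large, the Poincare inequality on \<open>B(x,4r)\<close> would contradict the smallness of \<open>g\<close>.\<close>
        define w where "w y = max 0 (min 1 ((v y - 0) / (1 / 4)))" for y
        define gs where "gs y = ennreal (1 / (1 / 4)) * (g' y * indicator {y. 0 < v y \<and> v y \<le> 0 + 1 / 4} y) + g' y" for y
        have wg: "path_upper_gradient w gs"
          unfolding w_def[abs_def] gs_def[abs_def] by (rule strip_upper_gradient[OF v(1) vm]) simp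
        have wm: "w \<in> borel_measurable borel" unfolding w_def[abs_def] using vm by measurable
        have lev: "{y. w y = j} \<inter> ball x (4 * r) \<in> fmeasurable M" for j
        proof -
          have "{y \<in> space borel. w y = j} \<in> sets borel" using wm by measurable
          then show ?thesis by (intro fmeasurable_in_ball[of _ x "4 * r"] sets.Int borel_M) auto
        qed
        have "ennreal (\<kappa> * vol x (\<tau> * (4 * r))) \<le> ennreal (C * (4 * r)) * (\<integral>\<^sup>+ y \<in> ball x (\<tau> * (4 * r)). gs y \<partial>M)"
        proof (rule two_level[OF wg wm])
          show "0 \<le> w y \<and> w y \<le> 1" for y by (auto simp: w_def)
          show "0 < 4 * r" using r by simp
          have "\<kappa> * vol x (4 * r) \<le> \<kappa> * (D ^ 4 * vol z (r / 2))"
            using z r \<kappa> by (intro mult_left_mono vol_compare) auto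
          also have "\<dots> = (\<kappa> * D ^ 4) * vol z (r / 2)" by simp
          also have "\<dots> \<le> 1 * vol z (r / 2)" using \<kappa>4 by (intro mult_right_mono) auto
          also have "\<dots> \<le> measure M ({y. w y = 0} \<inter> ball x (4 * r))"
          proof -
            have "ball z (r / 2) \<subseteq> {y. w y = 0} \<inter> ball x (4 * r)"
            proof
              fix y assume "y \<in> ball z (r / 2)"
              then have y: "dist z y < r / 2" by simp
              have "dist x y < 4 * r" using dist_triangle[of x y z] y z by simp
              moreover have "y \<notin> ball x (2 * r)" using dist_triangle2[of x z y] y z r by simp
              ultimately show "y \<in> {y. w y = 0} \<inter> ball x (4 * r)" using v(5)[of y] by (simp add: w_def)
            qed
            then have "vol z (r / 2) \<le> measure M ({y. w y = 0} \<inter> ball x (4 * r))"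
              using lev by (intro measure_mono_fmeasurable open_M) auto
            then show ?thesis by simp
          qed
          finally show "\<kappa> * vol x (4 * r) \<le> measure M ({y. w y = 0} \<inter> ball x (4 * r))" .
          note big
          also have "measure M ({y. 1 / 4 < v y} \<inter> ball x (4 * r)) \<le> measure M ({y. w y = 1} \<inter> ball x (4 * r))"
            by (rule measure_mono_fmeasurable[OF _ levM lev]) (auto simp: w_def)
          finally show "\<kappa> * vol x (4 * r) \<le> measure M ({y. w y = 1} \<inter> ball x (4 * r))" .
        qed
        also have "(\<integral>\<^sup>+ y \<in> ball x (\<tau> * (4 * r)). gs y \<partial>M) \<le> (\<integral>\<^sup>+ y. ennreal 5 * (g' y * indicator (ball x B) y) \<partial>M)"
        proof (rule nn_integral_mono)
          fix y
          have "ennreal 4 * g' y + g' y = ennreal 5 * g' y"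
          proof -
            have "ennreal 5 = ennreal 4 + ennreal 1" by (subst ennreal_plus[symmetric]) auto
            then show ?thesis by (simp only: distrib_right ennreal_1 mult_1)
          qed
          moreover have "g' y \<le> ennreal 4 * g' y + g' y" by simp
          ultimately show "gs y * indicator (ball x (\<tau> * (4 * r))) y \<le> ennreal 5 * (g' y * indicator (ball x B) y)"
            by (auto simp: gs_def indicator_def B_def)
        qed
        also have "\<dots> = ennreal 5 * ennreal I"
          unfolding I(1)[symmetric]
          by (intro nn_integral_cmult borel_measurable_M borel_measurable_times_ennreal g'm borel_measurable_indicator) auto
        also have "ennreal (C * (4 * r)) * (ennreal 5 * ennreal I) = ennreal (20 * C * r * I)"
          using C_pos r I(2) by (simp add: ennreal_mult[symmetric] mult_ac del: ennreal_numeral)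
        finally have "ennreal (\<kappa> * vol x (\<tau> * (4 * r))) \<le> ennreal (20 * C * r * I)"
          by (simp only: mult_left_mono zero_le)
        then have le: "\<kappa> * vol x (\<tau> * (4 * r)) \<le> 20 * C * r * I"
          using C_pos r I(2) by (subst (asm) ennreal_le_iff) auto
        have "20 * C * r * I < 20 * C * r * (\<delta> * vol x r / r)"
          using C_pos r I_less by (intro mult_strict_left_mono) auto
        also have "\<dots> = 20 * C * \<delta> * vol x r" using r by simp
        also have "\<dots> \<le> 20 * C * \<delta>0 * vol x r"
          using C_pos \<delta> by (intro mult_right_mono mult_left_mono) auto
        also have "\<dots> = \<kappa> * vol x r" using C_pos by (simp add: \<delta>0_def)
        also have "\<dots> \<le> \<kappa> * vol x (\<tau> * (4 * r))"
        proof (intro mult_left_mono measure_mono_ball open_M subset_ball)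
          have "\<tau> * (4 * r) = 4 * (\<tau> * r)" by simp
          then show "r \<le> \<tau> * (4 * r)" using \<tau>r r by linarith
        qed (use \<kappa> in auto)
        finally show False using le by linarith
      qed
      define G where "G s = enn2real (\<integral>\<^sup>+ y \<in> ball x B. g' y * indicator {y. v y \<le> s} y \<partial>M)" for s
      have Gfin: "(\<integral>\<^sup>+ y \<in> ball x B. g' y * indicator {y. v y \<le> s} y \<partial>M) \<le> ennreal I" for s
        unfolding I(1)[symmetric] by (intro nn_integral_mono) (auto simp: indicator_def)
      have Gtop: "(\<integral>\<^sup>+ y \<in> ball x B. g' y * indicator {y. v y \<le> s} y \<partial>M) < top" for s
        using Gfin ennreal_less_top by (rule le_less_trans)
      have "mono G"
      proof (rule monoI)
        fix s s' :: real assume "s \<le> s'"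
        then show "G s \<le> G s'" unfolding G_def using Gtop[of s']
          by (intro enn2real_mono nn_integral_mono) (auto simp: indicator_def)
      qed
      moreover have "G (1 / 2) - G (1 / 4) < 8 * I * (1 / 2 - 1 / 4)"
      proof -
        have "G (1 / 2) \<le> I" unfolding G_def using enn2real_mono[OF Gfin[of "1/2"]] I(2) by simp
        moreover have "0 \<le> G (1 / 4)" by (simp add: G_def)
        ultimately show ?thesis using I_pos by simp
      qed
      ultimately obtain t where t: "1 / 4 \<le> t" "t < 1 / 2" and
        level: "\<And>h0. 0 < h0 \<Longrightarrow> \<exists>h>0. h < h0 \<and> G (t + h) - G t \<le> 8 * I * h"
        using level_selection[of G "1 / 4" "1 / 2" "8 * I"] by auto
      \<comment> \<open>Dilation by \<open>\<tau>\<close> and the factor 3 of the Vitali covering bring this radius to \<open>r / 3\<close>.\<close>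
      define s0 where "s0 = r / (9 * \<tau>)"
      have s0: "0 < s0" "\<tau> * s0 = r / 9" "s0 \<le> r"
        using r \<tau>_ge_1 \<tau>r by (auto simp: s0_def field_simps)
      define U where "U = {y. t < v y}"
      have "\<exists>s. 0 < s \<and> s \<le> s0 \<and> measure M (U \<inter> ball y s) \<le> vol y s / 2 \<and> vol y s / (2 * D) < measure M (U \<inter> ball y s)"
        if y: "y \<in> E" for y
      proof (rule density_scale[OF _ _ s0(1)])
        have dy: "dist x y < r" using E y by auto
        show "open U" unfolding U_def by (rule v(6))
        show "y \<in> U" using v(4)[OF y] t by (simp add: U_def)
        have "measure M (U \<inter> ball y s0) \<le> measure M ({y. 1 / 4 < v y} \<inter> ball x (4 * r))"
        proof (rule measure_mono_fmeasurable)
          show "U \<inter> ball y s0 \<subseteq> {y. 1 / 4 < v y} \<inter> ball x (4 * r)"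
          proof
            fix z assume z: "z \<in> U \<inter> ball y s0"
            then have "dist x z < 4 * r" using dist_triangle[of x z y] dy s0(3) r by simp
            then show "z \<in> {y. 1 / 4 < v y} \<inter> ball x (4 * r)" using z t by (auto simp: U_def)
          qed
          show "U \<inter> ball y s0 \<in> sets M" unfolding U_def by (rule levM)
          show "{y. 1 / 4 < v y} \<inter> ball x (4 * r) \<in> fmeasurable M"
            by (rule fmeasurable_in_ball[OF _ levM, of _ _ _ x "4 * r"]) blast
        qed
        also have "\<dots> \<le> \<kappa> * vol x (4 * r)" using top by simp
        also have "\<dots> \<le> \<kappa> * (D ^ n * vol y s0)"
        proof (intro mult_left_mono vol_compare s0)
          have "5 * r = 45 * \<tau> * s0" using s0(2) by simp
          also have "\<dots> \<le> 2 ^ n * s0" using n s0(1) by (intro mult_right_mono) auto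
          finally show "dist x y + 4 * r \<le> 2 ^ n * s0" using dy by simp
        qed (use \<kappa> in auto)
        also have "\<dots> = vol y s0 / 2" using Dn D_ge_1 by (simp add: \<kappa>_def)
        finally show "measure M (U \<inter> ball y s0) \<le> vol y s0 / 2" .
      qed
      then obtain s where s: "\<And>y. y \<in> E \<Longrightarrow> 0 < s y" "\<And>y. y \<in> E \<Longrightarrow> s y \<le> s0"
        "\<And>y. y \<in> E \<Longrightarrow> measure M (U \<inter> ball y (s y)) \<le> vol y (s y) / 2"
        "\<And>y. y \<in> E \<Longrightarrow> vol y (s y) / (2 * D) < measure M (U \<inter> ball y (s y))" by metis
      have \<tau>s: "0 < \<tau> * s y \<and> \<tau> * s y \<le> r / 9" if "y \<in> E" for y
        using s(1,2)[OF that] \<tau>_ge_1 s0(2) mult_left_mono[of "s y" s0 \<tau>] by auto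
      obtain S where S: "S \<subseteq> E" "disjoint_family_on (\<lambda>y. ball y (\<tau> * s y)) S"
        "E \<subseteq> (\<Union>y\<in>S. ball y (3 * (\<tau> * s y)))"
        by (rule vitali_covering[of E "\<lambda>y. \<tau> * s y" "r / 9", OF \<tau>s])
      have sub: "ball y (\<tau> * s y) \<subseteq> ball x B" if "y \<in> S" for y
      proof
        fix z assume "z \<in> ball y (\<tau> * s y)"
        moreover have "dist x y < r" using that S(1) E by auto
        ultimately have "dist x z < 4 * r"
          using dist_triangle[of x z y] \<tau>s[of y] that S(1) r by (auto simp: subset_eq)
        moreover have "B = 4 * (\<tau> * r)" by (simp add: B_def)
        ultimately have "dist x z < B" using \<tau>r by linarith
        then show "z \<in> ball x B" by simp
      qed
      have "countable S"
        by (rule countable_disjoint_balls[OF S(2) sub]) (use \<tau>s S(1) in auto)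
      then have "codim_content (r / 3) E \<le> ennreal (D ^ 2 * (2 * D * C * (8 * I + I)))"
      proof (rule codim_content_le_countable[OF _ _ _ S(3)])
        show "3 * (\<tau> * s y) \<le> r / 3" if "y \<in> S" for y using \<tau>s[of y] that S(1) by auto
        show "0 < r / 3" using r by simp
        fix F assume F: "finite F" "F \<subseteq> S"
        have "(\<Sum>y\<in>F. vol y (3 * (\<tau> * s y)) / (3 * (\<tau> * s y))) \<le> (\<Sum>y\<in>F. D ^ 2 * (vol y (\<tau> * s y) / s y))"
        proof (rule sum_mono)
          fix y assume "y \<in> F"
          then have y: "0 < s y" "0 < \<tau> * s y" using F S(1) s(1)[of y] \<tau>s[of y] by auto
          have "vol y (3 * (\<tau> * s y)) \<le> D ^ 2 * vol y (\<tau> * s y)" using y by (intro vol_compare) auto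
          then have "vol y (3 * (\<tau> * s y)) / (3 * (\<tau> * s y)) \<le> D ^ 2 * vol y (\<tau> * s y) / (3 * (\<tau> * s y))"
            using y by (intro divide_right_mono) auto
          also have "\<dots> \<le> D ^ 2 * vol y (\<tau> * s y) / s y"
          proof (rule divide_left_mono)
            have "1 * s y \<le> \<tau> * s y" using \<tau>_ge_1 y by (intro mult_right_mono) auto
            then show "s y \<le> 3 * (\<tau> * s y)" using y by simp
          qed (use y in auto)
          finally show "vol y (3 * (\<tau> * s y)) / (3 * (\<tau> * s y)) \<le> D ^ 2 * (vol y (\<tau> * s y) / s y)" by simp
        qed
        also have "\<dots> = D ^ 2 * (\<Sum>y\<in>F. vol y (\<tau> * s y) / s y)" by (rule sum_distrib_left[symmetric])
        also have "\<dots> \<le> D ^ 2 * (2 * D * C * (8 * I + I))"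
        proof (rule mult_left_mono)
          have FE: "y \<in> E" "y \<in> S" if "y \<in> F" for y using that F S(1) by auto
          show "(\<Sum>y\<in>F. vol y (\<tau> * s y) / s y) \<le> 2 * D * C * (8 * I + I)"
            by (rule isoperimetric_sum[OF v(1) vm I level[unfolded G_def] F(1) disjoint_family_on_mono[OF F(2) S(2)]
                  sub[OF FE(2)] s(1)[OF FE(1)] s(3)[OF FE(1), unfolded U_def] s(4)[OF FE(1), unfolded U_def]])
        qed simp
        finally show "(\<Sum>y\<in>F. vol y (3 * (\<tau> * s y)) / (3 * (\<tau> * s y))) \<le> D ^ 2 * (2 * D * C * (8 * I + I))" .
      qed
      also have "\<dots> \<le> ennreal (C0 * \<delta> * vol x r / r)"
      proof (rule ennreal_leI)
        have "D ^ 2 * (2 * D * C * (8 * I + I)) = C0 * I" by (simp add: C0_def power2_eq_square power3_eq_cube)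
        also have "\<dots> \<le> C0 * (\<delta> * vol x r / r)" using pos I_less by (intro mult_left_mono) auto
        finally show "D ^ 2 * (2 * D * C * (8 * I + I)) \<le> C0 * \<delta> * vol x r / r" by simp
      qed
      finally show ?thesis .
    qed
    ultimately show ?thesis by (intro exI[of _ r0]) blast
  qed
  then show ?thesis using pos by (intro exI[of _ C0] conjI exI[of _ \<delta>0]) auto
qed

end

section \<open>The Choquet property\<close>

lemma one_le_ext_diff: "1 \<le> p \<Longrightarrow> 1 \<le> ext_diff p 0"
  by (cases p) (auto simp: ext_diff_def one_ennreal.rep_eq intro!: ennreal_leI simp flip: ennreal_1)

theorem theorem6p14:
  fixes \<mu> :: "'a::complete_space set \<Rightarrow> ennreal" and A :: "'a set" and \<epsilon> :: real
  assumes "\<exists>x y :: 'a. x \<noteq> y"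
    and "borel_regular_outer_measure \<mu>"
    and "doubling \<mu>"
    and "poincare_1_1 \<mu>"
    and "\<epsilon> > 0"
  shows "\<exists>W. open W \<and> W \<union> base1 \<mu> A = UNIV \<and> Cap1 \<mu> (W \<inter> A) < ennreal \<epsilon>"
proof -
  define M where "M = outer_to_measure \<mu>"
  have oms: "outer_measure_space UNIV \<mu>" and bl: "sets borel \<subseteq> lambda_system UNIV UNIV \<mu>"
    using assms(2) by (auto simp: borel_regular_outer_measure_def)
  obtain D where D: "1 \<le> D" and dbl: "\<And>x r. 0 < r \<Longrightarrow> 0 < \<mu> (ball x (2 * r)) \<and>
      \<mu> (ball x (2 * r)) \<le> ennreal D * \<mu> (ball x r) \<and> ennreal D * \<mu> (ball x r) < \<infinity>"
    using assms(3) unfolding doubling_def by blast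
  have \<mu>M: "emeasure M (ball x r) = \<mu> (ball x r)" for x r
    unfolding M_def by (rule emeasure_outer_to_measure[OF oms]) (use bl in auto)
  interpret doubling_measure M D
  proof
    show "sets borel \<subseteq> sets M" using bl by (simp add: M_def sets_outer_to_measure[OF oms])
    show "space M = UNIV" by (simp add: M_def)
    show "1 \<le> D" by fact
    show "0 < emeasure M (ball x r)" if "0 < r" for x r
      using dbl[of "r / 2" x] that by (simp add: \<mu>M)
    show "emeasure M (ball x (2 * r)) \<le> ennreal D * emeasure M (ball x r)" if "0 < r" for x r
      using dbl[OF that] by (simp add: \<mu>M)
    show "emeasure M (ball x r) < \<infinity>" for x r
    proof (cases "0 < r")
      case True
      have "1 * \<mu> (ball x r) \<le> ennreal D * \<mu> (ball x r)" using D by (intro mult_right_mono) auto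
      also have "\<dots> < \<infinity>" using dbl[OF True] by blast
      finally show ?thesis by (simp add: \<mu>M)
    qed (simp add: ball_empty)
  qed
  have \<mu>_ball: "\<mu> (ball x r) = ennreal (vol x r)" for x r
    using emeasure_ball[of x r] by (simp add: \<mu>M)
  obtain C \<tau> where "poincare_space M D C \<tau>"
    using poincare_space_of_poincare_1_1[OF M_def \<mu>_ball assms(4)] by blast
  then interpret poincare_space M D C \<tau> .
  obtain C0 \<delta>0 where C0: "0 < C0" "0 < \<delta>0" and
    box: "\<And>x :: 'a. \<exists>r0>0. \<forall>r \<delta> E g. 0 < r \<longrightarrow> r < r0 \<longrightarrow> 0 < \<delta> \<longrightarrow> \<delta> \<le> \<delta>0 \<longrightarrow> E \<subseteq> ball x r \<longrightarrow>
    g \<in> borel_measurable borel \<longrightarrow> (\<integral>\<^sup>+ y. g y \<partial>M) < ennreal (\<delta> * vol x r / r) \<longrightarrow>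
    separates g E (ball x (2 * r)) \<longrightarrow>
    codim_content (r / 3) E \<le> ennreal (C0 * \<delta> * vol x r / r)"
    using boxing[OF assms(1)] by blast
  \<comment> \<open>The second bound is what the covering argument needs to gain its factor 1/2.\<close>
  define \<delta> where "\<delta> = min \<delta>0 (3 / (2 * C0 * D ^ 3))"
  have D3: "0 < D ^ 3" using D by simp
  have \<delta>: "0 < \<delta>" "\<delta> \<le> \<delta>0" using C0 D3 by (auto simp: \<delta>_def)
  have \<delta>D: "C0 * \<delta> * D ^ 3 \<le> 3 / 2"
  proof -
    have "\<delta> * (C0 * D ^ 3) \<le> 3 / (2 * C0 * D ^ 3) * (C0 * D ^ 3)"
      unfolding \<delta>_def using C0 D3 by (intro mult_right_mono) auto
    also have "\<dots> = 3 / 2" using C0 D3 D by simp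
    finally show ?thesis by (simp add: mult_ac)
  qed
  have thin: "\<exists>r0>0. \<forall>r. 0 < r \<longrightarrow> r < r0 \<longrightarrow> codim_content (r / 3) (A \<inter> ball x r) \<le> ennreal (C0 * \<delta> * vol x r / r)"
    if x: "x \<in> - base1 \<mu> A" for x
  proof -
    obtain r1 where r1: "0 < r1" and box1: "\<forall>r \<delta> E g. 0 < r \<longrightarrow> r < r1 \<longrightarrow> 0 < \<delta> \<longrightarrow> \<delta> \<le> \<delta>0 \<longrightarrow> E \<subseteq> ball x r \<longrightarrow>
      g \<in> borel_measurable borel \<longrightarrow> (\<integral>\<^sup>+ y. g y \<partial>M) < ennreal (\<delta> * vol x r / r) \<longrightarrow>
      separates g E (ball x (2 * r)) \<longrightarrow> codim_content (r / 3) E \<le> ennreal (C0 * \<delta> * vol x r / r)"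
      using box[of x] by (elim exE conjE)
    have "thin1 \<mu> A x" using x by (simp add: base1_def)
    then have "eventually (\<lambda>r. ennreal r * (rel_cap1 \<mu> (A \<inter> ball x r) (ball x (2 * r)) / \<mu> (ball x r)) < ennreal \<delta>) (at_right 0)"
      unfolding thin1_def using \<delta> by (intro order_tendstoD) auto
    then obtain r2 where r2: "0 < r2" "\<And>r. 0 < r \<Longrightarrow> r < r2 \<Longrightarrow>
        ennreal r * (rel_cap1 \<mu> (A \<inter> ball x r) (ball x (2 * r)) / \<mu> (ball x r)) < ennreal \<delta>"
      unfolding eventually_at_right_field by blast
    have "codim_content (r / 3) (A \<inter> ball x r) \<le> ennreal (C0 * \<delta> * vol x r / r)" if r: "0 < r" "r < min r1 r2" for r
    proof -
      let ?cap = "rel_cap1 \<mu> (A \<inter> ball x r) (ball x (2 * r))"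
      have v: "0 < vol x r" using r by (intro vol_pos)
      have "?cap < ennreal (\<delta> * vol x r / r)"
      proof (rule ccontr)
        assume "\<not> ?cap < ennreal (\<delta> * vol x r / r)"
        then have "ennreal r * (ennreal (\<delta> * vol x r / r) / ennreal (vol x r)) \<le> ennreal r * (?cap / \<mu> (ball x r))"
          unfolding \<mu>_ball by (intro mult_left_mono divide_right_mono_ennreal) auto
        also have "\<dots> < ennreal \<delta>" using r2(2)[of r] r by simp
        also have "ennreal r * (ennreal (\<delta> * vol x r / r) / ennreal (vol x r)) = ennreal \<delta>"
          using r v \<delta> by (simp add: divide_ennreal ennreal_mult[symmetric])
        finally show False by simp
      qed
      then obtain p where p: "case p of (u, g) \<Rightarrow> u \<in> N11 \<mu> \<and> (\<forall>y\<in>A \<inter> ball x r. 1 \<le> u y) \<and>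
          (\<forall>y\<in>- ball x (2 * r). u y = 0) \<and> upper_gradient u g"
          "(case p of (u, g) \<Rightarrow> \<integral>\<^sup>+ y. g y \<partial>M) < ennreal (\<delta> * vol x r / r)"
        unfolding rel_cap1_def INF_less_iff M_def[symmetric] mem_Collect_eq by (elim bexE) simp
      obtain u g where "p = (u, g)" by (cases p)
      with p have ug: "\<forall>y\<in>A \<inter> ball x r. 1 \<le> u y" "\<forall>y\<in>- ball x (2 * r). u y = 0"
        and u: "upper_gradient u g" "(\<integral>\<^sup>+ y. g y \<partial>M) < ennreal (\<delta> * vol x r / r)"
        by simp_all
      show ?thesis
      proof (rule box1[rule_format, OF r(1) _ \<delta>, where g = g])
        show "g \<in> borel_measurable borel" using u(1) by (simp add: upper_gradient_def)
        show "separates g (A \<inter> ball x r) (ball x (2 * r))"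
          unfolding separates_def
        proof (intro allI impI, elim conjE)
          fix \<sigma> :: "real \<Rightarrow> 'a" and len :: real
          assume s: "0 \<le> len" "1-lipschitz_on {0..len} \<sigma>" "\<sigma> 0 \<in> A \<inter> ball x r" "\<sigma> len \<notin> ball x (2 * r)"
          have "\<sigma> 0 \<noteq> \<sigma> len" using s(3,4) r by auto
          then have "ext_diff (u (\<sigma> 0)) (u (\<sigma> len)) \<le> path_int g \<sigma> 0 len"
            by (rule upper_gradient_path_int[OF u(1) s(2,1)])
          moreover have "1 \<le> ext_diff (u (\<sigma> 0)) (u (\<sigma> len))"
            using one_le_ext_diff[of "u (\<sigma> 0)"] ug s(3,4) by simp
          ultimately show "1 \<le> path_int g \<sigma> 0 len" by (rule order_trans[rotated])
        qed
      qed (use r u in auto)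
    qed
    then show ?thesis using r1 r2(1) by (intro exI[of _ "min r1 r2"]) auto
  qed
  define e where "e = \<epsilon> / (4 * D ^ 2)"
  have e: "0 < e" using assms(5) D by (simp add: e_def)
  obtain W where W: "open W" "- base1 \<mu> A \<subseteq> W" "codim_content 1 (W \<inter> A) \<le> ennreal (e / 2)"
    using codim_content_choquet[OF _ \<delta>D, of "e / 2" "- base1 \<mu> A" A] thin C0 \<delta> e by auto
  have "codim_content 1 (W \<inter> A) < ennreal e"
    using W(3) by (rule le_less_trans) (use e in \<open>auto intro: ennreal_lessI\<close>)
  then obtain c \<rho> where c: "\<And>i. \<rho> i \<le> 1" "W \<inter> A \<subseteq> (\<Union>i. ball (c i) (\<rho> i))"
    "(\<Sum>i. ennreal (vol (c i) (\<rho> i) / \<rho> i)) < ennreal e"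
    by (rule codim_content_lessE) blast
  have "Cap1 \<mu> (W \<inter> A) \<le> ennreal (2 * D ^ 2) * (\<Sum>i. ennreal (vol (c i) (\<rho> i) / \<rho> i))"
    by (rule Cap1_le_cover[OF M_def c(1,2)])
  also have "\<dots> \<le> ennreal (2 * D ^ 2) * ennreal e" using c(3) by (intro mult_left_mono) auto
  also have "\<dots> = ennreal (\<epsilon> / 2)" using e D by (subst ennreal_mult[symmetric]) (auto simp: e_def)
  also have "\<dots> < ennreal \<epsilon>" using assms(5) by (intro ennreal_lessI) auto
  finally have "Cap1 \<mu> (W \<inter> A) < ennreal \<epsilon>" .
  then show ?thesis using W by (intro exI[of _ W]) auto
qed

end
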